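(* Let $\omega$, $L$ and $\sigma$ be as described in the context. Let $f\in L^q(\mathbb T^2;\mathbb C)$ with $q>2+\sigma$, and put $$\alpha=\frac{2-r-\mu}{r},\qquad r=\frac{q}{q-1},\qquad \mu=\frac{\sigma}{\sigma+1}.$$ Then the equation $Lu=f$ has a solution $u\in C^\alpha(\mathbb T^2;\mathbb C)$ if and only if $\displaystyle\int_{\mathbb T^2}f\,dx\,dy=0$.
   Context: Setting. Let $\mathbb T^2=\mathbb R^2/\mathbb Z^2$ with coordinates $(x,y)$ and covering map $\Pi:\mathbb R^2\to\mathbb T^2$. Let $\omega=a\,dx+b\,dy$ be a nowhere vanishing closed complex-valued one-form on $\mathbb T^2$ with $a,b\in C^{1+\varepsilon}(\mathbb T^2;\mathbb C)$, $\varepsilon>0$, such that: (a) the set $\Sigma=\{p\in\mathbb T^2:\ \omega(p)\wedge\overline{\omega(p)}=0\}$ is a one-dimensional (embedded) manifold, with connected components $\Sigma_1,\dots,\Sigma_N$; (b) for each $i$ there is a number $\sigma_i>0$ such that every $p\in\Sigma_i$ has a neighborhood in which $\omega\wedge\overline\omega=|\rho_i|^{\sigma_i}g\,dx\wedge dy$, where $\rho_i$ is a (real-valued) defining function of $\Sigma_i$ near $p$ and $g$ is a non-vanishing continuous function; (c) $\omega$ is hypocomplex: every $p\in\mathbb T^2$ has an open neighborhood $U$ with a first integral $\zeta\in C^{1+\varepsilon}(U;\mathbb C)$ (that is, $d\zeta\neq0$ and $d\zeta\wedge\omega=0$ on $U$) such that $\zeta:U\to\zeta(U)\subset\mathbb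 C$ is a homeomorphism; (d) near each $p\in\Sigma_i$ there are local ($C^1$) coordinates $(s,t)$ in which $\omega$ is a non-vanishing multiple of $ds+i|t|^{\sigma_i}dt$. Put $\sigma=\max_{1\le i\le N}\sigma_i$ and $L=b\,\partial_x-a\,\partial_y$ on $\mathbb T^2$. With $Z(x,y)=\int_{(0,0)}^{(x,y)}\Pi^\ast\omega$ on $\mathbb R^2$, it is assumed (normalization) that $Z(x+1,y)=Z(x,y)+1$ and $Z(x,y+1)=Z(x,y)+\tau$ for all $(x,y)$, where $\tau\in\mathbb C$, $\mathrm{Im}(\tau)>0$. Equations are understood in the sense of distributions: since $\omega$ is closed, $L$ is divergence free, and $Lu=f$ means $-\int_{\mathbb T^2}u\,L\phi\,dxdy=\int_{\mathbb T^2}f\phi\,dxdy$ for all $\phi\in C^\infty(\mathbb T^2)$. $C^\alpha(\mathbb T^2)$ is the space of Hölder continuous functions with exponent $\alpha$. *)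

theory Defs
  imports "HOL-Analysis.Analysis"
begin

text \<open>
  Functions and one-forms on the torus are represented by their $\mathbb{Z}^2$-periodic lifts to
  the plane. The torus itself is realised as $S^1 \times S^1$; this realisation is only used to
  speak about connected components of subsets of the torus.
\<close>

type_synonym plane = "real \<times> real"

definition torus_proj :: "plane \<Rightarrow> complex \<times> complex" where
  "torus_proj p = (cis (2 * pi * fst p), cis (2 * pi * snd p))"

lemma torus_proj_eq_iff:
  "torus_proj p = torus_proj q \<longleftrightarrow> fst p - fst q \<in> \<int> \<and> snd p - snd q \<in> \<int>"
proof -
  have "cis (2 * pi * s) = cis (2 * pi * t) \<longleftrightarrow> s - t \<in> \<int>" for s t :: real
  proof -
    have "cis (2 * pi * s) = cis (2 * pi * t) \<longleftrightarrow> cis (2 * pi * (s - t)) = 1"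
      by (simp add: right_diff_distrib flip: cis_divide)
    also have "\<dots> \<longleftrightarrow> cos (2 * pi * (s - t)) = 1"
      by (auto simp: complex_eq_iff intro: cos_one_sin_zero)
    also have "\<dots> \<longleftrightarrow> s - t \<in> \<int>"
      by (auto simp: cos_one_2pi_int Ints_def)
    finally show ?thesis .
  qed
  then show ?thesis by (simp add: torus_proj_def)
qed

definition torus_fun :: "(plane \<Rightarrow> 'a) \<Rightarrow> bool" where
  "torus_fun g \<longleftrightarrow> (\<forall>p. g (p + (1, 0)) = g p \<and> g (p + (0, 1)) = g p)"

definition unit_square :: "plane set" where
  "unit_square = {0..1} \<times> {0..1}"

subsection \<open>Function spaces\<close>

definition pd_x :: "(plane \<Rightarrow> 'a::real_normed_vector) \<Rightarrow> plane \<Rightarrow> 'a" where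
  "pd_x g p = frechet_derivative g (at p) (1, 0)"

definition pd_y :: "(plane \<Rightarrow> 'a::real_normed_vector) \<Rightarrow> plane \<Rightarrow> 'a" where
  "pd_y g p = frechet_derivative g (at p) (0, 1)"

text \<open>The sets \<open>U\<close> below are meant to be open.\<close>

primrec Ck_on :: "nat \<Rightarrow> plane set \<Rightarrow> (plane \<Rightarrow> 'a::real_normed_vector) \<Rightarrow> bool" where
  "Ck_on 0 U g \<longleftrightarrow> continuous_on U g"
| "Ck_on (Suc k) U g \<longleftrightarrow>
     (\<forall>p\<in>U. g differentiable (at p)) \<and> Ck_on k U (pd_x g) \<and> Ck_on k U (pd_y g)"

definition smooth :: "(plane \<Rightarrow> 'a::real_normed_vector) \<Rightarrow> bool" where
  "smooth g \<longleftrightarrow> (\<forall>k. Ck_on k UNIV g)"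

definition holder_on :: "real \<Rightarrow> plane set \<Rightarrow> (plane \<Rightarrow> 'a::real_normed_vector) \<Rightarrow> bool" where
  "holder_on \<alpha> U g \<longleftrightarrow> (\<exists>C. \<forall>p\<in>U. \<forall>q\<in>U. norm (g p - g q) \<le> C * dist p q powr \<alpha>)"

text \<open>$C^{1+\varepsilon}$, for $0 < \varepsilon \le 1$.\<close>

definition C1_holder_on :: "real \<Rightarrow> plane set \<Rightarrow> (plane \<Rightarrow> 'a::real_normed_vector) \<Rightarrow> bool" where
  "C1_holder_on \<epsilon> U g \<longleftrightarrow>
     Ck_on 1 U g \<and> holder_on \<epsilon> U (pd_x g) \<and> holder_on \<epsilon> U (pd_y g)"

text \<open>
  For a periodic function, Hoelder continuity on the plane is the same as Hoelder continuity
  with respect to the quotient metric of the torus.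
\<close>

definition holder_torus :: "real \<Rightarrow> (plane \<Rightarrow> complex) \<Rightarrow> bool" where
  "holder_torus \<alpha> u \<longleftrightarrow> torus_fun u \<and> holder_on \<alpha> UNIV u"

definition Lq_torus :: "real \<Rightarrow> (plane \<Rightarrow> complex) \<Rightarrow> bool" where
  "Lq_torus q f \<longleftrightarrow> torus_fun f \<and> f \<in> borel_measurable lebesgue \<and>
     set_integrable lebesgue unit_square (\<lambda>p. norm (f p) powr q)"

subsection \<open>One-forms\<close>

text \<open>
  A one-form assigns to each point a real-linear functional on tangent vectors; the differential
  of \<open>g\<close> at \<open>p\<close> is thus \<open>frechet_derivative g (at p)\<close>. \<open>one_form a b\<close> is $a\,dx + b\,dy$.
\<close>

definition one_form :: "(plane \<Rightarrow> complex) \<Rightarrow> (plane \<Rightarrow> complex) \<Rightarrow> plane \<Rightarrow> plane \<Rightarrow> complex" where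
  "one_form a b p v = a p * of_real (fst v) + b p * of_real (snd v)"

text \<open>The coefficient of $dx \wedge dy$ in the wedge product of two covectors.\<close>

definition wedge :: "(plane \<Rightarrow> 'a::comm_ring_1) \<Rightarrow> (plane \<Rightarrow> 'a) \<Rightarrow> 'a" where
  "wedge \<theta> \<eta> = \<theta> (1, 0) * \<eta> (0, 1) - \<theta> (0, 1) * \<eta> (1, 0)"

definition wedge_cnj :: "(plane \<Rightarrow> plane \<Rightarrow> complex) \<Rightarrow> plane \<Rightarrow> complex" where
  "wedge_cnj \<omega> p = wedge (\<omega> p) (\<lambda>v. cnj (\<omega> p v))"

text \<open>The full preimage in the plane of the characteristic set $\Sigma$ of the torus.\<close>

definition char_lift :: "(plane \<Rightarrow> plane \<Rightarrow> complex) \<Rightarrow> plane set" where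
  "char_lift \<omega> = {p. wedge_cnj \<omega> p = 0}"

definition closed_form :: "(plane \<Rightarrow> complex) \<Rightarrow> (plane \<Rightarrow> complex) \<Rightarrow> bool" where
  "closed_form a b \<longleftrightarrow> (\<forall>p. pd_x b p - pd_y a p = 0)"

text \<open>
  The integral of \<open>\<omega>\<close> along the segment from the origin to \<open>p\<close>; for closed \<open>\<omega>\<close> the choice of
  path is irrelevant.
\<close>

definition primitive :: "(plane \<Rightarrow> plane \<Rightarrow> complex) \<Rightarrow> plane \<Rightarrow> complex" where
  "primitive \<omega> p = integral {0..1} (\<lambda>t. \<omega> (t *\<^sub>R p) p)"

subsection \<open>Local structure\<close>

text \<open>
  By the inverse function theorem, \<open>(s, t)\<close> is then a $C^1$ diffeomorphism from the open set \<open>U\<close>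
  onto an open set.
\<close>

definition C1_coords :: "plane set \<Rightarrow> (plane \<Rightarrow> real) \<Rightarrow> (plane \<Rightarrow> real) \<Rightarrow> bool" where
  "C1_coords U s t \<longleftrightarrow> open U \<and> Ck_on 1 U s \<and> Ck_on 1 U t \<and> inj_on (\<lambda>p. (s p, t p)) U \<and>
     (\<forall>p\<in>U. wedge (frechet_derivative s (at p)) (frechet_derivative t (at p)) \<noteq> 0)"

text \<open>
  Since the covering map is a local diffeomorphism, a subset of the torus is an embedded curve
  iff its preimage in the plane is.
\<close>

definition embedded_curve :: "plane set \<Rightarrow> bool" where
  "embedded_curve S \<longleftrightarrow>
     (\<forall>p\<in>S. \<exists>U s t. p \<in> U \<and> C1_coords U s t \<and> S \<inter> U = {p'\<in>U. t p' = 0})"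

definition defining_fun :: "plane set \<Rightarrow> plane set \<Rightarrow> (plane \<Rightarrow> real) \<Rightarrow> bool" where
  "defining_fun S U \<rho> \<longleftrightarrow> Ck_on 1 U \<rho> \<and> S \<inter> U = {p\<in>U. \<rho> p = 0} \<and>
     (\<forall>p\<in>S \<inter> U. frechet_derivative \<rho> (at p) \<noteq> (\<lambda>v. 0))"

definition vanishes_to_order ::
    "(plane \<Rightarrow> plane \<Rightarrow> complex) \<Rightarrow> plane set \<Rightarrow> real \<Rightarrow> bool" where
  "vanishes_to_order \<omega> S \<sigma> \<longleftrightarrow>
     (\<forall>p\<in>S. \<exists>U \<rho> g. open U \<and> p \<in> U \<and> defining_fun S U \<rho> \<and>
        continuous_on U g \<and> (\<forall>p'\<in>U. g p' \<noteq> 0) \<and>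
        (\<forall>p'\<in>U. wedge_cnj \<omega> p' = of_real (\<bar>\<rho> p'\<bar> powr \<sigma>) * g p'))"

definition hypocomplex :: "real \<Rightarrow> (plane \<Rightarrow> plane \<Rightarrow> complex) \<Rightarrow> bool" where
  "hypocomplex \<epsilon> \<omega> \<longleftrightarrow>
     (\<forall>p. \<exists>U (\<zeta> :: plane \<Rightarrow> complex). open U \<and> p \<in> U \<and> C1_holder_on \<epsilon> U \<zeta> \<and>
        (\<forall>p'\<in>U. frechet_derivative \<zeta> (at p') \<noteq> (\<lambda>v. 0) \<and>
                wedge (frechet_derivative \<zeta> (at p')) (\<omega> p') = 0) \<and>
        (\<exists>\<xi>. homeomorphism U (\<zeta> ` U) \<zeta> \<xi>))"

definition normal_form :: "(plane \<Rightarrow> plane \<Rightarrow> complex) \<Rightarrow> plane set \<Rightarrow> real \<Rightarrow> bool" where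
  "normal_form \<omega> S \<sigma> \<longleftrightarrow>
     (\<forall>p\<in>S. \<exists>U s t h. p \<in> U \<and> C1_coords U s t \<and>
        (\<forall>p'\<in>U. h p' \<noteq> 0 \<and>
           (\<forall>v. \<omega> p' v = h p' * (of_real (frechet_derivative s (at p') v)
                  + \<i> * of_real (\<bar>t p'\<bar> powr \<sigma>) * of_real (frechet_derivative t (at p') v)))))"

subsection \<open>The equation $Lu = f$\<close>

definition L_op ::
    "(plane \<Rightarrow> complex) \<Rightarrow> (plane \<Rightarrow> complex) \<Rightarrow> (plane \<Rightarrow> complex) \<Rightarrow> plane \<Rightarrow> complex" where
  "L_op a b \<phi> p = b p * pd_x \<phi> p - a p * pd_y \<phi> p"

definition weak_solution ::
    "(plane \<Rightarrow> complex) \<Rightarrow> (plane \<Rightarrow> complex) \<Rightarrow> (plane \<Rightarrow> complex) \<Rightarrow> (plane \<Rightarrow> complex) \<Rightarrow> bool" where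
  "weak_solution a b f u \<longleftrightarrow>
     (\<forall>\<phi>. torus_fun \<phi> \<and> smooth \<phi> \<longrightarrow>
        - (LINT p:unit_square|lebesgue. u p * L_op a b \<phi> p)
          = (LINT p:unit_square|lebesgue. f p * \<phi> p))"

end

theory Submission
  imports Defs "HOL-Complex_Analysis.Complex_Analysis"
begin

text \<open>
  Let $Z=\int\omega$, $E=e^{2\pi i Z}$ and $q=e^{2\pi i\tau}$. The solution is
  $u(p)=\int f(p')\,k(E(p)/E(p'))\,dp'$, where $k$ is meromorphic on the punctured plane with simple
  poles at the powers of $q$ and $k(qw)=k(w)-1$; the jump integrates to zero because $f$ has mean zero.
  The normal form $ds+i|t|^\sigma dt$ shows that sets on which $E$ oscillates by at most $\rho$ have
  local area $O(\rho^{2-\mu})$. Hence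
  $\int|E-w_0|^{-r}|E-w_1|^{-r}=O(|w_0-w_1|^{2-\mu-2r})$, and duality with $L^q$ gives the exponent
  $\alpha=(2-\mu)/r-1$. The normal form also makes $Z$ locally injective; being proper, it is a covering
  of the plane, hence injective, so the kernel has no pole on the torus besides $p'$. Stokes' theorem
  on the unit square then yields $\int k(E/E(p'))\,L\phi=c_\phi-\phi(p')$ for almost every $p'$.
\<close>

subsection \<open>Lower bounds and measure of small sets\<close>

text \<open>The obstacle is that \<open>E\<close> fails to be a diffeomorphism along the
  characteristic set, so the equation cannot be carried over to the Cauchy-Riemann equation by a
  change of variables. All estimates therefore stay on the torus and see \<open>E\<close> only
  through the measure of preimages of discs. In the model, an increment \<rho> of \<open>E\<close>
  leaves room \<rho> for \<open>s\<close> but \<rho>^(1/(\<sigma>+1)) for \<open>t\<close>; the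
  product is \<rho>^(2-\<mu>). The condition q > 2 + \<sigma> says exactly that r < 2 - \<mu>, which
  makes the r-th power of a simple pole integrable against a measure of that growth, while 2 - \<mu>
  < 2r keeps the Hoelder exponent below 1. Passing from \<open>Z\<close> to \<open>E\<close> absorbs
  the period 1, so the kernel has to deal with a single generator of the lattice. A doubly periodic
  kernel with one simple pole per cell does not exist, so some jump is unavoidable. Necessity is
  seen by testing with a constant.\<close>

lemma has_derivative_partials:
  fixes g :: "plane \<Rightarrow> 'a::real_normed_vector"
  assumes "g differentiable (at p)"
  shows "(g has_derivative (\<lambda>v. fst v *\<^sub>R pd_x g p + snd v *\<^sub>R pd_y g p)) (at p)"
proof -
  let ?g' = "frechet_derivative g (at p)"
  have g: "(g has_derivative ?g') (at p)" using assms frechet_derivative_works by blast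
  then have lin: "linear ?g'" by (rule has_derivative_linear)
  have "?g' v = fst v *\<^sub>R pd_x g p + snd v *\<^sub>R pd_y g p" for v
  proof -
    have "v = fst v *\<^sub>R (1, 0) + snd v *\<^sub>R (0, 1)" by (simp add: prod_eq_iff)
    then have "?g' v = ?g' (fst v *\<^sub>R (1, 0) + snd v *\<^sub>R (0, 1))" by simp
    also have "\<dots> = fst v *\<^sub>R ?g' (1, 0) + snd v *\<^sub>R ?g' (0, 1)"
      by (simp only: linear_add[OF lin] linear_scale[OF lin])
    finally show ?thesis by (simp add: pd_x_def pd_y_def)
  qed
  then have "?g' = (\<lambda>v. fst v *\<^sub>R pd_x g p + snd v *\<^sub>R pd_y g p)" by (rule ext)
  with g show ?thesis by simp
qed

lemma frechet_derivative_partials: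
  fixes g :: "plane \<Rightarrow> 'a::real_normed_vector"
  assumes "g differentiable (at p)"
  shows "frechet_derivative g (at p) v = fst v *\<^sub>R pd_x g p + snd v *\<^sub>R pd_y g p"
  using frechet_derivative_at[OF has_derivative_partials[OF assms]] by metis

text \<open>The derivative at \<open>p\<^sub>0\<close>, being injective, expands by some factor
  \<open>e\<close>; near that point the derivative of \<open>F - L\<close> has norm at most
  \<open>e / 2\<close> by continuity of the partials, so \<open>F\<close> still expands by
  \<open>e / 2\<close>. The target is left general because the estimate serves both the first
  integral and the coordinate pairs \<open>(s, t)\<close>.\<close>

lemma C1_lower_bound:
  fixes F :: "plane \<Rightarrow> 'b::euclidean_space"
  assumes "open U" "p\<^sub>0 \<in> U"
    and F: "\<And>p. p \<in> U \<Longrightarrow> (F has_derivative (\<lambda>v. fst v *\<^sub>R A p + snd v *\<^sub>R B p)) (at p)"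
    and cont: "isCont A p\<^sub>0" "isCont B p\<^sub>0"
    and inj: "\<And>v. fst v *\<^sub>R A p\<^sub>0 + snd v *\<^sub>R B p\<^sub>0 = 0 \<Longrightarrow> v = 0"
  obtains \<delta> c where "0 < \<delta>" "ball p\<^sub>0 \<delta> \<subseteq> U" "0 < c"
    "\<And>p p'. p \<in> ball p\<^sub>0 \<delta> \<Longrightarrow> p' \<in> ball p\<^sub>0 \<delta> \<Longrightarrow> c * norm (p - p') \<le> norm (F p - F p')"
proof -
  define L where "L v = fst v *\<^sub>R A p\<^sub>0 + snd v *\<^sub>R B p\<^sub>0" for v :: plane
  have L': "(F has_derivative L) (at p\<^sub>0)" unfolding L_def[abs_def] by (rule F) fact
  then have L: "linear L" by (rule has_derivative_linear)
  have "inj L" using inj by (subst linear_injective_0[OF L]) (simp add: L_def)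
  then obtain e where e: "0 < e" "\<And>v. e * norm v \<le> norm (L v)"
    using linear_inj_bounded_below_pos[OF L] by metis
  obtain \<delta>\<^sub>0 where \<delta>0: "0 < \<delta>\<^sub>0" "ball p\<^sub>0 \<delta>\<^sub>0 \<subseteq> U" using assms open_contains_ball by blast
  obtain \<delta>\<^sub>1 where \<delta>1: "0 < \<delta>\<^sub>1" "\<And>p. dist p p\<^sub>0 < \<delta>\<^sub>1 \<Longrightarrow> norm (A p - A p\<^sub>0) < e / 4"
    using cont(1) e(1) unfolding continuous_at_eps_delta dist_norm by (meson divide_pos_pos zero_less_numeral)
  obtain \<delta>\<^sub>2 where \<delta>2: "0 < \<delta>\<^sub>2" "\<And>p. dist p p\<^sub>0 < \<delta>\<^sub>2 \<Longrightarrow> norm (B p - B p\<^sub>0) < e / 4"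
    using cont(2) e(1) unfolding continuous_at_eps_delta dist_norm by (meson divide_pos_pos zero_less_numeral)
  define \<delta> where "\<delta> = min \<delta>\<^sub>0 (min \<delta>\<^sub>1 \<delta>\<^sub>2)"
  show thesis
  proof (rule that[of \<delta> "e / 2"])
    show "0 < \<delta>" "0 < e / 2" using \<delta>0 \<delta>1 \<delta>2 e by (auto simp: \<delta>_def)
    have "ball p\<^sub>0 \<delta> \<subseteq> ball p\<^sub>0 \<delta>\<^sub>0" by (intro subset_ball) (simp add: \<delta>_def)
    then show U: "ball p\<^sub>0 \<delta> \<subseteq> U" using \<delta>0(2) by (rule order_trans)
    fix p p' assume p: "p \<in> ball p\<^sub>0 \<delta>" "p' \<in> ball p\<^sub>0 \<delta>"
    have "norm ((F p - L p) - (F p' - L p')) \<le> e / 2 * norm (p - p')"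
    proof (rule differentiable_bound[of "ball p\<^sub>0 \<delta>" "\<lambda>x. F x - L x" "\<lambda>x v. fst v *\<^sub>R (A x - A p\<^sub>0) + snd v *\<^sub>R (B x - B p\<^sub>0)" "e / 2" p p'])
      fix x assume x: "x \<in> ball p\<^sub>0 \<delta>"
      let ?D = "\<lambda>v. fst v *\<^sub>R (A x - A p\<^sub>0) + snd v *\<^sub>R (B x - B p\<^sub>0)"
      have 1: "((\<lambda>x. F x - L x) has_derivative (\<lambda>v. (fst v *\<^sub>R A x + snd v *\<^sub>R B x) - L v)) (at x within ball p\<^sub>0 \<delta>)"
        using x U by (intro has_derivative_diff[OF has_derivative_at_withinI[OF F] linear_imp_has_derivative[OF L]]) auto
      have 2: "(\<lambda>v. (fst v *\<^sub>R A x + snd v *\<^sub>R B x) - L v) = ?D"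
        by (rule ext) (simp add: L_def scaleR_right_diff_distrib)
      show "((\<lambda>x. F x - L x) has_derivative ?D) (at x within ball p\<^sub>0 \<delta>)"
        using 1 unfolding 2 .
      show "onorm ?D \<le> e / 2" 
      proof (rule onorm_le)
        fix v :: plane
        have n: "\<bar>fst v\<bar> \<le> norm v" "\<bar>snd v\<bar> \<le> norm v"
          using norm_fst_le[of "fst v" "snd v"] norm_snd_le[of "snd v" "fst v"] by simp_all
        have AB: "norm (A x - A p\<^sub>0) \<le> e / 4" "norm (B x - B p\<^sub>0) \<le> e / 4"
          using x \<delta>1(2)[of x] \<delta>2(2)[of x] by (auto simp: \<delta>_def dist_commute)
        have "norm (?D v) \<le> \<bar>fst v\<bar> * norm (A x - A p\<^sub>0) + \<bar>snd v\<bar> * norm (B x - B p\<^sub>0)"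
          by (rule norm_triangle_le) simp
        also have "\<dots> \<le> norm v * (e / 4) + norm v * (e / 4)"
          using n AB by (intro add_mono mult_mono) auto
        finally show "norm (?D v) \<le> e / 2 * norm v" by (simp add: algebra_simps)
      qed
    qed (use p in auto)
    moreover have "e * norm (p - p') \<le> norm (L (p - p'))" by (rule e)
    moreover have "L (p - p') = (F p - F p') - ((F p - L p) - (F p' - L p'))"
      by (simp add: linear_diff[OF L])
    then have "norm (L (p - p')) \<le> norm (F p - F p') + norm ((F p - L p) - (F p' - L p'))"
      by (metis norm_triangle_ineq4)
    ultimately show "e / 2 * norm (p - p') \<le> norm (F p - F p')" by simp
  qed
qed

section \<open>Area of sets confined in one or two directions\<close>

lemma emeasure_square_le:
  fixes p :: plane
  assumes "S \<subseteq> {p'. norm (p' - p) \<le> r}" "0 \<le> r"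
  shows "emeasure lebesgue S \<le> ennreal (4 * r\<^sup>2)"
proof -
  obtain x y where p: "p = (x, y)" by (cases p)
  have "S \<subseteq> cbox (x - r, y - r) (x + r, y + r)"
  proof
    fix p' assume "p' \<in> S"
    then have "norm (p' - p) \<le> r" using assms by auto
    moreover have "\<bar>fst p' - x\<bar> \<le> norm (p' - p)" "\<bar>snd p' - y\<bar> \<le> norm (p' - p)"
      using norm_fst_le[of "fst p' - x" "snd p' - y"] norm_snd_le[of "snd p' - y" "fst p' - x"] by (cases p'; simp add: p)+
    ultimately show "p' \<in> cbox (x - r, y - r) (x + r, y + r)" by (cases p') (auto simp: cbox_Pair_eq)
  qed
  then have "emeasure lebesgue S \<le> emeasure lebesgue (cbox (x - r, y - r) (x + r, y + r))"
    by (intro emeasure_mono) auto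
  also have "\<dots> = ennreal (measure lebesgue (cbox (x - r, y - r) (x + r, y + r)))"
    by (rule emeasure_eq_measure2) auto
  also have "measure lebesgue (cbox (x - r, y - r) (x + r, y + r)) = 4 * r\<^sup>2"
    using assms(2) by (simp add: content_Pair power2_eq_square)
  finally show ?thesis .
qed

text \<open>Cutting \<open>S\<close> into slabs of \<open>t\<close>-width \<rho> leaves pieces that
  fit into discs of radius \<open>C * \<rho>\<close>, hence of area O(\<rho>^2), and there are about
  \<open>b / \<rho>\<close> slabs. \<open>S\<close> need not be measurable: only the discs covering
  it have to be.\<close>

lemma emeasure_strip_le:
  fixes s t :: "plane \<Rightarrow> real"
  assumes lower: "\<And>p p'. p \<in> S \<Longrightarrow> p' \<in> S \<Longrightarrow> norm (p - p') \<le> C * max \<bar>s p - s p'\<bar> \<bar>t p - t p'\<bar>"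
    and s: "\<And>p p'. p \<in> S \<Longrightarrow> p' \<in> S \<Longrightarrow> \<bar>s p - s p'\<bar> \<le> \<rho>"
    and t: "\<And>p p'. p \<in> S \<Longrightarrow> p' \<in> S \<Longrightarrow> \<bar>t p - t p'\<bar> \<le> b"
    and "0 < \<rho>" "\<rho> \<le> b" "0 \<le> C"
  shows "emeasure lebesgue S \<le> ennreal (16 * C\<^sup>2 * \<rho> * b)"
proof (cases "S = {}")
  case False
  then obtain p\<^sub>0 where p0: "p\<^sub>0 \<in> S" by blast
  define n where "n p = \<lfloor>(t p - t p\<^sub>0) / \<rho>\<rfloor>" for p
  define J where "J = {\<lfloor>- b / \<rho>\<rfloor>..\<lfloor>b / \<rho>\<rfloor>}"
  define c where "c j = (SOME p. p \<in> S \<and> n p = j)" for j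
  define T where "T j = {p'. norm (p' - c j) \<le> C * \<rho>}" for j
  have nJ: "n p \<in> J" if "p \<in> S" for p
  proof -
    have "- b / \<rho> \<le> (t p - t p\<^sub>0) / \<rho>" "(t p - t p\<^sub>0) / \<rho> \<le> b / \<rho>"
      using t[OF that p0] \<open>0 < \<rho>\<close> by (intro divide_right_mono; simp)+
    then show ?thesis unfolding n_def J_def by (auto intro!: floor_mono)
  qed
  have mem: "p \<in> T (n p)" if "p \<in> S" for p
  proof -
    have c: "c (n p) \<in> S" "n (c (n p)) = n p"
      using someI[of "\<lambda>p'. p' \<in> S \<and> n p' = n p" p] that by (auto simp: c_def)
    have "\<bar>(t p - t p\<^sub>0) / \<rho> - (t (c (n p)) - t p\<^sub>0) / \<rho>\<bar> < 1"
      using c(2) unfolding n_def by linarith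
    then have "\<bar>(t p - t (c (n p))) / \<rho>\<bar> < 1" by (simp add: diff_divide_distrib)
    then have "\<bar>t p - t (c (n p))\<bar> < \<rho>" using \<open>0 < \<rho>\<close> by (simp add: field_simps)
    moreover have "\<bar>s p - s (c (n p))\<bar> \<le> \<rho>" by (rule s) fact+
    ultimately have "C * max \<bar>s p - s (c (n p))\<bar> \<bar>t p - t (c (n p))\<bar> \<le> C * \<rho>"
      using \<open>0 \<le> C\<close> by (intro mult_left_mono) auto
    then show ?thesis using lower[OF that c(1)] by (simp add: T_def)
  qed
  have Tm: "T j \<in> sets lebesgue" for j
  proof -
    have "T j = cball (c j) (C * \<rho>)" by (auto simp: T_def dist_norm norm_minus_commute)
    then show ?thesis by simp
  qed
  have "S \<subseteq> (\<Union>j\<in>J. T j)" using mem nJ by blast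
  then have "emeasure lebesgue S \<le> emeasure lebesgue (\<Union>j\<in>J. T j)"
    using Tm by (intro emeasure_mono sets.finite_UN) (auto simp: J_def)
  also have "\<dots> \<le> (\<Sum>j\<in>J. emeasure lebesgue (T j))"
    using Tm by (intro emeasure_subadditive_finite) (auto simp: J_def)
  also have "\<dots> \<le> (\<Sum>j\<in>J. ennreal (4 * (C * \<rho>)\<^sup>2))"
    using \<open>0 < \<rho>\<close> \<open>0 \<le> C\<close> by (intro sum_mono emeasure_square_le) (auto simp: T_def)
  also have "\<dots> = ennreal (real (card J) * (4 * (C * \<rho>)\<^sup>2))"
    by (simp add: ennreal_of_nat_eq_real_of_nat ennreal_mult'[symmetric])
  also have "\<dots> \<le> ennreal (4 * b / \<rho> * (4 * (C * \<rho>)\<^sup>2))"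
  proof (intro ennreal_leI mult_right_mono)
    \<comment> \<open>\<open>\<rho> \<le> b\<close> lets the rounding term 2 be absorbed into the
      factor 4.\<close>
    have "1 \<le> b / \<rho>" using assms by simp
    have "card J = nat (\<lfloor>b / \<rho>\<rfloor> - \<lfloor>- b / \<rho>\<rfloor> + 1)" unfolding J_def card_atLeastAtMost_int by (simp add: algebra_simps)
    moreover have "of_int (\<lfloor>b / \<rho>\<rfloor> - \<lfloor>- b / \<rho>\<rfloor> + 1) \<le> 2 * (b / \<rho>) + 2" by (simp, linarith)
    moreover have "0 \<le> \<lfloor>b / \<rho>\<rfloor> - \<lfloor>- b / \<rho>\<rfloor> + 1" using \<open>1 \<le> b / \<rho>\<close> by (simp, linarith)
    ultimately have "real (card J) \<le> 2 * (b / \<rho>) + 2" by (metis of_nat_nat)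
    then show "real (card J) \<le> 4 * b / \<rho>" using \<open>1 \<le> b / \<rho>\<close> by simp
  qed simp
  also have "4 * b / \<rho> * (4 * (C * \<rho>)\<^sup>2) = 16 * C\<^sup>2 * \<rho> * b"
    using \<open>0 < \<rho>\<close> by (simp add: power2_eq_square field_simps)
  finally show ?thesis .
qed simp

text \<open>The antiderivative of \<open>\<bar>t\<bar> powr \<sigma>\<close> vanishing at 0, so that
  the model form is the differential of \<open>s + \<i> * odd_power \<sigma> t\<close>.\<close>

definition odd_power :: "real \<Rightarrow> real \<Rightarrow> real" where
  "odd_power \<sigma> t = t * \<bar>t\<bar> powr \<sigma> / (\<sigma> + 1)"

text \<open>At 0 the difference quotient is
  \<open>\<bar>h\<bar> powr \<sigma> / (\<sigma> + 1)\<close>, which tends to 0; positive arguments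
  follow from the power rule and negative ones from oddness.\<close>

lemma odd_power_derivative:
  assumes "0 < \<sigma>"
  shows "(odd_power \<sigma> has_real_derivative \<bar>t\<bar> powr \<sigma>) (at t)"
proof (cases "t = 0")
  case True
  have "((\<lambda>h. \<bar>h\<bar> powr \<sigma> / (\<sigma> + 1)) \<longlongrightarrow> \<bar>0\<bar> powr \<sigma> / (\<sigma> + 1)) (at 0)"
    using assms by (intro tendsto_intros) auto
  then have "((\<lambda>h. \<bar>h\<bar> powr \<sigma> / (\<sigma> + 1)) \<longlongrightarrow> 0) (at 0)" using assms by simp
  moreover have "\<forall>\<^sub>F h in at 0. \<bar>h\<bar> powr \<sigma> / (\<sigma> + 1) = (odd_power \<sigma> (0 + h) - odd_power \<sigma> 0) / h"
    by (auto simp: eventually_at odd_power_def intro!: exI[of _ 1])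
  ultimately have "((\<lambda>h. (odd_power \<sigma> (0 + h) - odd_power \<sigma> 0) / h) \<longlongrightarrow> 0) (at 0)"
    by (rule Lim_transform_eventually)
  then show ?thesis using True assms by (simp add: DERIV_def)
next
  case False
  have pos: "(odd_power \<sigma> has_real_derivative u powr \<sigma>) (at u)" if "0 < u" for u
  proof (rule has_field_derivative_transform_within_open)
    show "((\<lambda>u. u powr (\<sigma> + 1) / (\<sigma> + 1)) has_real_derivative u powr \<sigma>) (at u)"
      using that assms by (auto intro!: derivative_eq_intros)
    show "open {0::real<..}" "u \<in> {0<..}" using that by auto
    show "x powr (\<sigma> + 1) / (\<sigma> + 1) = odd_power \<sigma> x" if "x \<in> {0<..}" for x
      using that by (simp add: odd_power_def powr_add)
  qed
  show ?thesis
  proof (cases "0 < t")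
    case True
    then show ?thesis using pos[of t] by simp
  next
    case neg: False
    have "((\<lambda>u. - odd_power \<sigma> (- u)) has_real_derivative (- ((- t) powr \<sigma> * (- 1)))) (at t)"
      using neg False by (intro DERIV_minus DERIV_chain2[where f = "odd_power \<sigma>" and g = uminus] pos) (auto intro!: derivative_eq_intros)
    also have "(\<lambda>u. - odd_power \<sigma> (- u)) = odd_power \<sigma>" by (simp add: odd_power_def[abs_def])
    finally show ?thesis using neg by simp
  qed
qed

text \<open>Writing \<open>z powr k = z * z powr (k - 1)\<close> reduces this to monotonicity of the
  power with exponent \<open>k - 1\<close>.\<close>

lemma powr_superadditive:
  fixes x y k :: real
  assumes "0 \<le> x" "0 \<le> y" "1 \<le> k"
  shows "x powr k + y powr k \<le> (x + y) powr k"
proof -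
  have *: "z powr k = z * z powr (k - 1)" if "0 \<le> z" for z :: real
    using that assms by (cases "z = 0") (auto simp: powr_diff)
  have "x powr k + y powr k = x * x powr (k - 1) + y * y powr (k - 1)" using * assms by simp
  also have "\<dots> \<le> x * (x + y) powr (k - 1) + y * (x + y) powr (k - 1)"
    using assms by (intro add_mono mult_left_mono powr_mono2) auto
  also have "\<dots> = (x + y) powr k" using * assms by (simp add: algebra_simps)
  finally show ?thesis .
qed

text \<open>For arguments of equal sign this is superadditivity of the power; for opposite signs the
  larger absolute value is at least half the distance, which is where the factor 1/2 comes from. In
  effect the inverse of \<open>odd_power \<sigma>\<close> is Hoelder continuous with exponent
  1/(\<sigma>+1), the source of the fractional growth exponent.\<close>

lemma odd_power_expanding:
  assumes "0 < \<sigma>"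
  shows "(\<bar>x - y\<bar> / 2) powr (\<sigma> + 1) / (\<sigma> + 1) \<le> \<bar>odd_power \<sigma> x - odd_power \<sigma> y\<bar>"
proof -
  let ?k = "\<sigma> + 1"
  have pos: "odd_power \<sigma> t = t powr ?k / ?k" if "0 \<le> t" for t
    using that by (cases "t = 0") (auto simp: odd_power_def powr_add)
  have neg: "odd_power \<sigma> (- t) = - odd_power \<sigma> t" for t by (simp add: odd_power_def)
  have half: "(z / 2) powr ?k \<le> z powr ?k" if "0 \<le> z" for z :: real
    using that assms by (intro powr_mono2) auto
  have same: "((x - y) / 2) powr ?k / ?k \<le> odd_power \<sigma> x - odd_power \<sigma> y" if "0 \<le> y" "y \<le> x" for x y
  proof -
    have "(x - y) powr ?k + y powr ?k \<le> x powr ?k" using powr_superadditive[of "x - y" y ?k] that assms by simp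
    then have "((x - y) / 2) powr ?k \<le> x powr ?k - y powr ?k" using half[of "x - y"] that by simp
    then have "((x - y) / 2) powr ?k / ?k \<le> (x powr ?k - y powr ?k) / ?k" using assms by (intro divide_right_mono) auto
    then show ?thesis using that by (simp add: pos diff_divide_distrib)
  qed
  have opp: "((x + y) / 2) powr ?k / ?k \<le> odd_power \<sigma> x + odd_power \<sigma> y" if "0 \<le> x" "0 \<le> y" for x y
  proof -
    have "((x + y) / 2) powr ?k \<le> (max x y) powr ?k" using that assms by (intro powr_mono2) auto
    also have "\<dots> \<le> x powr ?k + y powr ?k" by (auto simp: max_def)
    finally have "((x + y) / 2) powr ?k / ?k \<le> (x powr ?k + y powr ?k) / ?k" using assms by (intro divide_right_mono) auto
    then show ?thesis using that by (simp add: pos add_divide_distrib)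
  qed
  have main: "((x - y) / 2) powr ?k / ?k \<le> odd_power \<sigma> x - odd_power \<sigma> y" if "y \<le> x" for x y
  proof (cases "0 \<le> y")
    case True
    then show ?thesis using same that by simp
  next
    case False
    show ?thesis
    proof (cases "0 \<le> x")
      case True
      then show ?thesis using opp[of x "-y"] False neg[of y] by simp
    next
      case False
      then show ?thesis using same[of "- x" "- y"] that neg[of x] neg[of y] by simp
    qed
  qed
  show ?thesis using main[of x y] main[of y x] by (cases "y \<le> x") (auto simp: abs_if)
qed

text \<open>The increment is compared with that of a majorant \<phi> instead of the length of the
  interval: with \<open>odd_power\<close> as majorant this keeps the degenerate weight under control
  across \<open>t = 0\<close>. The endpoints may come in either order.\<close>

lemma mean_value_estimate:
  fixes f :: "real \<Rightarrow> 'a::real_normed_vector"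
  assumes "\<And>x. x \<in> closed_segment u v \<Longrightarrow> (f has_vector_derivative f' x) (at x)"
    and "\<And>x. x \<in> closed_segment u v \<Longrightarrow> (\<phi> has_real_derivative \<phi>' x) (at x)"
    and "\<And>x. x \<in> closed_segment u v \<Longrightarrow> norm (f' x) \<le> \<phi>' x"
  shows "norm (f v - f u) \<le> \<bar>\<phi> v - \<phi> u\<bar>"
proof -
  have *: "norm (f v - f u) \<le> \<phi> v - \<phi> u" if "u < v"
    "\<And>x. x \<in> {u..v} \<Longrightarrow> (f has_vector_derivative f' x) (at x)"
    "\<And>x. x \<in> {u..v} \<Longrightarrow> (\<phi> has_real_derivative \<phi>' x) (at x)"
    "\<And>x. x \<in> {u..v} \<Longrightarrow> norm (f' x) \<le> \<phi>' x" for u v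
    using that
    unfolding has_real_derivative_iff_has_vector_derivative
    by (intro differentiable_bound_general[where f' = f' and \<phi>' = \<phi>'] continuous_at_imp_continuous_on ballI)
      (auto dest: has_vector_derivative_continuous)
  consider "u < v" | "v < u" | "u = v" by linarith
  then show ?thesis
  proof cases
    case 1
    then show ?thesis using *[of u v] assms by (simp add: closed_segment_eq_real_ivl)
  next
    case 2
    then show ?thesis using *[of v u] assms by (simp add: closed_segment_eq_real_ivl norm_minus_commute)
  qed simp
qed

text \<open>
  The increment of \<open>G\<close> is compared with \<open>\<theta>\<^sub>0\<close> times the increment of $s + i\,t|t|^\sigma/(\sigma+1)$ along a
  horizontal and then a vertical segment. A straight segment in the original coordinates would not
  do, since the variation of \<open>s\<close> along it need not be controlled by the increment.
\<close>

lemma normal_form_estimate: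
  fixes G \<theta> :: "plane \<Rightarrow> complex" and bx :: "plane set"
  assumes "0 < \<sigma>"
    and bx: "bx = {x. \<bar>fst x - s\<^sub>0\<bar> < \<eta> \<and> \<bar>snd x - t\<^sub>0\<bar> < \<eta>}"
    and Gs: "\<And>s t. (s, t) \<in> bx \<Longrightarrow> ((\<lambda>s. G (s, t)) has_vector_derivative \<theta> (s, t)) (at s)"
    and Gt: "\<And>s t. (s, t) \<in> bx \<Longrightarrow> ((\<lambda>t. G (s, t)) has_vector_derivative \<i> * of_real (\<bar>t\<bar> powr \<sigma>) * \<theta> (s, t)) (at t)"
    and \<theta>: "\<And>x. x \<in> bx \<Longrightarrow> norm (\<theta> x - \<theta>\<^sub>0) \<le> norm \<theta>\<^sub>0 / 4"
    and xy: "x \<in> bx" "y \<in> bx"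
  shows "norm \<theta>\<^sub>0 / 2 * \<bar>fst x - fst y\<bar> \<le> norm (G x - G y)"
    and "norm \<theta>\<^sub>0 / 2 * \<bar>odd_power \<sigma> (snd x) - odd_power \<sigma> (snd y)\<bar> \<le> norm (G x - G y)"
proof -
  obtain s t s' t' where x: "x = (s, t)" and y: "y = (s', t')" by (cases x, cases y)
  let ?n = "norm \<theta>\<^sub>0" and ?\<phi> = "odd_power \<sigma>"
  have box_s: "(z, t') \<in> bx" if "z \<in> closed_segment s' s" for z
    using that xy unfolding x y bx by (auto simp: closed_segment_eq_real_ivl split: if_splits)
  have box_t: "(s, z) \<in> bx" if "z \<in> closed_segment t' t" for z
    using that xy unfolding x y bx by (auto simp: closed_segment_eq_real_ivl split: if_splits)
  have "norm ((G (s, t') - of_real s * \<theta>\<^sub>0) - (G (s', t') - of_real s' * \<theta>\<^sub>0)) \<le> \<bar>?n / 4 * s - ?n / 4 * s'\<bar>"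
  proof (rule mean_value_estimate[where f = "\<lambda>z. G (z, t') - of_real z * \<theta>\<^sub>0" and \<phi> = "\<lambda>z. ?n / 4 * z"
        and f' = "\<lambda>z. \<theta> (z, t') - \<theta>\<^sub>0" and \<phi>' = "\<lambda>_. ?n / 4"])
    fix z assume z: "z \<in> closed_segment s' s"
    show "((\<lambda>z. G (z, t') - of_real z * \<theta>\<^sub>0) has_vector_derivative \<theta> (z, t') - \<theta>\<^sub>0) (at z)"
      using Gs[OF box_s[OF z]] by (auto intro!: derivative_eq_intros)
    show "norm (\<theta> (z, t') - \<theta>\<^sub>0) \<le> ?n / 4" using z box_s \<theta> by blast
  qed (auto intro!: derivative_eq_intros)
  moreover have "(G (s, t') - of_real s * \<theta>\<^sub>0) - (G (s', t') - of_real s' * \<theta>\<^sub>0)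
      = (G (s, t') - G (s', t')) - of_real (s - s') * \<theta>\<^sub>0"
    by (simp add: algebra_simps)
  moreover have "\<bar>?n / 4 * s - ?n / 4 * s'\<bar> = ?n / 4 * \<bar>s - s'\<bar>"
    unfolding right_diff_distrib[symmetric] by (simp add: abs_mult)
  ultimately have 1: "norm ((G (s, t') - G (s', t')) - of_real (s - s') * \<theta>\<^sub>0) \<le> ?n / 4 * \<bar>s - s'\<bar>"
    by simp
  have "norm ((G (s, t) - \<i> * of_real (?\<phi> t) * \<theta>\<^sub>0) - (G (s, t') - \<i> * of_real (?\<phi> t') * \<theta>\<^sub>0)) \<le> \<bar>?n / 4 * ?\<phi> t - ?n / 4 * ?\<phi> t'\<bar>"
  proof (rule mean_value_estimate[where f = "\<lambda>z. G (s, z) - \<i> * of_real (?\<phi> z) * \<theta>\<^sub>0" and \<phi> = "\<lambda>z. ?n / 4 * ?\<phi> z"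
        and f' = "\<lambda>z. \<i> * of_real (\<bar>z\<bar> powr \<sigma>) * \<theta> (s, z) - \<i> * of_real (\<bar>z\<bar> powr \<sigma>) * \<theta>\<^sub>0" and \<phi>' = "\<lambda>z. ?n / 4 * \<bar>z\<bar> powr \<sigma>"])
    fix z assume z: "z \<in> closed_segment t' t"
    show "((\<lambda>z. G (s, z) - \<i> * of_real (?\<phi> z) * \<theta>\<^sub>0) has_vector_derivative
      \<i> * of_real (\<bar>z\<bar> powr \<sigma>) * \<theta> (s, z) - \<i> * of_real (\<bar>z\<bar> powr \<sigma>) * \<theta>\<^sub>0) (at z)"
      using Gt[OF box_t[OF z]] odd_power_derivative[OF \<open>0 < \<sigma>\<close>, of z]
      by (auto intro!: derivative_eq_intros has_vector_derivative_of_real simp: has_real_derivative_iff_has_vector_derivative)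
    have "norm (\<i> * of_real (\<bar>z\<bar> powr \<sigma>) * \<theta> (s, z) - \<i> * of_real (\<bar>z\<bar> powr \<sigma>) * \<theta>\<^sub>0)
      = \<bar>z\<bar> powr \<sigma> * norm (\<theta> (s, z) - \<theta>\<^sub>0)"
      unfolding right_diff_distrib[symmetric] norm_mult by simp
    also have "\<dots> \<le> \<bar>z\<bar> powr \<sigma> * (?n / 4)" using z box_t \<theta> by (intro mult_left_mono) auto
    finally show "norm (\<i> * of_real (\<bar>z\<bar> powr \<sigma>) * \<theta> (s, z) - \<i> * of_real (\<bar>z\<bar> powr \<sigma>) * \<theta>\<^sub>0) \<le> ?n / 4 * \<bar>z\<bar> powr \<sigma>"
      by (simp add: mult.commute)
    show "((\<lambda>z. ?n / 4 * ?\<phi> z) has_real_derivative ?n / 4 * \<bar>z\<bar> powr \<sigma>) (at z)"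
      by (intro DERIV_cmult odd_power_derivative \<open>0 < \<sigma>\<close>)
  qed
  moreover have "(G (s, t) - \<i> * of_real (?\<phi> t) * \<theta>\<^sub>0) - (G (s, t') - \<i> * of_real (?\<phi> t') * \<theta>\<^sub>0)
      = (G (s, t) - G (s, t')) - \<i> * of_real (?\<phi> t - ?\<phi> t') * \<theta>\<^sub>0"
    by (simp add: algebra_simps)
  moreover have "\<bar>?n / 4 * ?\<phi> t - ?n / 4 * ?\<phi> t'\<bar> = ?n / 4 * \<bar>?\<phi> t - ?\<phi> t'\<bar>"
    unfolding right_diff_distrib[symmetric] by (simp add: abs_mult)
  ultimately have 2: "norm ((G (s, t) - G (s, t')) - \<i> * of_real (?\<phi> t - ?\<phi> t') * \<theta>\<^sub>0) \<le> ?n / 4 * \<bar>?\<phi> t - ?\<phi> t'\<bar>"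
    by simp
  \<comment> \<open>The increment of \<open>s + \<i> * odd_power \<sigma> t\<close>; its real and
    imaginary parts are the two quantities to be bounded.\<close>
  define w where "w = of_real (s - s') + \<i> * of_real (?\<phi> t - ?\<phi> t')"
  have w: "\<bar>s - s'\<bar> \<le> norm w" "\<bar>?\<phi> t - ?\<phi> t'\<bar> \<le> norm w"
    using abs_Re_le_cmod[of w] abs_Im_le_cmod[of w] by (simp_all add: w_def)
  have "(G x - G y) - w * \<theta>\<^sub>0 = ((G (s, t') - G (s', t')) - of_real (s - s') * \<theta>\<^sub>0)
     + ((G (s, t) - G (s, t')) - \<i> * of_real (?\<phi> t - ?\<phi> t') * \<theta>\<^sub>0)"
    by (simp add: x y w_def algebra_simps)
  then have "norm ((G x - G y) - w * \<theta>\<^sub>0) \<le> ?n / 4 * \<bar>s - s'\<bar> + ?n / 4 * \<bar>?\<phi> t - ?\<phi> t'\<bar>"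
    using 1 2 by (metis add_mono norm_triangle_le)
  also have "\<dots> \<le> ?n / 4 * norm w + ?n / 4 * norm w" using w by (intro add_mono mult_left_mono) auto
  \<comment> \<open>The error is at most half of the main term \<open>w * \<theta>\<^sub>0\<close>,
    so the reverse triangle inequality keeps the other half.\<close>
  finally have "norm ((G x - G y) - w * \<theta>\<^sub>0) \<le> ?n / 2 * norm w" by simp
  moreover have "norm (w * \<theta>\<^sub>0) \<le> norm (G x - G y) + norm ((G x - G y) - w * \<theta>\<^sub>0)"
    using norm_triangle_ineq4[of "G x - G y" "(G x - G y) - w * \<theta>\<^sub>0"] by simp
  ultimately have 3: "?n / 2 * norm w \<le> norm (G x - G y)" by (simp add: norm_mult mult.commute)
  have "?n / 2 * \<bar>s - s'\<bar> \<le> ?n / 2 * norm w" "?n / 2 * \<bar>?\<phi> t - ?\<phi> t'\<bar> \<le> ?n / 2 * norm w"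
    using w by (intro mult_left_mono; simp)+
  then show "?n / 2 * \<bar>fst x - fst y\<bar> \<le> norm (G x - G y)"
    "?n / 2 * \<bar>?\<phi> (snd x) - ?\<phi> (snd y)\<bar> \<le> norm (G x - G y)"
    using 3 by (simp_all add: x y)
qed

text \<open>In the coordinates \<open>(s, t)\<close> the differential of \<open>E\<close> is
  \<theta> times the model form, so the box estimate applies to \<open>E\<close> composed with the
  inverse chart; the work lies in justifying this for charts that are only C^1. The bound on the
  variation of \<open>s\<close> alone is recorded to show later that the characteristic set is
  null.\<close>

lemma normal_form_lower_bound:
  fixes E \<theta> Ex Ey :: "plane \<Rightarrow> complex"
  assumes coords: "C1_coords U s t" and p0: "p\<^sub>0 \<in> U" and "0 < \<sigma>"
    and E: "\<And>p. p \<in> U \<Longrightarrow> (E has_derivative (\<lambda>v. fst v *\<^sub>R Ex p + snd v *\<^sub>R Ey p)) (at p)"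
    and cont: "isCont Ex p\<^sub>0" "isCont Ey p\<^sub>0"
    and form: "\<And>p v. p \<in> U \<Longrightarrow> fst v *\<^sub>R Ex p + snd v *\<^sub>R Ey p = \<theta> p * (of_real (frechet_derivative s (at p) v)
        + \<i> * of_real (\<bar>t p\<bar> powr \<sigma>) * of_real (frechet_derivative t (at p) v))"
    and "\<theta> p\<^sub>0 \<noteq> 0"
  obtains \<delta> c C where "0 < \<delta>" "ball p\<^sub>0 \<delta> \<subseteq> U" "0 < c" "0 \<le> C"
    "\<And>p p'. p \<in> ball p\<^sub>0 \<delta> \<Longrightarrow> p' \<in> ball p\<^sub>0 \<delta> \<Longrightarrow> norm (p - p') \<le> C * max \<bar>s p - s p'\<bar> \<bar>t p - t p'\<bar>"
    "\<And>p p'. p \<in> ball p\<^sub>0 \<delta> \<Longrightarrow> p' \<in> ball p\<^sub>0 \<delta> \<Longrightarrow> \<bar>s p - s p'\<bar> \<le> C"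
    "\<And>p p'. p \<in> ball p\<^sub>0 \<delta> \<Longrightarrow> p' \<in> ball p\<^sub>0 \<delta> \<Longrightarrow> c * \<bar>s p - s p'\<bar> \<le> norm (E p - E p')"
    "\<And>p p'. p \<in> ball p\<^sub>0 \<delta> \<Longrightarrow> p' \<in> ball p\<^sub>0 \<delta> \<Longrightarrow> c * \<bar>odd_power \<sigma> (t p) - odd_power \<sigma> (t p')\<bar> \<le> norm (E p - E p')"
proof -
  have "open U" and inj: "inj_on (\<lambda>p. (s p, t p)) U"
    and sd: "\<And>p. p \<in> U \<Longrightarrow> s differentiable (at p)" and td: "\<And>p. p \<in> U \<Longrightarrow> t differentiable (at p)"
    and contU: "continuous_on U (pd_x s)" "continuous_on U (pd_y s)" "continuous_on U (pd_x t)" "continuous_on U (pd_y t)"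
    and det: "\<And>p. p \<in> U \<Longrightarrow> pd_x s p * pd_y t p - pd_y s p * pd_x t p \<noteq> 0"
    using coords by (auto simp: C1_coords_def wedge_def pd_x_def pd_y_def)
  have isc: "isCont (pd_x s) p\<^sub>0" "isCont (pd_y s) p\<^sub>0" "isCont (pd_x t) p\<^sub>0" "isCont (pd_y t) p\<^sub>0"
    using contU \<open>open U\<close> p0 by (auto simp: continuous_on_eq_continuous_at)
  have st_cont: "isCont s p" "isCont t p" if "p \<in> U" for p
    using sd[OF that] td[OF that] by (auto intro: differentiable_imp_continuous_within)

  have \<theta>_cont: "isCont \<theta> p\<^sub>0"
  proof -
    \<comment> \<open>Continuity of \<theta> has to be derived. Along a coordinate direction in
      which \<open>s\<close> has a non-zero derivative the bracket has a non-zero real part, so near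
      the point \<theta> is a quotient of functions continuous there.\<close>
    have q: "isCont \<theta> p\<^sub>0" if u: "isCont Ev p\<^sub>0" "isCont sv p\<^sub>0" "isCont tv p\<^sub>0" "sv p\<^sub>0 \<noteq> 0"
      "\<And>p. p \<in> U \<Longrightarrow> Ev p = \<theta> p * (of_real (sv p) + \<i> * of_real (\<bar>t p\<bar> powr \<sigma>) * of_real (tv p))"
      for Ev and sv tv :: "plane \<Rightarrow> real"
    proof -
      let ?w = "\<lambda>p. of_real (sv p) + \<i> * of_real (\<bar>t p\<bar> powr \<sigma>) * of_real (tv p)"
      have "((\<lambda>p. \<bar>t p\<bar> powr \<sigma>) \<longlongrightarrow> \<bar>t p\<^sub>0\<bar> powr \<sigma>) (at p\<^sub>0)"
        using st_cont(2)[OF p0] \<open>0 < \<sigma>\<close> by (intro tendsto_powr' tendsto_intros) (auto simp: isCont_def)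
      then have w: "isCont ?w p\<^sub>0" using u(2,3) unfolding isCont_def
        by (intro tendsto_add tendsto_mult tendsto_of_real tendsto_const)
      have w0: "?w p\<^sub>0 \<noteq> 0" using u by (auto simp: complex_eq_iff)
      obtain e where e: "0 < e" "\<And>p. dist p\<^sub>0 p < e \<Longrightarrow> ?w p \<noteq> 0" using continuous_at_avoid[OF w w0] by blast
      have "\<forall>\<^sub>F p in nhds p\<^sub>0. \<theta> p = Ev p / ?w p"
      proof (rule eventually_mono[OF eventually_conj])
        show "\<forall>\<^sub>F p in nhds p\<^sub>0. p \<in> U" by (rule eventually_nhds_in_open) fact+
        show "\<forall>\<^sub>F p in nhds p\<^sub>0. p \<in> ball p\<^sub>0 e" by (rule eventually_nhds_in_open) (use e in auto)
        fix p assume "p \<in> U \<and> p \<in> ball p\<^sub>0 e"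
        then have "?w p \<noteq> 0" "Ev p = \<theta> p * ?w p" using e u by auto
        then show "\<theta> p = Ev p / ?w p" by simp
      qed
      moreover have "isCont (\<lambda>p. Ev p / ?w p) p\<^sub>0" by (rule isCont_divide[OF u(1) w w0])
      ultimately show ?thesis by (simp add: isCont_cong)
    qed
    have "pd_x s p\<^sub>0 \<noteq> 0 \<or> pd_y s p\<^sub>0 \<noteq> 0" using det[OF p0] by auto
    then show ?thesis
    proof
      assume "pd_x s p\<^sub>0 \<noteq> 0"
      then show ?thesis using form[of _ "(1, 0)"] by (intro q[of Ex "pd_x s" "pd_x t"] cont isc) (auto simp: pd_x_def)
    next
      assume "pd_y s p\<^sub>0 \<noteq> 0"
      then show ?thesis using form[of _ "(0, 1)"] by (intro q[of Ey "pd_y s" "pd_y t"] cont isc) (auto simp: pd_y_def)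
    qed
  qed
  obtain \<delta>\<^sub>\<theta> where d\<theta>: "0 < \<delta>\<^sub>\<theta>" "\<And>p. dist p p\<^sub>0 < \<delta>\<^sub>\<theta> \<Longrightarrow> norm (\<theta> p - \<theta> p\<^sub>0) < norm (\<theta> p\<^sub>0) / 4"
    using \<theta>_cont \<open>\<theta> p\<^sub>0 \<noteq> 0\<close> unfolding continuous_at_eps_delta dist_norm
    by (meson divide_pos_pos zero_less_norm_iff zero_less_numeral)

  define \<Phi> where "\<Phi> p = (s p, t p)" for p
  define \<Phi>' where "\<Phi>' p v = fst v *\<^sub>R (pd_x s p, pd_x t p) + snd v *\<^sub>R (pd_y s p, pd_y t p)" for p v :: plane
  have \<Phi>_deriv: "(\<Phi> has_derivative \<Phi>' p) (at p)" if "p \<in> U" for p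
    using has_derivative_Pair[OF has_derivative_partials[OF sd[OF that]] has_derivative_partials[OF td[OF that]]]
    by (simp add: \<Phi>_def[abs_def] \<Phi>'_def[abs_def] mult.commute)
  have \<Phi>_inj: "v = 0" if "\<Phi>' p v = 0" "p \<in> U" for p v
  proof -
    obtain v1 v2 where v: "v = (v1, v2)" by (cases v)
    have 1: "v1 * pd_x s p + v2 * pd_y s p = 0" "v1 * pd_x t p + v2 * pd_y t p = 0"
      using that(1) by (simp_all add: v \<Phi>'_def zero_prod_def)
    have "v1 * (pd_x s p * pd_y t p - pd_y s p * pd_x t p)
       = (v1 * pd_x s p + v2 * pd_y s p) * pd_y t p - (v1 * pd_x t p + v2 * pd_y t p) * pd_y s p"
      "v2 * (pd_x s p * pd_y t p - pd_y s p * pd_x t p)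
       = (v1 * pd_x t p + v2 * pd_y t p) * pd_x s p - (v1 * pd_x s p + v2 * pd_y s p) * pd_x t p"
      by (simp_all add: algebra_simps)
    then have "v1 * (pd_x s p * pd_y t p - pd_y s p * pd_x t p) = 0" "v2 * (pd_x s p * pd_y t p - pd_y s p * pd_x t p) = 0"
      unfolding 1 by simp_all
    then show ?thesis using det[OF that(2)] unfolding mult_eq_0_iff v zero_prod_def by blast
  qed
  obtain \<delta>\<^sub>1 c\<^sub>1 where d1: "0 < \<delta>\<^sub>1" "ball p\<^sub>0 \<delta>\<^sub>1 \<subseteq> U" "0 < c\<^sub>1"
    "\<And>p p'. p \<in> ball p\<^sub>0 \<delta>\<^sub>1 \<Longrightarrow> p' \<in> ball p\<^sub>0 \<delta>\<^sub>1 \<Longrightarrow> c\<^sub>1 * norm (p - p') \<le> norm (\<Phi> p - \<Phi> p')"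
  proof (rule C1_lower_bound[OF \<open>open U\<close> p0, of \<Phi> "\<lambda>p. (pd_x s p, pd_x t p)" "\<lambda>p. (pd_y s p, pd_y t p)"])
    show "(\<Phi> has_derivative (\<lambda>v. fst v *\<^sub>R (pd_x s p, pd_x t p) + snd v *\<^sub>R (pd_y s p, pd_y t p))) (at p)" if "p \<in> U" for p
      using \<Phi>_deriv[OF that] by (simp add: \<Phi>'_def[abs_def])
    show "v = 0" if "fst v *\<^sub>R (pd_x s p\<^sub>0, pd_x t p\<^sub>0) + snd v *\<^sub>R (pd_y s p\<^sub>0, pd_y t p\<^sub>0) = 0" for v
      using \<Phi>_inj[OF _ p0, of v] that by (simp add: \<Phi>'_def)
    show "isCont (\<lambda>p. (pd_x s p, pd_x t p)) p\<^sub>0" "isCont (\<lambda>p. (pd_y s p, pd_y t p)) p\<^sub>0"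
      using isc by (auto intro!: continuous_intros)
  qed blast
  define B where "B = ball p\<^sub>0 (min \<delta>\<^sub>1 \<delta>\<^sub>\<theta>)"
  have B: "open B" "p\<^sub>0 \<in> B" "B \<subseteq> U" "B \<subseteq> ball p\<^sub>0 \<delta>\<^sub>1" using d1 d\<theta> by (auto simp: B_def)
  have \<Phi>_cont: "continuous_on B \<Phi>" unfolding \<Phi>_def using B st_cont
    by (intro continuous_at_imp_continuous_on ballI continuous_intros) auto
  have \<Phi>_injB: "inj_on \<Phi> B" unfolding \<Phi>_def by (rule inj_on_subset[OF inj]) fact
  define g where "g = inv_into B \<Phi>"
  have g: "g (\<Phi> p) = p" if "p \<in> B" for p unfolding g_def using that \<Phi>_injB by (rule inv_into_f_f[rotated])
  \<comment> \<open>Invariance of domain supplies an open image, hence a box on which the inverse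
    \<open>g\<close> is defined.\<close>
  have "open (\<Phi> ` B)" using B \<Phi>_cont \<Phi>_injB by (intro invariance_of_domain_gen) auto
  moreover have "\<Phi> p\<^sub>0 \<in> \<Phi> ` B" using B by blast
  ultimately obtain e where e: "0 < e" "ball (\<Phi> p\<^sub>0) e \<subseteq> \<Phi> ` B" using open_contains_ball by blast
  define bx where "bx = {x. \<bar>fst x - s p\<^sub>0\<bar> < e / 2 \<and> \<bar>snd x - t p\<^sub>0\<bar> < e / 2}"
  have box_sub: "bx \<subseteq> \<Phi> ` B"
  proof
    fix x assume "x \<in> bx"
    then have x: "\<bar>fst x - s p\<^sub>0\<bar> < e / 2" "\<bar>snd x - t p\<^sub>0\<bar> < e / 2" by (auto simp: bx_def)
    have "norm (x - \<Phi> p\<^sub>0) \<le> norm (fst (x - \<Phi> p\<^sub>0)) + norm (snd (x - \<Phi> p\<^sub>0))"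
      by (metis norm_Pair_le prod.collapse)
    then have "norm (x - \<Phi> p\<^sub>0) < e" using x by (simp add: \<Phi>_def)
    then show "x \<in> \<Phi> ` B" using e by (auto simp: dist_norm norm_minus_commute)
  qed
  have gB: "g x \<in> B" and \<Phi>g: "\<Phi> (g x) = x" if "x \<in> bx" for x
    using box_sub that by (auto simp: g_def inv_into_into f_inv_into_f)

  have Eg: "\<exists>g'. \<Phi>' (g x) \<circ> g' = id \<and> ((E \<circ> g) has_derivative (\<lambda>v. fst (g' v) *\<^sub>R Ex (g x) + snd (g' v) *\<^sub>R Ey (g x))) (at x)"
    if x: "x \<in> bx" for x
  proof -
    have gU: "g x \<in> U" using gB[OF x] B by blast
    have lin: "linear (\<Phi>' (g x))" using \<Phi>_deriv[OF gU] by (rule has_derivative_linear)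
    then have "inj (\<Phi>' (g x))" using \<Phi>_inj[OF _ gU] by (subst linear_injective_0) auto
    then obtain g' where g': "linear g'" "\<Phi>' (g x) \<circ> g' = id"
      using linear_injective_isomorphism[OF lin] by (metis comp_def eq_id_iff)
    have "(g has_derivative g') (at (\<Phi> (g x)))"
      by (rule has_derivative_inverse_strong[OF B(1) gB[OF x] \<Phi>_cont g \<Phi>_deriv[OF gU] g'(2)])
    then have "(g has_derivative g') (at x)" by (simp add: \<Phi>g[OF x])
    from diff_chain_at[OF this E[OF gU]] g'(2) show ?thesis by (auto simp: o_def)
  qed
  have st_g: "s (g x) = fst x" "t (g x) = snd x" if "x \<in> bx" for x
    using arg_cong[OF \<Phi>g[OF that], of fst] arg_cong[OF \<Phi>g[OF that], of snd] by (simp_all add: \<Phi>_def)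
  \<comment> \<open>Pulling back by the inverse chart turns ds and dt into the coordinate
    projections.\<close>
  have dir: "fst (g' v) *\<^sub>R Ex (g x) + snd (g' v) *\<^sub>R Ey (g x) = \<theta> (g x) * (of_real (fst v) + \<i> * of_real (\<bar>snd x\<bar> powr \<sigma>) * of_real (snd v))"
    if "x \<in> bx" "\<Phi>' (g x) \<circ> g' = id" for x g' v
  proof -
    have gU: "g x \<in> U" using gB[OF that(1)] B by blast
    have "\<Phi>' (g x) (g' v) = v" using that(2) by (metis comp_apply id_apply)
    then have "frechet_derivative s (at (g x)) (g' v) = fst v" "frechet_derivative t (at (g x)) (g' v) = snd v"
      unfolding frechet_derivative_partials[OF sd[OF gU]] frechet_derivative_partials[OF td[OF gU]]
      by (auto simp: \<Phi>'_def prod_eq_iff)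
    then show ?thesis using form[OF gU, of "g' v"] st_g(2)[OF that(1)] by simp
  qed
  note est = normal_form_estimate[of \<sigma> bx "s p\<^sub>0" "e / 2" "t p\<^sub>0" "E \<circ> g" "\<theta> \<circ> g" "\<theta> p\<^sub>0", OF \<open>0 < \<sigma>\<close> bx_def]
  have Gs: "((\<lambda>s. (E \<circ> g) (s, y)) has_vector_derivative (\<theta> \<circ> g) (x, y)) (at x)" if xy: "(x, y) \<in> bx" for x y
  proof -
    obtain g' where g': "\<Phi>' (g (x, y)) \<circ> g' = id"
      "((E \<circ> g) has_derivative (\<lambda>v. fst (g' v) *\<^sub>R Ex (g (x, y)) + snd (g' v) *\<^sub>R Ey (g (x, y)))) (at (x, y))"
      using Eg[OF xy] by blast
    have "((\<lambda>s. (s, y)) has_derivative (\<lambda>h. (h, 0))) (at x)" by (auto intro!: derivative_eq_intros)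
    from diff_chain_at[OF this g'(2)]
    have "((\<lambda>z. E (g (z, y))) has_derivative (\<lambda>h. fst (g' (h, 0)) *\<^sub>R Ex (g (x, y)) + snd (g' (h, 0)) *\<^sub>R Ey (g (x, y)))) (at x)"
      by (simp only: o_def)
    then show ?thesis
      unfolding has_vector_derivative_def dir[OF xy g'(1)] by (simp add: scaleR_conv_of_real mult.commute)
  qed
  have Gt: "((\<lambda>t. (E \<circ> g) (x, t)) has_vector_derivative \<i> * of_real (\<bar>y\<bar> powr \<sigma>) * (\<theta> \<circ> g) (x, y)) (at y)" if xy: "(x, y) \<in> bx" for x y
  proof -
    obtain g' where g': "\<Phi>' (g (x, y)) \<circ> g' = id"
      "((E \<circ> g) has_derivative (\<lambda>v. fst (g' v) *\<^sub>R Ex (g (x, y)) + snd (g' v) *\<^sub>R Ey (g (x, y)))) (at (x, y))"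
      using Eg[OF xy] by blast
    have "((\<lambda>t. (x, t)) has_derivative (\<lambda>h. (0, h))) (at y)" by (auto intro!: derivative_eq_intros)
    from diff_chain_at[OF this g'(2)]
    have "((\<lambda>z. E (g (x, z))) has_derivative (\<lambda>h. fst (g' (0, h)) *\<^sub>R Ex (g (x, y)) + snd (g' (0, h)) *\<^sub>R Ey (g (x, y)))) (at y)"
      by (simp only: o_def)
    then show ?thesis
      unfolding has_vector_derivative_def dir[OF xy g'(1)] by (simp add: scaleR_conv_of_real mult_ac)
  qed
  have \<theta>g: "norm ((\<theta> \<circ> g) x - \<theta> p\<^sub>0) \<le> norm (\<theta> p\<^sub>0) / 4" if "x \<in> bx" for x
  proof -
    have "dist (g x) p\<^sub>0 < \<delta>\<^sub>\<theta>" using gB[OF that] by (auto simp: B_def dist_commute)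
    then show ?thesis using d\<theta>(2)[of "g x"] by simp
  qed
  note est = est[OF Gs Gt \<theta>g]

  have "open bx" unfolding bx_def by (intro open_Collect_conj open_Collect_less continuous_intros)
  then have "open (\<Phi> -` bx \<inter> B)"
    using continuous_on_open_vimage[OF B(1)] \<Phi>_cont by blast
  moreover have "p\<^sub>0 \<in> \<Phi> -` bx \<inter> B" using B e by (auto simp: bx_def \<Phi>_def)
  ultimately obtain \<delta> where \<delta>: "0 < \<delta>" "ball p\<^sub>0 \<delta> \<subseteq> \<Phi> -` bx \<inter> B" using open_contains_ball by blast
  show thesis
  \<comment> \<open>\<open>2 / c\<^sub>1\<close> turns the Euclidean lower bound into one for the
    maximum; \<open>e\<close> bounds the width of the box in \<open>s\<close>.\<close>
  proof (rule that[of \<delta> "norm (\<theta> p\<^sub>0) / 2" "max (2 / c\<^sub>1) e"])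
    show "0 < \<delta>" "0 < norm (\<theta> p\<^sub>0) / 2" "0 \<le> max (2 / c\<^sub>1) e" "ball p\<^sub>0 \<delta> \<subseteq> U"
      using \<delta> B \<open>\<theta> p\<^sub>0 \<noteq> 0\<close> e by auto
    fix p p' assume pp: "p \<in> ball p\<^sub>0 \<delta>" "p' \<in> ball p\<^sub>0 \<delta>"
    then have bx: "\<Phi> p \<in> bx" "\<Phi> p' \<in> bx" and inB: "p \<in> B" "p' \<in> B" using \<delta> by auto
    have "c\<^sub>1 * norm (p - p') \<le> norm (\<Phi> p - \<Phi> p')" using inB B by (intro d1) auto
    also have "\<dots> \<le> \<bar>s p - s p'\<bar> + \<bar>t p - t p'\<bar>" unfolding \<Phi>_def using norm_Pair_le[of "s p - s p'" "t p - t p'"] by simp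
    also have "\<dots> \<le> 2 * max \<bar>s p - s p'\<bar> \<bar>t p - t p'\<bar>"
      using max.cobounded1[of "\<bar>s p - s p'\<bar>" "\<bar>t p - t p'\<bar>"] max.cobounded2[of "\<bar>t p - t p'\<bar>" "\<bar>s p - s p'\<bar>"] by linarith
    finally have "norm (p - p') \<le> (2 / c\<^sub>1) * max \<bar>s p - s p'\<bar> \<bar>t p - t p'\<bar>" using d1(3) by (simp add: field_simps)
    also have "\<dots> \<le> max (2 / c\<^sub>1) e * max \<bar>s p - s p'\<bar> \<bar>t p - t p'\<bar>" by (intro mult_right_mono) auto
    finally show "norm (p - p') \<le> max (2 / c\<^sub>1) e * max \<bar>s p - s p'\<bar> \<bar>t p - t p'\<bar>" .
    have "\<bar>s p - s p\<^sub>0\<bar> < e / 2" "\<bar>s p' - s p\<^sub>0\<bar> < e / 2" using bx by (auto simp: bx_def \<Phi>_def)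
    then have "\<bar>s p - s p'\<bar> \<le> e" by linarith
    then show "\<bar>s p - s p'\<bar> \<le> max (2 / c\<^sub>1) e" by simp
    show "norm (\<theta> p\<^sub>0) / 2 * \<bar>s p - s p'\<bar> \<le> norm (E p - E p')"
      "norm (\<theta> p\<^sub>0) / 2 * \<bar>odd_power \<sigma> (t p) - odd_power \<sigma> (t p')\<bar> \<le> norm (E p - E p')"
      using est[OF _ _ _ bx] g inB by (simp_all add: \<Phi>_def)
  qed
qed

subsection \<open>Global injectivity and periodicity\<close>

text \<open>The segment between two points of a fibre is the lift of a loop; the loop contracts
  linearly, so by monodromy its lift closes up and the points agree. Equal dimensions make
  invariance of domain available, by which local injectivity already yields open maps and local
  homeomorphisms.\<close>

lemma inj_of_proper_locally_injective:
  fixes Z :: "'a::euclidean_space \<Rightarrow> 'b::euclidean_space"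
  assumes dim: "DIM('b) = DIM('a)" and cont: "continuous_on UNIV Z"
    and loc: "\<And>p. \<exists>\<delta>>0. inj_on Z (ball p \<delta>)"
    and proper: "\<And>z r. bounded (Z -` cball z r)"
  shows "inj Z"
proof -
  have K: "compact (Z -` cball z r)" for z r
    using proper cont by (auto simp: compact_eq_bounded_closed intro!: closed_vimage)
  have openZ: "open (Z ` W)" if "open W" "inj_on Z W" for W
    using that dim continuous_on_subset[OF cont] by (intro invariance_of_domain_gen) auto
  have surj: "range Z = UNIV"
  proof -
    have "open (range Z)"
    proof (rule openI)
      fix z assume "z \<in> range Z"
      then obtain p where p: "z = Z p" by blast
      obtain \<delta> where \<delta>: "\<delta> > 0" "inj_on Z (ball p \<delta>)" using loc by blast
      have "open (Z ` ball p \<delta>)" "z \<in> Z ` ball p \<delta>" using openZ \<delta> p by auto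
      then show "\<exists>e>0. ball z e \<subseteq> range Z" by (metis open_contains_ball image_mono subset_UNIV subset_trans)
    qed
    \<comment> \<open>Properness enters here: the preimage of a ball around the limit is compact, so
      the limit is attained.\<close>
    moreover have "closed (range Z)"
    proof (rule closed_sequential_limits[THEN iffD2, rule_format], elim conjE)
      fix f l assume f: "\<forall>n. f n \<in> range Z" "f \<longlonglongrightarrow> l"
      obtain n0 where n0: "\<And>n. n \<ge> n0 \<Longrightarrow> dist (f n) l < 1"
        using f(2) unfolding lim_sequentially by (meson zero_less_one)
      have "closed (Z ` (Z -` cball l 1))"
        using compact_continuous_image[OF continuous_on_subset[OF cont] K] by (intro compact_imp_closed) auto
      moreover have "\<forall>\<^sub>F n in sequentially. f n \<in> Z ` (Z -` cball l 1)"
        unfolding eventually_sequentially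
      proof (intro exI[of _ n0] allI impI)
        fix n assume "n0 \<le> n"
        then show "f n \<in> Z ` (Z -` cball l 1)" using n0[of n] f(1) by (auto simp: image_iff dist_commute less_imp_le)
      qed
      ultimately have "l \<in> Z ` (Z -` cball l 1)" using f(2) Lim_in_closed_set by fastforce
      then show "l \<in> range Z" by blast
    qed
    ultimately show ?thesis using clopen by blast
  qed
  have "covering_space UNIV Z UNIV"
  proof (rule covering_spaceI)
    fix z :: 'b
    define F where "F = Z -` {z}"
    have "compact F" using K[of z 0] by (simp add: F_def)
    obtain \<delta> where \<delta>: "\<And>p. \<delta> p > 0" "\<And>p. inj_on Z (ball p (\<delta> p))" using loc by metis
    have "finite F"
    proof (rule ccontr)
      assume "infinite F"
      then obtain x where x: "x \<in> F" "x islimpt F"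
        using \<open>compact F\<close> compact_eq_Bolzano_Weierstrass[of F] by blast
      then obtain y where y: "y \<in> F" "y \<noteq> x" "dist y x < \<delta> x" using \<delta>(1)[of x] unfolding islimpt_approachable by blast
      then show False using inj_onD[OF \<delta>(2)[of x], of x y] x \<delta>(1)[of x] by (auto simp: F_def dist_commute)
    qed
    \<comment> \<open>Inserting 1 ensures that \<open>Min\<close> is taken over a non-empty set;
      half of the minimal radius makes the balls around distinct points of the fibre
      disjoint.\<close>
    obtain e where e: "0 < e" "\<And>p. p \<in> F \<Longrightarrow> 2 * e \<le> \<delta> p"
    proof (rule that[of "Min (insert 1 (\<delta> ` F)) / 2"])
      show "0 < Min (insert 1 (\<delta> ` F)) / 2" using \<open>finite F\<close> \<delta>(1) by (auto simp: Min_gr_iff)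
      show "2 * (Min (insert 1 (\<delta> ` F)) / 2) \<le> \<delta> p" if "p \<in> F" for p using \<open>finite F\<close> that by (auto intro!: Min_le)
    qed
    have inj: "inj_on Z (ball p e)" if "p \<in> F" for p
      using e(2)[OF that] e(1) by (intro inj_on_subset[OF \<delta>(2)[of p]] subset_ball) auto
    have disj: "ball p e \<inter> ball p' e = {}" if "p \<in> F" "p' \<in> F" "p \<noteq> p'" for p p'
    proof (rule ccontr)
      assume "ball p e \<inter> ball p' e \<noteq> {}"
      then obtain x where "dist p x < e" "dist p' x < e" by auto
      then have "dist p p' < \<delta> p" using e(2)[OF that(1)] dist_triangle2[of p p' x] by linarith
      then show False using inj_onD[OF \<delta>(2)[of p], of p p'] that \<delta>(1)[of p] by (auto simp: F_def)
    qed
    \<comment> \<open>The points over a neighbourhood of \<open>z\<close> that stay away from the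
      fibre. Their image is compact and misses \<open>z\<close>, so over a smaller ball the whole
      preimage lies in the balls around the fibre.\<close>
    define K1 where "K1 = Z -` cball z 1 - (\<Union>p\<in>F. ball p e)"
    have "compact K1" unfolding K1_def by (intro compact_diff K open_UN ballI open_ball)
    then have "closed (Z ` K1)" using continuous_on_subset[OF cont] by (intro compact_imp_closed compact_continuous_image) auto
    moreover have "z \<notin> Z ` K1" using e by (auto simp: K1_def F_def)
    ultimately have "open (- (Z ` K1) \<inter> ball z 1 \<inter> (\<Inter>p\<in>F. Z ` ball p e))"
      using \<open>finite F\<close> inj by (intro open_Int open_INT openZ ballI) auto
    moreover have "z \<in> - (Z ` K1) \<inter> ball z 1 \<inter> (\<Inter>p\<in>F. Z ` ball p e)"
      using \<open>z \<notin> Z ` K1\<close> e by (auto simp: F_def)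
    ultimately obtain \<rho> where \<rho>: "0 < \<rho>" "ball z \<rho> \<subseteq> - (Z ` K1) \<inter> ball z 1 \<inter> (\<Inter>p\<in>F. Z ` ball p e)"
      using open_contains_ball by meson
    define V where "V = (\<lambda>p. ball p e \<inter> Z -` ball z \<rho>) ` F"
    have opens: "open (ball p e \<inter> Z -` ball z \<rho>)" for p using cont by (intro open_Int open_vimage) auto
    show "\<exists>T. z \<in> T \<and> openin (top_of_set UNIV) T \<and> (\<exists>v. \<Union>v = UNIV \<inter> Z -` T \<and>
      (\<forall>u\<in>v. openin (top_of_set UNIV) u) \<and> pairwise disjnt v \<and> (\<forall>u\<in>v. \<exists>q. homeomorphism u T Z q))"
    proof (intro exI[of _ "ball z \<rho>"] conjI exI[of _ V])
      show "z \<in> ball z \<rho>" "openin (top_of_set UNIV) (ball z \<rho>)" using \<rho> by auto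
      show "\<Union>V = UNIV \<inter> Z -` ball z \<rho>"
      proof
        show "UNIV \<inter> Z -` ball z \<rho> \<subseteq> \<Union>V"
        proof
          fix p assume "p \<in> UNIV \<inter> Z -` ball z \<rho>"
          then have p: "Z p \<in> ball z \<rho>" by auto
          then have "Z p \<notin> Z ` K1" "Z p \<in> ball z 1" using \<rho>(2) by blast+
          then have "p \<in> (\<Union>p\<in>F. ball p e)" unfolding K1_def by (auto simp: less_imp_le)
          then show "p \<in> \<Union>V" using p by (auto simp: V_def)
        qed
      qed (auto simp: V_def)
      show "\<forall>u\<in>V. openin (top_of_set UNIV) u" using opens by (auto simp: V_def)
      show "pairwise disjnt V" using disj unfolding V_def pairwise_image by (fastforce simp: pairwise_def disjnt_def)
      show "\<forall>u\<in>V. \<exists>q. homeomorphism u (ball z \<rho>) Z q"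
      proof
        fix u assume "u \<in> V"
        then obtain p where p: "p \<in> F" "u = ball p e \<inter> Z -` ball z \<rho>" by (auto simp: V_def)
        have "Z ` u = ball z \<rho>"
        proof
          show "ball z \<rho> \<subseteq> Z ` u"
          proof
            fix y assume y: "y \<in> ball z \<rho>"
            then have "y \<in> Z ` ball p e" using \<rho>(2) p by blast
            then show "y \<in> Z ` u" using y p by blast
          qed
        qed (use p in auto)
        moreover have "inj_on Z u" using p inj by (auto intro: inj_on_subset)
        ultimately show "\<exists>q. homeomorphism u (ball z \<rho>) Z q"
          using invariance_of_domain_homeomorphism[of u Z] opens[of p] p dim continuous_on_subset[OF cont]
          by (metis order_refl subset_UNIV)
      qed
    qed
  qed (use cont surj in auto)
  note monodromy = covering_space_monodromy[OF this]
  show "inj Z"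
  proof (rule injI)
    fix p p' assume eq: "Z p = Z p'"
    let ?h = "linepath p p'"
    have path: "path (Z \<circ> ?h)" by (intro path_continuous_image path_linepath continuous_on_subset[OF cont]) auto
    have "homotopic_paths UNIV (Z \<circ> ?h) (linepath (Z p) (Z p))"
      using path eq by (intro homotopic_paths_linear) (auto simp: pathstart_compose pathfinish_compose)
    then have "pathfinish ?h = pathfinish (linepath p p)"
      using path by (intro monodromy[of "Z \<circ> ?h" "linepath (Z p) (Z p)"]) (auto simp: fun_cong[OF linepath_refl])
    then show "p = p'" by simp
  qed
qed

section \<open>Lattice translations of periodic functions\<close>

lemma torus_fun_shift:
  assumes "torus_fun g"
  shows "g (p + (of_int m, of_int n)) = g p"
proof -
  have x: "g (p + (1, 0)) = g p" and y: "g (p + (0, 1)) = g p" for p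
    using assms unfolding torus_fun_def by blast+
  have 1: "g (p + (of_int m, 0)) = g p" for p
  proof (induction m rule: int_induct[of _ 0])
    case (step1 i)
    then show ?case using x[of "p + (of_int i, 0)"] by (simp add: add.assoc)
  next
    case (step2 i)
    then show ?case using x[of "p + (of_int (i - 1), 0)"] by (simp add: add.assoc)
  qed (simp add: zero_prod_def[symmetric])
  have 2: "g (p + (0, of_int n)) = g p" for p
  proof (induction n rule: int_induct[of _ 0])
    case (step1 i)
    then show ?case using y[of "p + (0, of_int i)"] by (simp add: add.assoc)
  next
    case (step2 i)
    then show ?case using y[of "p + (0, of_int (i - 1))"] by (simp add: add.assoc)
  qed (simp add: zero_prod_def[symmetric])
  show ?thesis using 1[of "p + (0, of_int n)"] 2[of p] by (simp add: add.assoc)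
qed

lemma torus_reduce:
  obtains m n :: int where "p + (of_int m, of_int n) \<in> unit_square"
proof (rule that[of "- \<lfloor>fst p\<rfloor>" "- \<lfloor>snd p\<rfloor>"])
  show "p + (of_int (- \<lfloor>fst p\<rfloor>), of_int (- \<lfloor>snd p\<rfloor>)) \<in> unit_square"
    by (cases p) (auto simp: unit_square_def; linarith)
qed

lemma unit_square_cbox: "unit_square = cbox (0, 0) (1, 1)"
  by (auto simp: unit_square_def cbox_Pair_eq)

lemma compact_unit_square: "compact unit_square"
  unfolding unit_square_cbox by (rule compact_cbox)

lemma torus_fun_bounded:
  fixes g :: "plane \<Rightarrow> 'a::real_normed_vector"
  assumes "torus_fun g" "continuous_on UNIV g"
  obtains C where "0 \<le> C" "\<And>p. norm (g p) \<le> C"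
proof -
  have "bounded (g ` unit_square)"
    using assms(2) by (intro compact_imp_bounded compact_continuous_image compact_unit_square continuous_on_subset[OF assms(2)]) auto
  then obtain C where C: "\<And>p. p \<in> unit_square \<Longrightarrow> norm (g p) \<le> C" by (auto simp: bounded_iff)
  show thesis
  proof (rule that[of "max C 0"])
    fix p
    obtain m n where mn: "p + (of_int m, of_int n) \<in> unit_square" using torus_reduce by blast
    show "norm (g p) \<le> max C 0" using C[OF mn] torus_fun_shift[OF assms(1), of p m n] by simp
  qed simp
qed

subsection \<open>Cauchy transforms of measures of fractional growth\<close>

lemma ex_dyadic_upper:
  fixes x \<rho> :: real
  assumes "0 < \<rho>" "\<rho> \<le> x"
  shows "\<exists>n::nat. \<rho> * 2 ^ n \<le> x \<and> x < 2 * \<rho> * 2 ^ n"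
proof -
  obtain n where n: "x < \<rho> * 2 ^ n" using assms real_arch_pow[of 2 "x / \<rho>"] by (auto simp: field_simps)
  define m where "m = (LEAST n. x < \<rho> * 2 ^ n)"
  have m: "x < \<rho> * 2 ^ m" unfolding m_def by (rule LeastI) fact
  then have "m \<noteq> 0" using assms by (intro notI) auto
  then obtain k where k: "m = Suc k" by (cases m) auto
  have "\<not> x < \<rho> * 2 ^ k" using not_less_Least[of k "\<lambda>n. x < \<rho> * 2 ^ n"] k m_def by auto
  then show ?thesis using m k by (intro exI[of _ k]) (auto simp: algebra_simps)
qed

lemma ex_dyadic_lower:
  fixes x \<rho> :: real
  assumes "0 < x" "x < 2 * \<rho>"
  shows "\<exists>n::nat. \<rho> * (1/2) ^ n \<le> x \<and> x < 2 * \<rho> * (1/2) ^ n"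
proof -
  have "0 < \<rho>" using assms by simp
  then have "\<exists>n. (1/2) ^ n < x / \<rho>" using assms by (intro real_arch_pow_inv) auto
  then obtain n where "(1/2) ^ n < x / \<rho>" ..
  then have n: "\<rho> * (1/2) ^ n \<le> x" using \<open>0 < \<rho>\<close> by (simp add: field_simps)
  define m where "m = (LEAST n. \<rho> * (1/2) ^ n \<le> x)"
  have m: "\<rho> * (1/2) ^ m \<le> x" unfolding m_def by (rule LeastI) fact
  show ?thesis
  proof (cases m)
    case 0
    then show ?thesis using m assms by (intro exI[of _ 0]) auto
  next
    case (Suc k)
    have "\<not> \<rho> * (1/2) ^ k \<le> x" using not_less_Least[of k "\<lambda>n. \<rho> * (1/2) ^ n \<le> x"] Suc m_def by auto
    then show ?thesis using m Suc by (intro exI[of _ m]) auto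
  qed
qed

text \<open>The image of \<open>M\<close> under \<open>E\<close> satisfies Frostman's growth
  condition of dimension \<open>d\<close>. Stating it through preimages of discs replaces any change
  of variables by \<open>E\<close>.\<close>

locale growth_measure = finite_measure M for M :: "'a measure" +
  fixes E :: "'a \<Rightarrow> complex" and C d :: real
  assumes E_meas [measurable]: "E \<in> borel_measurable M"
    and C_nonneg: "0 \<le> C" and d_pos: "0 < d"
    and growth: "\<And>w \<rho>. 0 < \<rho> \<Longrightarrow> emeasure M {x \<in> space M. norm (E x - w) < \<rho>} \<le> ennreal (C * \<rho> powr d)"
begin

text \<open>The growth bound tends to 0 with the radius, so fibres are null. This is what allows the
  poles of the kernel to be ignored throughout.\<close>

lemma AE_neq: "AE x in M. E x \<noteq> w"
proof -
  have lim: "((\<lambda>\<rho>. ennreal (C * \<rho> powr d)) \<longlongrightarrow> ennreal (C * 0)) (at_right 0)"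
  proof (intro tendsto_ennrealI tendsto_mult tendsto_const)
    have "((\<lambda>\<rho>::real. \<rho> powr d) \<longlongrightarrow> 0 powr d) (at_right 0)"
      using d_pos by (intro tendsto_powr') (auto intro!: tendsto_eq_intros eventually_mono[OF eventually_at_right_less[of 0]])
    then show "((\<lambda>\<rho>::real. \<rho> powr d) \<longlongrightarrow> 0) (at_right 0)" using d_pos by simp
  qed
  have "emeasure M {x \<in> space M. E x = w} \<le> 0"
  proof (rule tendsto_lowerbound)
    show "((\<lambda>\<rho>. ennreal (C * \<rho> powr d)) \<longlongrightarrow> 0) (at_right 0)" using lim by simp
    show "\<forall>\<^sub>F \<rho> in at_right 0. emeasure M {x \<in> space M. E x = w} \<le> ennreal (C * \<rho> powr d)"
      unfolding eventually_at_right_field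
    proof (intro exI[of _ 1] conjI allI impI)
      fix \<rho> :: real assume "0 < \<rho>" "\<rho> < 1"
      have "emeasure M {x \<in> space M. E x = w} \<le> emeasure M {x \<in> space M. norm (E x - w) < \<rho>}"
        using \<open>0 < \<rho>\<close> by (intro emeasure_mono) auto
      also have "\<dots> \<le> ennreal (C * \<rho> powr d)" by (rule growth) fact
      finally show "emeasure M {x \<in> space M. E x = w} \<le> ennreal (C * \<rho> powr d)" .
    qed simp
  qed simp
  then have "{x \<in> space M. \<not> E x \<noteq> w} \<in> null_sets M" by (intro null_setsI) auto
  then show ?thesis by (rule AE_I') auto
qed

text \<open>On the shell between \<rho> \<theta>^n and 2 \<rho> \<theta>^n the integrand is at most
  (\<rho> \<theta>^n)^(-s) and the measure is O((\<rho> \<theta>^n)^d), so the shells contribute a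
  geometric series of ratio \<theta>^(d-s). Leaving \<theta> free treats shrinking shells (\<theta>
  = 1/2, \<open>s < d\<close>) and growing ones (\<theta> = 2, \<open>d < s\<close>) at
  once.\<close>

lemma nn_integral_dyadic:
  assumes S [measurable]: "S \<in> sets M" and \<theta>: "0 < \<theta>" "\<theta> powr (d - s) < 1" and "0 < \<rho>" "0 \<le> s"
    and cover: "\<And>x. x \<in> S \<Longrightarrow> \<exists>n::nat. \<rho> * \<theta> ^ n \<le> norm (E x - w) \<and> norm (E x - w) < 2 * \<rho> * \<theta> ^ n"
  shows "(\<integral>\<^sup>+x\<in>S. ennreal (norm (E x - w) powr - s) \<partial>M)
    \<le> ennreal (C * 2 powr d * \<rho> powr (d - s) / (1 - \<theta> powr (d - s)))"
proof -
  define A where "A n = {x \<in> space M. norm (E x - w) < 2 * \<rho> * \<theta> ^ n}" for n :: nat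
  have [measurable]: "A n \<in> sets M" for n unfolding A_def by measurable
  have pos: "0 < \<rho> * \<theta> ^ n" for n using \<theta> \<open>0 < \<rho>\<close> by simp
  have "(\<integral>\<^sup>+x\<in>S. ennreal (norm (E x - w) powr - s) \<partial>M)
     \<le> (\<integral>\<^sup>+x. (\<Sum>n. ennreal ((\<rho> * \<theta> ^ n) powr - s) * indicator (A n) x) \<partial>M)"
  proof (intro nn_integral_mono)
    fix x assume "x \<in> space M"
    show "ennreal (norm (E x - w) powr - s) * indicator S x \<le> (\<Sum>n. ennreal ((\<rho> * \<theta> ^ n) powr - s) * indicator (A n) x)"
    proof (cases "x \<in> S")
      case True
      then obtain n where n: "\<rho> * \<theta> ^ n \<le> norm (E x - w)" "norm (E x - w) < 2 * \<rho> * \<theta> ^ n"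
        using cover by blast
      have "ennreal (norm (E x - w) powr - s) * indicator S x \<le> ennreal ((\<rho> * \<theta> ^ n) powr - s) * indicator (A n) x"
        using True n \<open>x \<in> space M\<close> pos[of n] \<open>0 \<le> s\<close> by (auto simp: A_def intro!: ennreal_leI powr_mono2')
      also have "\<dots> \<le> (\<Sum>n. ennreal ((\<rho> * \<theta> ^ n) powr - s) * indicator (A n) x)"
        using sum_le_suminf[of "\<lambda>n. ennreal ((\<rho> * \<theta> ^ n) powr - s) * indicator (A n) x" "{n}"]
        by (simp only: finite.intros sum.insert sum.empty finite.emptyI empty_iff not_False_eq_True add_0_right) auto
      finally show ?thesis .
    qed auto
  qed
  also have "\<dots> = (\<Sum>n. ennreal ((\<rho> * \<theta> ^ n) powr - s) * emeasure M (A n))"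
    by (simp add: nn_integral_suminf nn_integral_cmult)
  also have "\<dots> \<le> (\<Sum>n. ennreal (C * 2 powr d * \<rho> powr (d - s) * (\<theta> powr (d - s)) ^ n))"
  proof (intro suminf_le allI)
    fix n
    have "ennreal ((\<rho> * \<theta> ^ n) powr - s) * emeasure M (A n)
      \<le> ennreal ((\<rho> * \<theta> ^ n) powr - s) * ennreal (C * (2 * \<rho> * \<theta> ^ n) powr d)"
      unfolding A_def using pos[of n] by (intro mult_left_mono growth) (auto simp: mult.assoc)
    also have "\<dots> = ennreal (C * 2 powr d * ((\<rho> * \<theta> ^ n) powr (d - s)))"
      using pos[of n] C_nonneg by (simp add: ennreal_mult[symmetric] powr_mult powr_diff powr_minus field_simps)
    also have "(\<rho> * \<theta> ^ n) powr (d - s) = \<rho> powr (d - s) * (\<theta> powr (d - s)) ^ n"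
      using \<theta> \<open>0 < \<rho>\<close> by (simp add: powr_mult powr_realpow[symmetric] powr_powr mult.commute)
    finally show "ennreal ((\<rho> * \<theta> ^ n) powr - s) * emeasure M (A n) \<le> ennreal (C * 2 powr d * \<rho> powr (d - s) * (\<theta> powr (d - s)) ^ n)"
      by (simp add: mult.assoc)
  qed auto
  also have "\<dots> = ennreal (\<Sum>n. C * 2 powr d * \<rho> powr (d - s) * (\<theta> powr (d - s)) ^ n)"
    using \<theta> C_nonneg by (intro suminf_ennreal2 summable_mult summable_geometric) auto
  also have "(\<Sum>n. C * 2 powr d * \<rho> powr (d - s) * (\<theta> powr (d - s)) ^ n) = C * 2 powr d * \<rho> powr (d - s) / (1 - \<theta> powr (d - s))"
    using \<theta> by (subst suminf_mult) (auto simp: suminf_geometric summable_geometric)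
  finally show ?thesis .
qed

lemma nn_integral_near:
  assumes "0 \<le> s" "s < d"
  obtains K where "0 \<le> K" "\<And>w \<rho>. 0 < \<rho> \<Longrightarrow>
    (\<integral>\<^sup>+x\<in>{x \<in> space M. norm (E x - w) < \<rho>}. ennreal (norm (E x - w) powr - s) \<partial>M) \<le> ennreal (K * \<rho> powr (d - s))"
proof
  let ?K = "C * 2 powr d / (1 - (1/2) powr (d - s)) * (1/2) powr (d - s)"
  have lt: "(1/2::real) powr (d - s) < 1" using assms by (simp add: powr01_less_one)
  show "0 \<le> ?K" using C_nonneg lt by (intro mult_nonneg_nonneg divide_nonneg_nonneg) auto
  fix w and \<rho> :: real assume "0 < \<rho>"
  \<comment> \<open>Points with \<open>E x = w\<close> lie in no shell but form a null set; the
    radius is halved because the outermost shell reaches up to twice its parameter.\<close>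
  have "(\<integral>\<^sup>+x\<in>{x \<in> space M. norm (E x - w) < \<rho>}. ennreal (norm (E x - w) powr - s) \<partial>M)
    = (\<integral>\<^sup>+x\<in>{x \<in> space M. E x \<noteq> w \<and> norm (E x - w) < 2 * (\<rho>/2)}. ennreal (norm (E x - w) powr - s) \<partial>M)"
    using AE_neq[of w] by (intro nn_integral_cong_AE) (auto elim!: eventually_mono split: split_indicator)
  also have "\<dots> \<le> ennreal (C * 2 powr d * (\<rho>/2) powr (d - s) / (1 - (1/2) powr (d - s)))"
    using \<open>0 < \<rho>\<close> assms lt by (intro nn_integral_dyadic ex_dyadic_lower) auto
  also have "C * 2 powr d * (\<rho>/2) powr (d - s) / (1 - (1/2) powr (d - s)) = ?K * \<rho> powr (d - s)"
    using \<open>0 < \<rho>\<close> by (simp add: powr_divide)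
  finally show "(\<integral>\<^sup>+x\<in>{x \<in> space M. norm (E x - w) < \<rho>}. ennreal (norm (E x - w) powr - s) \<partial>M) \<le> ennreal (?K * \<rho> powr (d - s))" .
qed

lemma nn_integral_far:
  assumes "0 \<le> s" "d < s"
  obtains K where "0 \<le> K" "\<And>w \<rho>. 0 < \<rho> \<Longrightarrow>
    (\<integral>\<^sup>+x\<in>{x \<in> space M. \<rho> \<le> norm (E x - w)}. ennreal (norm (E x - w) powr - s) \<partial>M) \<le> ennreal (K * \<rho> powr (d - s))"
proof
  let ?K = "C * 2 powr d / (1 - 2 powr (d - s))"
  have lt: "(2::real) powr (d - s) < 1" using assms powr_less_one[of 2 "d - s"] by simp
  show "0 \<le> ?K" using C_nonneg lt by (intro divide_nonneg_nonneg) auto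
  fix w and \<rho> :: real assume "0 < \<rho>"
  have "(\<integral>\<^sup>+x\<in>{x \<in> space M. \<rho> \<le> norm (E x - w)}. ennreal (norm (E x - w) powr - s) \<partial>M)
    \<le> ennreal (C * 2 powr d * \<rho> powr (d - s) / (1 - 2 powr (d - s)))"
    using \<open>0 < \<rho>\<close> assms lt by (intro nn_integral_dyadic ex_dyadic_upper) auto
  then show "(\<integral>\<^sup>+x\<in>{x \<in> space M. \<rho> \<le> norm (E x - w)}. ennreal (norm (E x - w) powr - s) \<partial>M) \<le> ennreal (?K * \<rho> powr (d - s))"
    by simp
qed

text \<open>Let \<delta> be half the distance of the poles. Within \<delta> of one pole the other
  factor is at most \<open>\<delta> powr - s\<close>; outside both discs the distances are
  comparable up to the factor 3, and the integrand is controlled by a single pole of order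
  \<open>2 * s > d\<close>, which \<open>nn_integral_far\<close> handles. All three parts scale like
  \<open>\<delta> powr (d - 2 * s)\<close>.\<close>

lemma nn_integral_two_poles:
  assumes "0 \<le> s" "s < d" "d < 2 * s"
  obtains K where "0 \<le> K" "\<And>w\<^sub>0 w\<^sub>1. w\<^sub>0 \<noteq> w\<^sub>1 \<Longrightarrow>
    (\<integral>\<^sup>+x. ennreal (norm (E x - w\<^sub>0) powr - s * norm (E x - w\<^sub>1) powr - s) \<partial>M) \<le> ennreal (K * norm (w\<^sub>1 - w\<^sub>0) powr (d - 2 * s))"
proof -
  obtain K1 where K1: "0 \<le> K1" "\<And>w \<rho>. 0 < \<rho> \<Longrightarrow>
    (\<integral>\<^sup>+x\<in>{x \<in> space M. norm (E x - w) < \<rho>}. ennreal (norm (E x - w) powr - s) \<partial>M) \<le> ennreal (K1 * \<rho> powr (d - s))"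
    by (rule nn_integral_near[of s]) (use assms in auto)
  obtain K2 where K2: "0 \<le> K2" "\<And>w \<rho>. 0 < \<rho> \<Longrightarrow>
    (\<integral>\<^sup>+x\<in>{x \<in> space M. \<rho> \<le> norm (E x - w)}. ennreal (norm (E x - w) powr - (2 * s)) \<partial>M) \<le> ennreal (K2 * \<rho> powr (d - 2 * s))"
    by (rule nn_integral_far[of "2 * s"]) (use assms in auto)
  let ?K = "(2 * K1 + 3 powr s * K2) * (1/2) powr (d - 2 * s)"
  show ?thesis
  proof
    show "0 \<le> ?K" using K1 K2 by simp
    fix w\<^sub>0 w\<^sub>1 :: complex assume ne: "w\<^sub>0 \<noteq> w\<^sub>1"
    define \<delta> where "\<delta> = norm (w\<^sub>1 - w\<^sub>0) / 2"
    have "0 < \<delta>" using ne by (simp add: \<delta>_def)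
    define N where "N w = {x \<in> space M. norm (E x - w) < \<delta>}" for w
    have [measurable]: "N w \<in> sets M" for w unfolding N_def by measurable
    define F where "F = {x \<in> space M. \<delta> \<le> norm (E x - w\<^sub>0)}"
    have [measurable]: "F \<in> sets M" unfolding F_def by measurable
    let ?g = "\<lambda>w x. norm (E x - w) powr - s"
    have near: "?g w x * ?g w' x \<le> \<delta> powr - s * ?g w x" if "x \<in> N w" "norm (w - w') = 2 * \<delta>" for x w w'
    proof -
      have "\<delta> \<le> norm (E x - w')"
        using that norm_triangle_ineq[of "E x - w'" "w - E x"] norm_minus_commute[of w "E x"] by (auto simp: N_def)
      then have "?g w' x \<le> \<delta> powr - s" using \<open>0 < \<delta>\<close> assms by (intro powr_mono2') auto
      then show ?thesis by (simp add: mult.commute mult_right_mono)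
    qed
    have far: "?g w\<^sub>0 x * ?g w\<^sub>1 x \<le> 3 powr s * norm (E x - w\<^sub>0) powr - (2 * s)"
      if "x \<in> space M" "x \<notin> N w\<^sub>0" "x \<notin> N w\<^sub>1" for x
    proof -
      have 0: "\<delta> \<le> norm (E x - w\<^sub>0)" "\<delta> \<le> norm (E x - w\<^sub>1)" using that by (auto simp: N_def)
      have "norm (E x - w\<^sub>0) \<le> norm (E x - w\<^sub>1) + 2 * \<delta>"
        using norm_triangle_ineq[of "E x - w\<^sub>1" "w\<^sub>1 - w\<^sub>0"] by (simp add: \<delta>_def)
      then have "norm (E x - w\<^sub>0) / 3 \<le> norm (E x - w\<^sub>1)" using 0 by simp
      then have "?g w\<^sub>1 x \<le> (norm (E x - w\<^sub>0) / 3) powr - s" using 0 \<open>0 < \<delta>\<close> assms by (intro powr_mono2') auto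
      then have "?g w\<^sub>0 x * ?g w\<^sub>1 x \<le> ?g w\<^sub>0 x * (norm (E x - w\<^sub>0) / 3) powr - s" by (intro mult_left_mono) auto
      also have "\<dots> = 3 powr s * (?g w\<^sub>0 x * ?g w\<^sub>0 x)" by (simp add: powr_divide powr_minus field_simps)
      also have "?g w\<^sub>0 x * ?g w\<^sub>0 x = norm (E x - w\<^sub>0) powr - (2 * s)"
        by (simp add: powr_add[symmetric])
      finally show ?thesis .
    qed
    have "(\<integral>\<^sup>+x. ennreal (?g w\<^sub>0 x * ?g w\<^sub>1 x) \<partial>M)
      \<le> (\<integral>\<^sup>+x. (ennreal (\<delta> powr - s) * (ennreal (?g w\<^sub>0 x) * indicator (N w\<^sub>0) x)
          + ennreal (\<delta> powr - s) * (ennreal (?g w\<^sub>1 x) * indicator (N w\<^sub>1) x))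
          + ennreal (3 powr s) * (ennreal (norm (E x - w\<^sub>0) powr - (2 * s)) * indicator F x) \<partial>M)"
    proof (intro nn_integral_mono)
      fix x assume x: "x \<in> space M"
      consider "x \<in> N w\<^sub>0" | "x \<in> N w\<^sub>1" | "x \<notin> N w\<^sub>0" "x \<notin> N w\<^sub>1" "x \<in> F"
        using x by (force simp: F_def N_def)
      then show "ennreal (?g w\<^sub>0 x * ?g w\<^sub>1 x) \<le> (ennreal (\<delta> powr - s) * (ennreal (?g w\<^sub>0 x) * indicator (N w\<^sub>0) x)
          + ennreal (\<delta> powr - s) * (ennreal (?g w\<^sub>1 x) * indicator (N w\<^sub>1) x))
          + ennreal (3 powr s) * (ennreal (norm (E x - w\<^sub>0) powr - (2 * s)) * indicator F x)"
      proof cases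
        case 1
        then have "ennreal (?g w\<^sub>0 x * ?g w\<^sub>1 x) \<le> ennreal (\<delta> powr - s * ?g w\<^sub>0 x)"
          using near[of x w\<^sub>0 w\<^sub>1] by (intro ennreal_leI) (auto simp: \<delta>_def norm_minus_commute)
        then show ?thesis using 1 by (simp add: ennreal_mult add_increasing2)
      next
        case 2
        then have "ennreal (?g w\<^sub>0 x * ?g w\<^sub>1 x) \<le> ennreal (\<delta> powr - s * ?g w\<^sub>1 x)"
          using near[of x w\<^sub>1 w\<^sub>0] by (intro ennreal_leI) (auto simp: \<delta>_def mult.commute)
        then show ?thesis using 2 by (simp add: ennreal_mult add_increasing add_increasing2)
      next
        case 3
        then have "ennreal (?g w\<^sub>0 x * ?g w\<^sub>1 x) \<le> ennreal (3 powr s * norm (E x - w\<^sub>0) powr - (2 * s))"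
          using far[of x] x by (intro ennreal_leI)
        then show ?thesis using 3 by (simp add: ennreal_mult add_increasing)
      qed
    qed
    also have "\<dots> = ennreal (\<delta> powr - s) * (\<integral>\<^sup>+x\<in>N w\<^sub>0. ennreal (?g w\<^sub>0 x) \<partial>M)
      + ennreal (\<delta> powr - s) * (\<integral>\<^sup>+x\<in>N w\<^sub>1. ennreal (?g w\<^sub>1 x) \<partial>M)
      + ennreal (3 powr s) * (\<integral>\<^sup>+x\<in>F. ennreal (norm (E x - w\<^sub>0) powr - (2 * s)) \<partial>M)"
      by (simp add: nn_integral_add nn_integral_cmult)
    also have "\<dots> \<le> ennreal (\<delta> powr - s) * ennreal (K1 * \<delta> powr (d - s)) + ennreal (\<delta> powr - s) * ennreal (K1 * \<delta> powr (d - s))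
       + ennreal (3 powr s) * ennreal (K2 * \<delta> powr (d - 2 * s))"
      unfolding N_def F_def using \<open>0 < \<delta>\<close> by (intro add_mono mult_left_mono K1 K2) auto
    also have "\<dots> = ennreal (\<delta> powr - s * (K1 * \<delta> powr (d - s)) + \<delta> powr - s * (K1 * \<delta> powr (d - s)) + 3 powr s * (K2 * \<delta> powr (d - 2 * s)))"
      using K1 K2 by (simp add: ennreal_mult[symmetric] ennreal_plus[symmetric] del: ennreal_plus)
    also have "\<delta> powr - s * (K1 * \<delta> powr (d - s)) = K1 * \<delta> powr (d - 2 * s)"
    proof -
      have "\<delta> powr - s * \<delta> powr (d - s) = \<delta> powr (d - 2 * s)" by (simp add: powr_add[symmetric])
      then show ?thesis by (simp add: mult.left_commute)
    qed
    also have "K1 * \<delta> powr (d - 2 * s) + K1 * \<delta> powr (d - 2 * s) + 3 powr s * (K2 * \<delta> powr (d - 2 * s)) = (2 * K1 + 3 powr s * K2) * \<delta> powr (d - 2 * s)"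
      by (simp add: algebra_simps)
    also have "\<delta> powr (d - 2 * s) = (1/2) powr (d - 2 * s) * norm (w\<^sub>1 - w\<^sub>0) powr (d - 2 * s)"
      by (simp add: \<delta>_def powr_divide)
    finally show "(\<integral>\<^sup>+x. ennreal (?g w\<^sub>0 x * ?g w\<^sub>1 x) \<partial>M) \<le> ennreal (?K * norm (w\<^sub>1 - w\<^sub>0) powr (d - 2 * s))"
      by (simp add: mult.assoc)
  qed
qed

text \<open>
  In the next two proofs Hoelder's inequality is replaced by Young's, in the second one after a
  rescaling that balances the two terms.
\<close>

lemma integrable_Cauchy_kernel:
  fixes g :: "'a \<Rightarrow> real"
  assumes "1 < q" "1 < r" "1 / q + 1 / r = 1" "r < d"
    and g [measurable]: "g \<in> borel_measurable M" "integrable M (\<lambda>x. \<bar>g x\<bar> powr q)"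
  obtains K where "0 \<le> K" "\<And>w. integrable M (\<lambda>x. g x / norm (E x - w))"
    "\<And>w. (\<integral>x. \<bar>g x\<bar> / norm (E x - w) \<partial>M) \<le> K"
proof -
  obtain K1 where K1: "0 \<le> K1" "\<And>w \<rho>. 0 < \<rho> \<Longrightarrow>
    (\<integral>\<^sup>+x\<in>{x \<in> space M. norm (E x - w) < \<rho>}. ennreal (norm (E x - w) powr - r) \<partial>M) \<le> ennreal (K1 * \<rho> powr (d - r))"
    by (rule nn_integral_near[of r]) (use assms in auto)
  let ?K = "(\<integral>x. \<bar>g x\<bar> powr q \<partial>M) / q + (K1 + measure M (space M)) / r"
  have bd: "(\<integral>\<^sup>+x. ennreal (\<bar>g x\<bar> / norm (E x - w)) \<partial>M) \<le> ennreal ?K" for w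
  proof -
    let ?N = "{x \<in> space M. norm (E x - w) < 1}"
    have "(\<integral>\<^sup>+x. ennreal (\<bar>g x\<bar> / norm (E x - w)) \<partial>M) \<le> (\<integral>\<^sup>+x. ennreal (\<bar>g x\<bar> powr q / q) +
        ennreal (1/r) * (ennreal (norm (E x - w) powr - r) * indicator ?N x + indicator (space M) x) \<partial>M)"
    proof (intro nn_integral_mono)
      fix x assume x: "x \<in> space M"
      let ?t = "norm (E x - w)"
      have "\<bar>g x\<bar> / ?t = \<bar>g x\<bar> * (?t powr -1)" by (simp add: powr_minus divide_inverse)
      also have "\<dots> \<le> \<bar>g x\<bar> powr q / q + (?t powr -1) powr r / r" using assms by (intro Youngs_inequality) auto
      also have "(?t powr -1) powr r = ?t powr - r" by (simp only: powr_powr) simp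
      finally have 1: "\<bar>g x\<bar> / ?t \<le> \<bar>g x\<bar> powr q / q + (1/r) * (?t powr - r)" by simp
      have 2: "ennreal (?t powr - r) \<le> ennreal (?t powr - r) * indicator ?N x + indicator (space M) x"
      proof (cases "?t < 1")
        case True
        then show ?thesis using x by (simp add: add_increasing2)
      next
        case False
        then have "?t powr - r \<le> 1 powr - r" using assms by (intro powr_mono2') auto
        then have "ennreal (?t powr - r) \<le> ennreal 1" by (intro ennreal_leI) simp
        also have "\<dots> = indicator (space M) x" using x by simp
        finally show ?thesis by (simp add: add_increasing)
      qed
      have "ennreal (\<bar>g x\<bar> / ?t) \<le> ennreal (\<bar>g x\<bar> powr q / q + (1/r) * (?t powr - r))" using 1 by (rule ennreal_leI)
      also have "\<dots> = ennreal (\<bar>g x\<bar> powr q / q) + ennreal (1/r) * ennreal (?t powr - r)"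
        using assms by (simp add: ennreal_mult[symmetric] ennreal_plus[symmetric] del: ennreal_plus)
      also have "\<dots> \<le> ennreal (\<bar>g x\<bar> powr q / q) +
        ennreal (1/r) * (ennreal (norm (E x - w) powr - r) * indicator ?N x + indicator (space M) x)"
        using 2 by (intro add_left_mono mult_left_mono) auto
      finally show "ennreal (\<bar>g x\<bar> / ?t) \<le> \<dots>" .
    qed
    also have "\<dots> = (\<integral>\<^sup>+x. ennreal (\<bar>g x\<bar> powr q / q) \<partial>M) + ennreal (1/r) * ((\<integral>\<^sup>+x\<in>?N. ennreal (norm (E x - w) powr - r) \<partial>M) + emeasure M (space M))"
      by (simp add: nn_integral_add nn_integral_cmult)
    also have "(\<integral>\<^sup>+x. ennreal (\<bar>g x\<bar> powr q / q) \<partial>M) = ennreal (\<integral>x. \<bar>g x\<bar> powr q / q \<partial>M)"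
      using assms by (intro nn_integral_eq_integral) auto
    also have "(\<integral>x. \<bar>g x\<bar> powr q / q \<partial>M) = (\<integral>x. \<bar>g x\<bar> powr q \<partial>M) / q" by simp
    also have "ennreal ((\<integral>x. \<bar>g x\<bar> powr q \<partial>M) / q) + ennreal (1/r) * ((\<integral>\<^sup>+x\<in>?N. ennreal (norm (E x - w) powr - r) \<partial>M) + emeasure M (space M))
      \<le> ennreal ((\<integral>x. \<bar>g x\<bar> powr q \<partial>M) / q) + ennreal (1/r) * (ennreal K1 + ennreal (measure M (space M)))"
      using K1(2)[of 1 w] by (intro add_left_mono mult_left_mono add_mono) (auto simp: emeasure_eq_measure)
    also have "\<dots> = ennreal ?K"
      using assms K1 by (simp add: ennreal_mult[symmetric] ennreal_plus[symmetric] del: ennreal_plus)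
    finally show ?thesis .
  qed
  have K0: "0 \<le> ?K" using assms K1 by (intro add_nonneg_nonneg divide_nonneg_nonneg) auto
  have int: "integrable M (\<lambda>x. g x / norm (E x - w))" for w
  proof (rule integrableI_bounded)
    show "(\<integral>\<^sup>+x. ennreal (norm (g x / norm (E x - w))) \<partial>M) < \<infinity>"
      using bd[of w] by (simp add: abs_divide le_less_trans)
  qed measurable
  have "(\<integral>x. \<bar>g x\<bar> / norm (E x - w) \<partial>M) \<le> ?K" for w
  proof -
    have "integrable M (\<lambda>x. \<bar>g x\<bar> / norm (E x - w))"
      using integrable_abs[OF int[of w]] by (simp add: abs_divide)
    then have "ennreal (\<integral>x. \<bar>g x\<bar> / norm (E x - w) \<partial>M) \<le> ennreal ?K"
      using bd[of w] by (subst nn_integral_eq_integral[symmetric]) auto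
    then show ?thesis using K0 by (simp add: ennreal_le_iff)
  qed
  then show thesis using that[OF K0 int] by blast
qed

lemma integral_two_poles_le:
  fixes g :: "'a \<Rightarrow> real"
  assumes "1 < q" "1 < r" "1 / q + 1 / r = 1" "r < d" "d < 2 * r"
    and g [measurable]: "g \<in> borel_measurable M" "integrable M (\<lambda>x. \<bar>g x\<bar> powr q)"
  obtains K where "0 \<le> K" "\<And>w\<^sub>0 w\<^sub>1. w\<^sub>0 \<noteq> w\<^sub>1 \<Longrightarrow> integrable M (\<lambda>x. \<bar>g x\<bar> / (norm (E x - w\<^sub>0) * norm (E x - w\<^sub>1)))"
    "\<And>w\<^sub>0 w\<^sub>1. w\<^sub>0 \<noteq> w\<^sub>1 \<Longrightarrow>
    (\<integral>x. \<bar>g x\<bar> / (norm (E x - w\<^sub>0) * norm (E x - w\<^sub>1)) \<partial>M) \<le> K * norm (w\<^sub>1 - w\<^sub>0) powr (d / r - 2)"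
proof -
  obtain K1 where K1: "0 \<le> K1" "\<And>w\<^sub>0 w\<^sub>1. w\<^sub>0 \<noteq> w\<^sub>1 \<Longrightarrow>
    (\<integral>\<^sup>+x. ennreal (norm (E x - w\<^sub>0) powr - r * norm (E x - w\<^sub>1) powr - r) \<partial>M) \<le> ennreal (K1 * norm (w\<^sub>1 - w\<^sub>0) powr (d - 2 * r))"
    by (rule nn_integral_two_poles[of r]) (use assms in auto)
  let ?K = "(\<integral>x. \<bar>g x\<bar> powr q \<partial>M) / q + K1 / r"
  have K0: "0 \<le> ?K" using assms K1 by (intro add_nonneg_nonneg divide_nonneg_nonneg) auto
  have bd: "(\<integral>\<^sup>+x. ennreal (\<bar>g x\<bar> / (norm (E x - w\<^sub>0) * norm (E x - w\<^sub>1))) \<partial>M) \<le> ennreal (?K * norm (w\<^sub>1 - w\<^sub>0) powr (d / r - 2))"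
    if ne: "w\<^sub>0 \<noteq> w\<^sub>1" for w\<^sub>0 w\<^sub>1
  proof -
    \<comment> \<open>The expected size of the integral: dividing the kernel by \<open>s\<close>
      before applying Young's inequality makes both terms of order one.\<close>
    define s where "s = norm (w\<^sub>1 - w\<^sub>0) powr (d / r - 2)"
    have s: "0 < s" using ne by (simp add: s_def)
    have sr: "s powr - r * norm (w\<^sub>1 - w\<^sub>0) powr (d - 2 * r) = 1"
    proof -
      have "s powr - r = norm (w\<^sub>1 - w\<^sub>0) powr - (d - 2 * r)"
        unfolding s_def powr_powr using assms(2) by (intro arg_cong[where f="(powr) _"]) (simp add: field_simps)
      then show ?thesis using ne by (simp add: powr_add[symmetric])
    qed
    have "(\<integral>\<^sup>+x. ennreal (\<bar>g x\<bar> / (norm (E x - w\<^sub>0) * norm (E x - w\<^sub>1))) \<partial>M)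
      \<le> (\<integral>\<^sup>+x. ennreal s * (ennreal (\<bar>g x\<bar> powr q / q) +
        ennreal (s powr - r / r) * ennreal (norm (E x - w\<^sub>0) powr - r * norm (E x - w\<^sub>1) powr - r)) \<partial>M)"
    proof (intro nn_integral_mono)
      fix x
      let ?t = "norm (E x - w\<^sub>0)" and ?t' = "norm (E x - w\<^sub>1)"
      have "\<bar>g x\<bar> / (?t * ?t') = s * (\<bar>g x\<bar> * (s powr -1 * ?t powr -1 * ?t' powr -1))"
        using s by (simp add: powr_minus divide_inverse)
      also have "\<dots> \<le> s * (\<bar>g x\<bar> powr q / q + (s powr -1 * ?t powr -1 * ?t' powr -1) powr r / r)"
        using assms s by (intro mult_left_mono Youngs_inequality) auto
      also have "(s powr -1 * ?t powr -1 * ?t' powr -1) powr r = s powr - r * (?t powr - r * ?t' powr - r)"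
        by (simp only: powr_powr powr_mult) simp
      finally have "\<bar>g x\<bar> / (?t * ?t') \<le> s * (\<bar>g x\<bar> powr q / q + (s powr - r / r) * (?t powr - r * ?t' powr - r))" by simp
      then show "ennreal (\<bar>g x\<bar> / (?t * ?t')) \<le> ennreal s * (ennreal (\<bar>g x\<bar> powr q / q) +
        ennreal (s powr - r / r) * ennreal (?t powr - r * ?t' powr - r))"
        using s assms by (simp add: ennreal_mult[symmetric] ennreal_plus[symmetric] ennreal_leI del: ennreal_plus)
    qed
    also have "\<dots> = ennreal s * ((\<integral>\<^sup>+x. ennreal (\<bar>g x\<bar> powr q / q) \<partial>M) +
        ennreal (s powr - r / r) * (\<integral>\<^sup>+x. ennreal (norm (E x - w\<^sub>0) powr - r * norm (E x - w\<^sub>1) powr - r) \<partial>M))"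
      by (simp add: nn_integral_add nn_integral_cmult)
    also have "(\<integral>\<^sup>+x. ennreal (\<bar>g x\<bar> powr q / q) \<partial>M) = ennreal (\<integral>x. \<bar>g x\<bar> powr q / q \<partial>M)"
      using assms by (intro nn_integral_eq_integral) auto
    also have "(\<integral>x. \<bar>g x\<bar> powr q / q \<partial>M) = (\<integral>x. \<bar>g x\<bar> powr q \<partial>M) / q" by simp
    also have "ennreal s * (ennreal ((\<integral>x. \<bar>g x\<bar> powr q \<partial>M) / q) +
        ennreal (s powr - r / r) * (\<integral>\<^sup>+x. ennreal (norm (E x - w\<^sub>0) powr - r * norm (E x - w\<^sub>1) powr - r) \<partial>M))
      \<le> ennreal s * (ennreal ((\<integral>x. \<bar>g x\<bar> powr q \<partial>M) / q) + ennreal (s powr - r / r) * ennreal (K1 * norm (w\<^sub>1 - w\<^sub>0) powr (d - 2 * r)))"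
      by (intro add_left_mono mult_left_mono K1 ne) auto
    also have "\<dots> = ennreal (s * ((\<integral>x. \<bar>g x\<bar> powr q \<partial>M) / q + (s powr - r / r) * (K1 * norm (w\<^sub>1 - w\<^sub>0) powr (d - 2 * r))))"
      using s K1 assms by (simp add: ennreal_mult[symmetric] ennreal_plus[symmetric] del: ennreal_plus)
    also have "(s powr - r / r) * (K1 * norm (w\<^sub>1 - w\<^sub>0) powr (d - 2 * r)) = K1 / r * (s powr - r * norm (w\<^sub>1 - w\<^sub>0) powr (d - 2 * r))"
      by simp
    finally show ?thesis unfolding sr by (simp add: s_def mult.commute)
  qed
  have int: "integrable M (\<lambda>x. \<bar>g x\<bar> / (norm (E x - w\<^sub>0) * norm (E x - w\<^sub>1)))" if "w\<^sub>0 \<noteq> w\<^sub>1" for w\<^sub>0 w\<^sub>1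
  proof (rule integrableI_bounded)
    show "(\<integral>\<^sup>+x. ennreal (norm (\<bar>g x\<bar> / (norm (E x - w\<^sub>0) * norm (E x - w\<^sub>1)))) \<partial>M) < \<infinity>"
      using bd[OF that] by (simp add: abs_divide abs_mult le_less_trans)
  qed measurable
  have "(\<integral>x. \<bar>g x\<bar> / (norm (E x - w\<^sub>0) * norm (E x - w\<^sub>1)) \<partial>M) \<le> ?K * norm (w\<^sub>1 - w\<^sub>0) powr (d / r - 2)"
    if ne: "w\<^sub>0 \<noteq> w\<^sub>1" for w\<^sub>0 w\<^sub>1
  proof -
    have "ennreal (\<integral>x. \<bar>g x\<bar> / (norm (E x - w\<^sub>0) * norm (E x - w\<^sub>1)) \<partial>M) \<le> ennreal (?K * norm (w\<^sub>1 - w\<^sub>0) powr (d / r - 2))"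
      using bd[OF ne] int[OF ne] by (subst nn_integral_eq_integral[symmetric]) auto
    then show ?thesis using K0 by (simp add: ennreal_le_iff)
  qed
  then show thesis using that[OF K0 int] by blast
qed

end

subsection \<open>The kernel of the torus\<close>

text \<open>The second summand is the term of index \<open>n + 1\<close> of the bilateral series
  over the powers of \<open>q\<close>. The first is the term of index \<open>-(n + 1)\<close> plus
  1: with x = q^(n+1), the quotient of 1/x by w - 1/x is 1/(w x - 1). The added 1 makes the series
  converge and is the origin of the jump of the kernel.\<close>

definition kernel_term :: "complex \<Rightarrow> nat \<Rightarrow> complex \<Rightarrow> complex" where
  "kernel_term q n w = w * q ^ Suc n / (w * q ^ Suc n - 1) + q ^ Suc n / (w - q ^ Suc n)"

definition kernel_reg :: "complex \<Rightarrow> complex \<Rightarrow> complex" where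
  "kernel_reg q w = (\<Sum>n. kernel_term q n w)"

text \<open>
  Up to the divergent constant coming from the terms with \<open>n < 0\<close>, this is
  $\sum_{n\in\mathbb{Z}} q^n/(w-q^n)$, the logarithmic derivative of a theta function in the
  multiplicative variable $w=e^{2\pi i z}$.
\<close>

definition torus_kernel :: "complex \<Rightarrow> complex \<Rightarrow> complex" where
  "torus_kernel q w = 1 / (w - 1) + kernel_reg q w"

definition kernel_dom :: "complex \<Rightarrow> complex set" where
  "kernel_dom q = {w. w \<noteq> 0 \<and> (\<forall>n. w \<noteq> q ^ Suc n \<and> w * q ^ Suc n \<noteq> 1)}"

lemma kernel_measurable [measurable]: "torus_kernel q \<in> borel_measurable borel"
  unfolding torus_kernel_def kernel_reg_def kernel_term_def by measurable

section \<open>Convergence, quasi-periodicity and bounds of the kernel\<close>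

lemma simple_pole_diff:
  fixes a b w\<^sub>0 w\<^sub>1 :: "'a :: real_normed_field"
  assumes "w\<^sub>0 \<noteq> a" "w\<^sub>1 \<noteq> a"
  shows "norm (b / (w\<^sub>1 - a) - b / (w\<^sub>0 - a)) = norm b * norm (w\<^sub>1 - w\<^sub>0) * (1 / (norm (w\<^sub>0 - a) * norm (w\<^sub>1 - a)))"
proof -
  have "b / (w\<^sub>1 - a) - b / (w\<^sub>0 - a) = b * (w\<^sub>0 - w\<^sub>1) / ((w\<^sub>0 - a) * (w\<^sub>1 - a))"
    using assms by (simp add: field_simps)
  then show ?thesis by (simp add: norm_divide norm_mult norm_minus_commute)
qed

locale nome =
  fixes q :: complex
  assumes q_nz: "q \<noteq> 0" and q_lt_1: "norm q < 1"
begin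

text \<open>The powers of \<open>q\<close> tend to 0, so all but finitely many poles, on the small
  and on the large side, are uniformly far from a given annulus; one threshold \<open>m\<close>
  serves the whole annulus.\<close>

lemma far_poles:
  assumes "0 < r\<^sub>0"
  obtains m where "\<And>n w. m \<le> n \<Longrightarrow> r\<^sub>0 \<le> norm w \<Longrightarrow> norm w \<le> R \<Longrightarrow>
    r\<^sub>0 / 2 \<le> norm (w - q ^ Suc n) \<and> 1 / 2 \<le> norm (w * q ^ Suc n - 1)"
proof -
  \<comment> \<open>The first entry keeps \<open>q ^ Suc n\<close> below half the inner radius, the
    second keeps \<open>w * q ^ Suc n\<close> below 1/2; \<open>\<bar>R\<bar> + 1\<close> avoids a
    division by zero.\<close>
  define \<epsilon> where "\<epsilon> = min (r\<^sub>0 / 2) (1 / (2 * (\<bar>R\<bar> + 1)))"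
  have "0 < \<epsilon>" using assms by (simp add: \<epsilon>_def)
  then obtain m where m: "norm q ^ m < \<epsilon>" using real_arch_pow_inv q_lt_1 by blast
  show thesis
  proof
    fix n and w :: complex assume n: "m \<le> n" and w: "r\<^sub>0 \<le> norm w" "norm w \<le> R"
    have "norm q ^ Suc n \<le> norm q ^ m" using n q_lt_1 by (intro power_decreasing) auto
    then have qn: "norm (q ^ Suc n) \<le> \<epsilon>" using m by (simp add: norm_power norm_mult)
    have "norm w - norm (q ^ Suc n) \<le> norm (w - q ^ Suc n)" by (rule norm_triangle_ineq2)
    moreover have "norm (q ^ Suc n) \<le> r\<^sub>0 / 2" using qn by (simp add: \<epsilon>_def)
    ultimately have 1: "r\<^sub>0 / 2 \<le> norm (w - q ^ Suc n)" using w by linarith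
    have "norm (w * q ^ Suc n) \<le> (\<bar>R\<bar> + 1) * (1 / (2 * (\<bar>R\<bar> + 1)))"
      unfolding norm_mult[of w] using w qn by (intro mult_mono) (auto simp: \<epsilon>_def)
    also have "\<dots> = 1/2" by simp
    finally have "norm (w * q ^ Suc n) \<le> 1/2" .
    moreover have "norm (1::complex) - norm (w * q ^ Suc n) \<le> norm (1 - w * q ^ Suc n)" by (rule norm_triangle_ineq2)
    ultimately have "1/2 \<le> norm (1 - w * q ^ Suc n)" by simp
    with 1 show "r\<^sub>0 / 2 \<le> norm (w - q ^ Suc n) \<and> 1 / 2 \<le> norm (w * q ^ Suc n - 1)"
      by (simp add: norm_minus_commute)
  qed
qed

lemma kernel_term_bounds:
  assumes "0 < r\<^sub>0" "r\<^sub>0 \<le> norm w" "norm w \<le> R"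
    and "r\<^sub>0 / 2 \<le> norm (w - q ^ Suc n)" "1 / 2 \<le> norm (w * q ^ Suc n - 1)"
  shows "norm (w * q ^ Suc n / (w * q ^ Suc n - 1)) \<le> 2 * R * norm q ^ n"
    and "norm (q ^ Suc n / (w - q ^ Suc n)) \<le> 2 / r\<^sub>0 * norm q ^ n"
proof -
  have qn: "norm (q ^ Suc n) \<le> norm q ^ n"
    using q_lt_1 by (simp add: norm_mult norm_power mult_left_le_one_le)
  have "norm (w * q ^ Suc n / (w * q ^ Suc n - 1)) \<le> (R * norm q ^ n) / (1/2)"
    unfolding norm_divide norm_mult[of w] using assms qn by (intro frac_le mult_mono mult_nonneg_nonneg) auto
  then show "norm (w * q ^ Suc n / (w * q ^ Suc n - 1)) \<le> 2 * R * norm q ^ n" by simp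
  have "norm (q ^ Suc n / (w - q ^ Suc n)) \<le> norm q ^ n / (r\<^sub>0/2)"
    unfolding norm_divide using assms qn by (intro frac_le) auto
  then show "norm (q ^ Suc n / (w - q ^ Suc n)) \<le> 2 / r\<^sub>0 * norm q ^ n" by (simp add: mult.commute)
qed

lemma summable_q: "summable (\<lambda>n. c * norm q ^ n)"
  using q_lt_1 by (intro summable_mult summable_geometric) auto

lemma kernel_term_summable:
  assumes "w \<noteq> 0"
  shows "summable (\<lambda>n. w * q ^ Suc n / (w * q ^ Suc n - 1))" "summable (\<lambda>n. q ^ Suc n / (w - q ^ Suc n))"
proof -
  obtain m where m: "\<And>n v. m \<le> n \<Longrightarrow> norm w \<le> norm v \<Longrightarrow> norm v \<le> norm w \<Longrightarrow>
    norm w / 2 \<le> norm (v - q ^ Suc n) \<and> 1 / 2 \<le> norm (v * q ^ Suc n - 1)"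
    by (rule far_poles[of "norm w" "norm w"]) (use assms in auto)
  have w: "0 < norm w" using assms by simp
  have *: "m \<le> n \<Longrightarrow> norm w / 2 \<le> norm (w - q ^ Suc n)" "m \<le> n \<Longrightarrow> 1 / 2 \<le> norm (w * q ^ Suc n - 1)" for n
    using m[of n w] by auto
  show "summable (\<lambda>n. w * q ^ Suc n / (w * q ^ Suc n - 1))"
    using kernel_term_bounds(1)[OF w order_refl order_refl *(1) *(2)] by (intro summable_comparison_test'[OF summable_q, of m])
  show "summable (\<lambda>n. q ^ Suc n / (w - q ^ Suc n))"
    using kernel_term_bounds(2)[OF w order_refl order_refl *(1) *(2)] by (intro summable_comparison_test'[OF summable_q, of m])
qed

text \<open>Replacing \<open>w\<close> by \<open>q * w\<close> shifts the index, so that one half of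
  the series loses a term and the other gains one. The lost term cancels
  \<open>1 / (q * w - 1)\<close>, the gained one supplies \<open>1 / (w - 1)\<close>, and the
  renormalising 1 of the lost term is what remains.\<close>

lemma kernel_quasi_periodic:
  assumes "w \<in> kernel_dom q" "w \<noteq> 1"
  shows "torus_kernel q (q * w) = torus_kernel q w - 1"
proof -
  have w: "w \<noteq> 0" "q * w \<noteq> 0" "w * q \<noteq> 1" using assms q_nz by (auto simp: kernel_dom_def dest: spec[of _ 0])
  define A where "A v n = v * q ^ Suc n / (v * q ^ Suc n - 1)" for v n
  define B where "B v n = q ^ Suc n / (v - q ^ Suc n)" for v n
  have sA: "summable (A v)" and sB: "summable (B v)" if "v \<noteq> 0" for v
    using kernel_term_summable[OF that] by (simp_all add: A_def[abs_def] B_def[abs_def])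
  have reg: "kernel_reg q v = suminf (A v) + suminf (B v)" if "v \<noteq> 0" for v
    unfolding kernel_reg_def kernel_term_def using suminf_add[OF sA[OF that] sB[OF that]] by (simp add: A_def B_def)
  have "A (q * w) = (\<lambda>n. A w (Suc n))" by (rule ext) (simp add: A_def mult_ac)
  then have 1: "suminf (A (q * w)) = suminf (A w) - A w 0" using suminf_split_head[OF sA[OF w(1)]] by simp
  have "(\<lambda>n. B (q * w) (Suc n)) = B w"
  proof
    fix n
    have "q * w - q ^ Suc (Suc n) = q * (w - q ^ Suc n)" by (simp add: algebra_simps)
    then show "B (q * w) (Suc n) = B w n" using q_nz by (simp add: B_def mult.assoc)
  qed
  then have 2: "suminf (B (q * w)) = suminf (B w) + B (q * w) 0" using suminf_split_head[OF sB[OF w(2)]] by simp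
  have "q * w - q = q * (w - 1)" by (simp add: algebra_simps)
  then have "B (q * w) 0 = 1 / (w - 1)" using q_nz by (simp add: B_def)
  moreover have "A w 0 = 1 + 1 / (q * w - 1)" using w by (simp add: A_def field_simps)
  ultimately show ?thesis unfolding torus_kernel_def reg[OF w(1)] reg[OF w(2)] 1 2 by simp
qed

text \<open>The excluded points accumulate only at 0 and infinity, so near \<open>w\<close> finitely
  many conditions matter and \<open>far_poles\<close> takes care of the rest.\<close>

lemma open_kernel_dom: "open (kernel_dom q)"
proof (rule openI)
  fix w assume w: "w \<in> kernel_dom q"
  then have "w \<noteq> 0" by (simp add: kernel_dom_def)
  then obtain m where m: "\<And>n v. m \<le> n \<Longrightarrow> norm w / 2 \<le> norm v \<Longrightarrow> norm v \<le> 2 * norm w \<Longrightarrow>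
    norm w / 2 / 2 \<le> norm (v - q ^ Suc n) \<and> 1 / 2 \<le> norm (v * q ^ Suc n - 1)"
    using far_poles[of "norm w / 2" "2 * norm w"] by (metis half_gt_zero zero_less_norm_iff)
  define U where "U = {v. norm w / 2 < norm v} \<inter> {v. norm v < 2 * norm w} \<inter> (\<Inter>n<m. {v. v \<noteq> q ^ Suc n} \<inter> {v. v * q ^ Suc n \<noteq> 1})"
  have "open U" unfolding U_def
    by (intro open_Int open_INT open_Collect_less open_Collect_neq continuous_intros ballI) auto
  moreover have "w \<in> U" using w \<open>w \<noteq> 0\<close> by (auto simp: U_def kernel_dom_def)
  moreover have "U \<subseteq> kernel_dom q"
  proof
    fix v assume v: "v \<in> U"
    have "v \<noteq> 0" using v by (auto simp: U_def)
    moreover have "v \<noteq> q ^ Suc n \<and> v * q ^ Suc n \<noteq> 1" for n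
    proof (cases "n < m")
      case True
      then show ?thesis using v by (auto simp: U_def)
    next
      case False
      have "norm w / 2 / 2 \<le> norm (v - q ^ Suc n) \<and> 1 / 2 \<le> norm (v * q ^ Suc n - 1)"
        using False v by (intro m) (auto simp: U_def)
      then show ?thesis using \<open>w \<noteq> 0\<close> by (auto simp del: power_Suc)
    qed
    ultimately show "v \<in> kernel_dom q" by (simp add: kernel_dom_def)
  qed
  ultimately show "\<exists>e>0. ball w e \<subseteq> kernel_dom q" by (meson open_contains_ball subset_trans)
qed

text \<open>On a closed disc in the domain the terms are dominated by a geometric series, though
  only eventually, since the first \<open>m\<close> of them may have poles nearby.\<close>

lemma kernel_reg_holomorphic: "kernel_reg q holomorphic_on kernel_dom q"
proof (rule holomorphic_uniform_sequence[OF open_kernel_dom])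
  show "(\<lambda>w. \<Sum>n<N. kernel_term q n w) holomorphic_on kernel_dom q" for N
    unfolding kernel_term_def by (intro holomorphic_intros) (auto simp: kernel_dom_def simp del: power_Suc)
  fix w assume w: "w \<in> kernel_dom q"
  obtain e where e: "0 < e" "cball w e \<subseteq> kernel_dom q"
    using open_kernel_dom w open_contains_cball by blast
  have w0: "w \<noteq> 0" using w by (simp add: kernel_dom_def)
  define d where "d = min e (norm w / 2)"
  have d: "0 < d" "cball w d \<subseteq> kernel_dom q" using e w0 by (auto simp: d_def)
  have r: "0 < norm w / 2" using w0 by simp
  obtain m where m: "\<And>n v. m \<le> n \<Longrightarrow> norm w / 2 \<le> norm v \<Longrightarrow> norm v \<le> 2 * norm w \<Longrightarrow>
    norm w / 2 / 2 \<le> norm (v - q ^ Suc n) \<and> 1 / 2 \<le> norm (v * q ^ Suc n - 1)"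
    using far_poles[OF r] by metis
  let ?c = "2 * (2 * norm w) + 2 / (norm w / 2)"
  have "uniform_limit (cball w d) (\<lambda>N v. \<Sum>n<N. kernel_term q n v) (\<lambda>v. \<Sum>n. kernel_term q n v) sequentially"
  proof (rule Weierstrass_m_test_ev[OF _ summable_q[of ?c]])
    show "\<forall>\<^sub>F n in sequentially. \<forall>v\<in>cball w d. norm (kernel_term q n v) \<le> ?c * norm q ^ n"
      unfolding eventually_sequentially
    proof (intro exI[of _ m] allI impI ballI)
      fix n v assume n: "m \<le> n" and v: "v \<in> cball w d"
      have dv: "norm (w - v) \<le> norm w / 2" using v by (simp add: d_def dist_norm)
      have v1: "norm w / 2 \<le> norm v" using norm_triangle_ineq[of "w - v" v] dv by (simp only: diff_add_cancel)
      have v2: "norm v \<le> 2 * norm w"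
        using norm_triangle_ineq[of "v - w" w] dv norm_minus_commute[of v w] norm_ge_zero[of w]
        unfolding diff_add_cancel by linarith
      note b = kernel_term_bounds[OF r v1 v2 conjunct1[OF m[OF n v1 v2]] conjunct2[OF m[OF n v1 v2]]]
      have "norm (kernel_term q n v) \<le> norm (v * q ^ Suc n / (v * q ^ Suc n - 1)) + norm (q ^ Suc n / (v - q ^ Suc n))"
        unfolding kernel_term_def by (rule norm_triangle_ineq)
      also have "\<dots> \<le> ?c * norm q ^ n" using b by (simp add: algebra_simps)
      finally show "norm (kernel_term q n v) \<le> ?c * norm q ^ n" .
    qed
  qed
  then show "\<exists>d>0. cball w d \<subseteq> kernel_dom q \<and> uniform_limit (cball w d) (\<lambda>N v. \<Sum>n<N. kernel_term q n v) (kernel_reg q) sequentially"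
    using d unfolding kernel_reg_def by blast
qed

text \<open>On an annulus the kernel is a finite sum of simple poles plus a bounded Lipschitz tail.
  \<open>F\<close> collects 1 and the poles of index below \<open>m\<close> on either side; some may
  lie outside the annulus, which costs nothing. The difference of a simple pole at two points is the
  distance times a product of two poles, which is why pairs appear in the second bound.\<close>

lemma kernel_bounds:
  assumes "0 < r\<^sub>0"
  obtains F C where "finite F" "0 \<notin> F" "0 \<le> C"
    "\<And>w. w \<in> kernel_dom q \<Longrightarrow> w \<noteq> 1 \<Longrightarrow> r\<^sub>0 \<le> norm w \<Longrightarrow> norm w \<le> R \<Longrightarrow>
      norm (torus_kernel q w) \<le> C * (1 + (\<Sum>a\<in>F. 1 / norm (w - a)))"
    "\<And>w\<^sub>0 w\<^sub>1. w\<^sub>0 \<in> kernel_dom q \<Longrightarrow> w\<^sub>0 \<noteq> 1 \<Longrightarrow> r\<^sub>0 \<le> norm w\<^sub>0 \<Longrightarrow> norm w\<^sub>0 \<le> R \<Longrightarrow>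
      w\<^sub>1 \<in> kernel_dom q \<Longrightarrow> w\<^sub>1 \<noteq> 1 \<Longrightarrow> r\<^sub>0 \<le> norm w\<^sub>1 \<Longrightarrow> norm w\<^sub>1 \<le> R \<Longrightarrow>
      norm (torus_kernel q w\<^sub>1 - torus_kernel q w\<^sub>0) \<le> C * norm (w\<^sub>1 - w\<^sub>0) * (1 + (\<Sum>a\<in>F. 1 / (norm (w\<^sub>0 - a) * norm (w\<^sub>1 - a))))"
proof -
  obtain m where m: "\<And>n w. m \<le> n \<Longrightarrow> r\<^sub>0 \<le> norm w \<Longrightarrow> norm w \<le> R \<Longrightarrow>
    r\<^sub>0 / 2 \<le> norm (w - q ^ Suc n) \<and> 1 / 2 \<le> norm (w * q ^ Suc n - 1)"
    using far_poles[OF assms] by metis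
  define p where "p n = inverse (q ^ Suc n)" for n
  define F where "F = insert 1 ((\<lambda>n. q ^ Suc n) ` {..<m} \<union> p ` {..<m})"
  have F: "finite F" "0 \<notin> F" "1 \<in> F" using q_nz by (auto simp: F_def p_def)
  have Fmem: "q ^ Suc n \<in> F" "p n \<in> F" if "n < m" for n using that by (auto simp: F_def simp del: power_Suc)
  define A where "A n w = w * q ^ Suc n / (w * q ^ Suc n - 1)" for n w
  define B where "B n w = q ^ Suc n / (w - q ^ Suc n)" for n w
  have AB: "kernel_term q n w = A n w + B n w" for n w by (simp add: kernel_term_def A_def B_def)
  \<comment> \<open>Splitting off the constant 1 leaves a genuine simple pole, and the constant
    cancels in differences.\<close>
  have A_pole: "A n w = 1 + p n / (w - p n)" and p_neq: "w \<noteq> p n" if "w \<in> kernel_dom q" for n w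
  proof -
    have "w * q ^ Suc n \<noteq> 1" using that by (auto simp: kernel_dom_def)
    then show "A n w = 1 + p n / (w - p n)" "w \<noteq> p n" unfolding A_def p_def using q_nz
      by (auto simp: divide_simps simp del: power_Suc)
  qed
  define c where "c = (\<Sum>n<m. norm (p n) + norm (q ^ Suc n))"
  have "0 \<le> c" unfolding c_def by (intro sum_nonneg) auto
  let ?tail = "\<lambda>w. \<Sum>n. kernel_term q (n + m) w"
  have split: "torus_kernel q w = 1 / (w - 1) + ?tail w + (\<Sum>n<m. kernel_term q n w)" if "w \<noteq> 0" for w
    unfolding torus_kernel_def kernel_reg_def
    using suminf_split_initial_segment[of "\<lambda>n. kernel_term q n w" m] summable_add[OF kernel_term_summable[OF that]]
    by (simp add: kernel_term_def del: power_Suc)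
  define C1 where "C1 = (\<Sum>n. (2 * R + 2 / r\<^sub>0) * norm q ^ n)"
  define C2 where "C2 = (\<Sum>n. (4 + 4 / r\<^sub>0\<^sup>2) * norm q ^ n)"
  \<comment> \<open>A constant for both bounds: \<open>C1\<close> and \<open>C2\<close> control the
    tail and its Lipschitz constant, \<open>1 + c\<close> the residues, and \<open>m\<close> the
    constants split off.\<close>
  define C where "C = \<bar>C1\<bar> + \<bar>C2\<bar> + 1 + c + real m"
  have qn: "norm (q ^ Suc (n + m)) \<le> norm q ^ n" for n
    using q_lt_1 power_decreasing[of n "Suc (n + m)" "norm q"] by (simp add: norm_power norm_mult)
  show thesis
  proof
    show "finite F" "0 \<notin> F" by fact+
    show "0 \<le> C" using \<open>0 \<le> c\<close> by (simp add: C_def)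
    {
      fix w assume w: "w \<in> kernel_dom q" "w \<noteq> 1" "r\<^sub>0 \<le> norm w" "norm w \<le> R"
      have "w \<noteq> 0" using w assms by auto
      let ?S = "\<Sum>a\<in>F. 1 / norm (w - a)"
      have S: "1 / norm (w - a) \<le> ?S" if "a \<in> F" for a
        using F that by (intro member_le_sum) auto
      have S0: "0 \<le> ?S" by (intro sum_nonneg) auto
      have tail_term: "norm (kernel_term q (n + m) w) \<le> (2 * R + 2 / r\<^sub>0) * norm q ^ n" for n
      proof -
        have b: "norm (A (n + m) w) \<le> 2 * R * norm q ^ (n + m)" "norm (B (n + m) w) \<le> 2 / r\<^sub>0 * norm q ^ (n + m)"
          unfolding A_def B_def using m[of "n + m" w] w
          by (intro kernel_term_bounds[OF assms w(3,4)]; simp del: power_Suc)+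
        have "norm (kernel_term q (n + m) w) \<le> norm (A (n + m) w) + norm (B (n + m) w)"
          unfolding AB by (rule norm_triangle_ineq)
        also have "\<dots> \<le> (2 * R + 2 / r\<^sub>0) * norm q ^ (n + m)" using b by (simp add: algebra_simps)
        also have "\<dots> \<le> (2 * R + 2 / r\<^sub>0) * norm q ^ n"
          using assms w order_trans[OF norm_ge_zero w(4)] q_lt_1 by (intro mult_left_mono power_decreasing) auto
        finally show ?thesis .
      qed
      have tail: "norm (?tail w) \<le> C1"
        unfolding C1_def by (intro norm_suminf_le tail_term summable_q)
      have init: "norm (kernel_term q n w) \<le> 1 + (norm (p n) + norm (q ^ Suc n)) * ?S" if "n < m" for n
      proof -
        have "norm (kernel_term q n w) \<le> 1 + norm (p n) * (1 / norm (w - p n)) + norm (q ^ Suc n) * (1 / norm (w - q ^ Suc n))"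
          unfolding AB A_pole[OF w(1)] B_def
          using norm_triangle_ineq[of "1 + p n / (w - p n)" "q ^ Suc n / (w - q ^ Suc n)"] norm_triangle_ineq[of 1 "p n / (w - p n)"]
          by (simp add: norm_divide del: power_Suc)
        also have "\<dots> \<le> 1 + norm (p n) * ?S + norm (q ^ Suc n) * ?S"
          using that by (intro add_mono mult_left_mono S Fmem) auto
        finally show ?thesis by (simp add: algebra_simps)
      qed
      have "norm (\<Sum>n<m. kernel_term q n w) \<le> (\<Sum>n<m. 1 + (norm (p n) + norm (q ^ Suc n)) * ?S)"
        by (intro sum_norm_le init) auto
      also have "\<dots> = real m + c * ?S" unfolding c_def sum.distrib[of "\<lambda>_. 1"] sum_distrib_right by simp
      finally have 1: "norm (\<Sum>n<m. kernel_term q n w) \<le> real m + c * ?S" .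
      have 2: "norm (1 / (w - 1)) \<le> ?S" using S[of 1] F by (simp add: norm_divide)
      have "norm (torus_kernel q w) \<le> norm (1 / (w - 1)) + norm (?tail w) + norm (\<Sum>n<m. kernel_term q n w)"
        unfolding split[OF \<open>w \<noteq> 0\<close>] by (intro norm_triangle_le add_mono norm_triangle_ineq order_refl)
      also have "\<dots> \<le> ?S + C1 + (real m + c * ?S)" by (intro add_mono 1 2 tail)
      also have "\<dots> = (C1 + real m) * 1 + (1 + c) * ?S" by (simp add: algebra_simps)
      also have "\<dots> \<le> C * 1 + C * ?S"
        using S0 \<open>0 \<le> c\<close> by (intro add_mono mult_right_mono) (auto simp: C_def)
      finally show "norm (torus_kernel q w) \<le> C * (1 + ?S)" by (simp add: algebra_simps)
    }
    {
      fix w\<^sub>0 w\<^sub>1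
      assume w0: "w\<^sub>0 \<in> kernel_dom q" "w\<^sub>0 \<noteq> 1" "r\<^sub>0 \<le> norm w\<^sub>0" "norm w\<^sub>0 \<le> R"
        and w1: "w\<^sub>1 \<in> kernel_dom q" "w\<^sub>1 \<noteq> 1" "r\<^sub>0 \<le> norm w\<^sub>1" "norm w\<^sub>1 \<le> R"
      have nz: "w\<^sub>0 \<noteq> 0" "w\<^sub>1 \<noteq> 0" using w0 w1 assms by auto
      let ?P = "\<lambda>a. 1 / (norm (w\<^sub>0 - a) * norm (w\<^sub>1 - a))"
      let ?S = "\<Sum>a\<in>F. ?P a" and ?\<delta> = "norm (w\<^sub>1 - w\<^sub>0)"
      have S: "?P a \<le> ?S" if "a \<in> F" for a
        using F that by (intro member_le_sum) auto
      have S0: "0 \<le> ?S" by (intro sum_nonneg) auto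
      have B_neq: "w\<^sub>0 \<noteq> q ^ Suc n" "w\<^sub>1 \<noteq> q ^ Suc n" for n using w0 w1 by (auto simp: kernel_dom_def)
      have A_diff: "norm (A n w\<^sub>1 - A n w\<^sub>0) = norm (p n) * ?\<delta> * ?P (p n)" for n
        using simple_pole_diff[OF p_neq[OF w0(1)] p_neq[OF w1(1)], where b = "p n"]
        by (simp add: A_pole[OF w0(1)] A_pole[OF w1(1)])
      have B_diff: "norm (B n w\<^sub>1 - B n w\<^sub>0) = norm (q ^ Suc n) * ?\<delta> * ?P (q ^ Suc n)" for n
        using simple_pole_diff[OF B_neq, where b = "q ^ Suc n"] by (simp add: B_def del: power_Suc)
      have tail_term: "norm (kernel_term q (n + m) w\<^sub>1 - kernel_term q (n + m) w\<^sub>0) \<le> ?\<delta> * ((4 + 4 / r\<^sub>0\<^sup>2) * norm q ^ n)" for n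
      proof -
        let ?N = "Suc (n + m)"
        have m0: "r\<^sub>0 / 2 \<le> norm (w\<^sub>0 - q ^ ?N)" "1 / 2 \<le> norm (w\<^sub>0 * q ^ ?N - 1)"
          and m1: "r\<^sub>0 / 2 \<le> norm (w\<^sub>1 - q ^ ?N)" "1 / 2 \<le> norm (w\<^sub>1 * q ^ ?N - 1)"
          using m[of "n + m" w\<^sub>0] m[of "n + m" w\<^sub>1] w0 w1 by auto
        have "w\<^sub>0 * q ^ ?N \<noteq> 1" "w\<^sub>1 * q ^ ?N \<noteq> 1" using m0 m1 by auto
        then have "A (n + m) w\<^sub>1 - A (n + m) w\<^sub>0 = q ^ ?N * (w\<^sub>0 - w\<^sub>1) / ((w\<^sub>0 * q ^ ?N - 1) * (w\<^sub>1 * q ^ ?N - 1))"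
          unfolding A_def by (simp add: divide_simps del: power_Suc) (simp add: algebra_simps)
        then have "norm (A (n + m) w\<^sub>1 - A (n + m) w\<^sub>0)
          = (norm (q ^ ?N) * ?\<delta>) / (norm (w\<^sub>0 * q ^ ?N - 1) * norm (w\<^sub>1 * q ^ ?N - 1))"
          by (simp add: norm_divide norm_mult norm_minus_commute)
        also have "\<dots> \<le> (norm q ^ n * ?\<delta>) / (1/2 * (1/2))"
          using m0 m1 qn by (intro frac_le mult_mono mult_nonneg_nonneg) auto
        finally have 1: "norm (A (n + m) w\<^sub>1 - A (n + m) w\<^sub>0) \<le> ?\<delta> * (4 * norm q ^ n)" by (simp add: mult_ac)
        have "norm (B (n + m) w\<^sub>1 - B (n + m) w\<^sub>0) = (norm (q ^ ?N) * ?\<delta>) / (norm (w\<^sub>0 - q ^ ?N) * norm (w\<^sub>1 - q ^ ?N))"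
          unfolding B_diff by simp
        also have "\<dots> \<le> (norm q ^ n * ?\<delta>) / (r\<^sub>0/2 * (r\<^sub>0/2))"
          using m0 m1 qn assms by (intro frac_le mult_mono mult_nonneg_nonneg mult_pos_pos) auto
        also have "\<dots> = ?\<delta> * ((4 / r\<^sub>0\<^sup>2) * norm q ^ n)" by (simp add: power2_eq_square mult_ac)
        finally have 2: "norm (B (n + m) w\<^sub>1 - B (n + m) w\<^sub>0) \<le> ?\<delta> * ((4 / r\<^sub>0\<^sup>2) * norm q ^ n)" .
        have "kernel_term q (n + m) w\<^sub>1 - kernel_term q (n + m) w\<^sub>0 = (A (n + m) w\<^sub>1 - A (n + m) w\<^sub>0) + (B (n + m) w\<^sub>1 - B (n + m) w\<^sub>0)"
          by (simp add: AB)
        then have "norm (kernel_term q (n + m) w\<^sub>1 - kernel_term q (n + m) w\<^sub>0) \<le> ?\<delta> * (4 * norm q ^ n) + ?\<delta> * ((4 / r\<^sub>0\<^sup>2) * norm q ^ n)"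
          using 1 2 by (metis add_mono norm_triangle_le)
        then show ?thesis by (simp only: distrib_left[symmetric] distrib_right[symmetric])
      qed
      have sm: "summable (\<lambda>n. kernel_term q (n + m) w)" if "w \<noteq> 0" for w
        using summable_ignore_initial_segment[OF summable_add[OF kernel_term_summable[OF that]], of m]
        by (simp add: kernel_term_def)
      have "norm (?tail w\<^sub>1 - ?tail w\<^sub>0) = norm (\<Sum>n. kernel_term q (n + m) w\<^sub>1 - kernel_term q (n + m) w\<^sub>0)"
        using suminf_diff[OF sm[OF nz(2)] sm[OF nz(1)]] by simp
      also have "\<dots> \<le> (\<Sum>n. ?\<delta> * ((4 + 4 / r\<^sub>0\<^sup>2) * norm q ^ n))"
        by (intro norm_suminf_le tail_term summable_mult[OF summable_q])
      also have "\<dots> = ?\<delta> * C2" unfolding C2_def by (intro suminf_mult summable_q)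
      finally have tail: "norm (?tail w\<^sub>1 - ?tail w\<^sub>0) \<le> ?\<delta> * C2" .
      have init: "norm (kernel_term q n w\<^sub>1 - kernel_term q n w\<^sub>0) \<le> (norm (p n) + norm (q ^ Suc n)) * (?\<delta> * ?S)" if "n < m" for n
      proof -
        have "kernel_term q n w\<^sub>1 - kernel_term q n w\<^sub>0 = (A n w\<^sub>1 - A n w\<^sub>0) + (B n w\<^sub>1 - B n w\<^sub>0)" by (simp add: AB)
        then have "norm (kernel_term q n w\<^sub>1 - kernel_term q n w\<^sub>0) \<le> norm (p n) * ?\<delta> * ?P (p n) + norm (q ^ Suc n) * ?\<delta> * ?P (q ^ Suc n)"
          using A_diff B_diff by (metis norm_triangle_ineq)
        also have "\<dots> \<le> norm (p n) * ?\<delta> * ?S + norm (q ^ Suc n) * ?\<delta> * ?S"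
          using that by (intro add_mono mult_left_mono S Fmem mult_nonneg_nonneg) auto
        finally show ?thesis by (simp add: algebra_simps)
      qed
      have "norm ((\<Sum>n<m. kernel_term q n w\<^sub>1) - (\<Sum>n<m. kernel_term q n w\<^sub>0)) \<le> (\<Sum>n<m. (norm (p n) + norm (q ^ Suc n)) * (?\<delta> * ?S))"
        unfolding sum_subtractf[symmetric] by (intro sum_norm_le init) auto
      also have "\<dots> = c * (?\<delta> * ?S)" unfolding c_def by (simp add: sum_distrib_right)
      finally have 1: "norm ((\<Sum>n<m. kernel_term q n w\<^sub>1) - (\<Sum>n<m. kernel_term q n w\<^sub>0)) \<le> c * (?\<delta> * ?S)" .
      have "norm (1 / (w\<^sub>1 - 1) - 1 / (w\<^sub>0 - 1)) = ?\<delta> * ?P 1"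
        using simple_pole_diff[OF w0(2) w1(2), of 1] by simp
      also have "\<dots> \<le> ?\<delta> * ?S" using F by (intro mult_left_mono S) auto
      finally have 2: "norm (1 / (w\<^sub>1 - 1) - 1 / (w\<^sub>0 - 1)) \<le> ?\<delta> * ?S" .
      have "torus_kernel q w\<^sub>1 - torus_kernel q w\<^sub>0 = (1 / (w\<^sub>1 - 1) - 1 / (w\<^sub>0 - 1)) + (?tail w\<^sub>1 - ?tail w\<^sub>0)
         + ((\<Sum>n<m. kernel_term q n w\<^sub>1) - (\<Sum>n<m. kernel_term q n w\<^sub>0))"
        unfolding split[OF nz(1)] split[OF nz(2)] by simp
      then have "norm (torus_kernel q w\<^sub>1 - torus_kernel q w\<^sub>0) \<le> ?\<delta> * ?S + ?\<delta> * C2 + c * (?\<delta> * ?S)"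
        using 1 2 tail by (smt (verit) norm_triangle_ineq)
      also have "\<dots> = ?\<delta> * (C2 * 1 + (1 + c) * ?S)" by (simp add: algebra_simps)
      also have "\<dots> \<le> ?\<delta> * (C * 1 + C * ?S)"
        using S0 \<open>0 \<le> c\<close> by (intro mult_left_mono add_mono mult_right_mono) (auto simp: C_def)
      finally show "norm (torus_kernel q w\<^sub>1 - torus_kernel q w\<^sub>0) \<le> C * ?\<delta> * (1 + ?S)" by (simp add: algebra_simps)
    }
  qed
qed

end

subsection \<open>The primitive of a closed one-form on the torus\<close>

lemma one_form_scaleR: "one_form a b p v = fst v *\<^sub>R a p + snd v *\<^sub>R b p"
  by (simp add: one_form_def scaleR_conv_of_real mult.commute)

text \<open>Differentiation under the integral sign takes derivatives in the normed space of bounded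
  linear maps; this is the covector with components \<open>c\<close> and \<open>d\<close> in that
  space.\<close>

definition covector :: "complex \<Rightarrow> complex \<Rightarrow> plane \<Rightarrow>\<^sub>L complex" where
  "covector c d = Blinfun (\<lambda>v. fst v *\<^sub>R c + snd v *\<^sub>R d)"

lemma covector_apply [simp]: "blinfun_apply (covector c d) v = fst v *\<^sub>R c + snd v *\<^sub>R d"
proof -
  have "bounded_linear (\<lambda>v::plane. fst v *\<^sub>R c + snd v *\<^sub>R d)"
    by (intro bounded_linear_add bounded_linear_scaleR_const bounded_linear_fst bounded_linear_snd)
  then show ?thesis unfolding covector_def by (simp add: bounded_linear_Blinfun_apply)
qed

lemma continuous_on_covector:
  fixes c d :: "'a::t2_space \<Rightarrow> complex"
  assumes "continuous_on S c" "continuous_on S d"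
  shows "continuous_on S (\<lambda>x. covector (c x) (d x))"
  by (rule continuous_on_blinfun_componentwise) (auto intro!: continuous_intros assms)

locale torus_form =
  fixes a b :: "plane \<Rightarrow> complex" and \<tau> :: complex
  assumes C1: "Ck_on 1 UNIV a" "Ck_on 1 UNIV b"
    and periodic: "torus_fun a" "torus_fun b"
    and closed: "closed_form a b"
    and normalization: "\<And>p. primitive (one_form a b) (p + (1, 0)) = primitive (one_form a b) p + 1"
      "\<And>p. primitive (one_form a b) (p + (0, 1)) = primitive (one_form a b) p + \<tau>"
      "Im \<tau> > 0"
begin

abbreviation Z :: "plane \<Rightarrow> complex" where "Z \<equiv> primitive (one_form a b)"

text \<open>The exponential makes the period 1 disappear and turns the period \<tau> into
  multiplication by the nome \<open>q\<close>: the plane modulo the lattice becomes the punctured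
  plane modulo powers of \<open>q\<close>.\<close>

definition E :: "plane \<Rightarrow> complex" where "E p = exp (2 * pi * \<i> * Z p)"

definition q :: complex where "q = exp (2 * pi * \<i> * \<tau>)"

lemma differentiable: "a differentiable (at p)" "b differentiable (at p)"
  and continuous_pd: "continuous_on UNIV (pd_x a)" "continuous_on UNIV (pd_y a)" "continuous_on UNIV (pd_x b)" "continuous_on UNIV (pd_y b)"
  using C1 unfolding One_nat_def Ck_on.simps by blast+

lemma continuous_ab: "continuous_on S a" "continuous_on S b"
  using differentiable by (auto intro!: continuous_at_imp_continuous_on differentiable_imp_continuous_within)

lemma pd_swap: "pd_x b p = pd_y a p"
  using closed unfolding closed_form_def by (metis eq_iff_diff_eq_0)

text \<open>Poincare's lemma on the star-shaped plane: after differentiation under the integral,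
  closedness makes the integrand the total derivative in \<open>t\<close> of
  \<open>t *\<^sub>R one_form a b (t *\<^sub>R p) v\<close>, so the integral is the value at
  \<open>t = 1\<close>.\<close>

lemma primitive_has_derivative: "(Z has_derivative (\<lambda>v. fst v *\<^sub>R a p + snd v *\<^sub>R b p)) (at p)"
proof -
  \<comment> \<open>The two components of the derivative of
    \<open>one_form a b (t *\<^sub>R x) x\<close> with respect to \<open>x\<close>.\<close>
  define c where "c x t = a (t *\<^sub>R x) + t *\<^sub>R (fst x *\<^sub>R pd_x a (t *\<^sub>R x) + snd x *\<^sub>R pd_x b (t *\<^sub>R x))" for x t
  define d where "d x t = b (t *\<^sub>R x) + t *\<^sub>R (fst x *\<^sub>R pd_y a (t *\<^sub>R x) + snd x *\<^sub>R pd_y b (t *\<^sub>R x))" for x t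
  have cont: "continuous_on UNIV (\<lambda>y. g (snd y *\<^sub>R fst y))" if "continuous_on UNIV g" for g :: "plane \<Rightarrow> complex"
    by (rule continuous_on_compose2[OF that]) (auto intro!: continuous_intros)
  note conts = continuous_pd[THEN cont] continuous_ab[of UNIV, THEN cont]
  have cc: "continuous_on UNIV (\<lambda>y. c (fst y) (snd y))" and cd: "continuous_on UNIV (\<lambda>y. d (fst y) (snd y))"
    unfolding c_def d_def by (intro continuous_intros conts)+
  have t1: "continuous_on UNIV (\<lambda>t::real. (x, t))" for x :: plane by (intro continuous_intros)
  have cc': "continuous_on UNIV (c x)" and cd': "continuous_on UNIV (d x)" for x
    using continuous_on_compose2[OF cc t1[of x]] continuous_on_compose2[OF cd t1[of x]] by auto
  have ct: "continuous_on S (\<lambda>t. g (t *\<^sub>R x))" if "continuous_on UNIV g" for g :: "plane \<Rightarrow> complex" and x S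
    by (rule continuous_on_compose2[OF that]) (auto intro!: continuous_intros)
  have "((\<lambda>x. integral (cbox 0 1) (\<lambda>t. one_form a b (t *\<^sub>R x) x)) has_derivative
      blinfun_apply (integral (cbox 0 1) (\<lambda>t. covector (c p t) (d p t)))) (at p within UNIV)"
  proof (rule leibniz_rule)
    fix x :: plane and t :: real
    have comp: "((\<lambda>x. g (t *\<^sub>R x)) has_derivative (\<lambda>v. (t * fst v) *\<^sub>R pd_x g (t *\<^sub>R x) + (t * snd v) *\<^sub>R pd_y g (t *\<^sub>R x))) (at x)"
      if "g differentiable (at (t *\<^sub>R x))" for g :: "plane \<Rightarrow> complex"
    proof -
      have "((\<lambda>x. t *\<^sub>R x) has_derivative (\<lambda>v. t *\<^sub>R v)) (at x)" by (auto intro!: derivative_eq_intros)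
      from diff_chain_at[OF this has_derivative_partials[OF that]] show ?thesis by (simp add: o_def)
    qed
    have "((\<lambda>x. fst x *\<^sub>R a (t *\<^sub>R x) + snd x *\<^sub>R b (t *\<^sub>R x)) has_derivative
      (\<lambda>v. (fst x *\<^sub>R ((t * fst v) *\<^sub>R pd_x a (t *\<^sub>R x) + (t * snd v) *\<^sub>R pd_y a (t *\<^sub>R x)) + fst v *\<^sub>R a (t *\<^sub>R x))
        + (snd x *\<^sub>R ((t * fst v) *\<^sub>R pd_x b (t *\<^sub>R x) + (t * snd v) *\<^sub>R pd_y b (t *\<^sub>R x)) + snd v *\<^sub>R b (t *\<^sub>R x)))) (at x)"
      by (intro has_derivative_add has_derivative_scaleR comp differentiable has_derivative_fst has_derivative_snd has_derivative_ident)
    then show "((\<lambda>x. one_form a b (t *\<^sub>R x) x) has_derivative blinfun_apply (covector (c x t) (d x t))) (at x within UNIV)"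
      unfolding one_form_scaleR by (rule has_derivative_eq_rhs) (auto simp: c_def d_def algebra_simps)
  next
    show "(\<lambda>t. one_form a b (t *\<^sub>R x) x) integrable_on cbox 0 1" for x
      unfolding one_form_scaleR by (intro integrable_continuous continuous_intros ct continuous_ab)
    show "continuous_on (UNIV \<times> cbox 0 1) (\<lambda>(x, t). covector (c x t) (d x t))"
      unfolding case_prod_beta by (intro continuous_on_covector continuous_on_subset[OF cc] continuous_on_subset[OF cd]) auto
  qed auto
  moreover have "blinfun_apply (integral (cbox 0 1) (\<lambda>t. covector (c p t) (d p t))) v = fst v *\<^sub>R a p + snd v *\<^sub>R b p" for v
  proof -
    have "(\<lambda>t. covector (c p t) (d p t)) integrable_on cbox 0 1"
      by (intro integrable_continuous continuous_on_covector continuous_on_subset[OF cc'] continuous_on_subset[OF cd']) auto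
    then have "blinfun_apply (integral (cbox 0 1) (\<lambda>t. covector (c p t) (d p t))) v
      = integral (cbox 0 1) (\<lambda>t. fst v *\<^sub>R c p t + snd v *\<^sub>R d p t)"
      by (subst blinfun_apply_integral) auto
    also have "((\<lambda>t. fst v *\<^sub>R c p t + snd v *\<^sub>R d p t) has_integral
       1 *\<^sub>R (fst v *\<^sub>R a (1 *\<^sub>R p) + snd v *\<^sub>R b (1 *\<^sub>R p)) - 0 *\<^sub>R (fst v *\<^sub>R a (0 *\<^sub>R p) + snd v *\<^sub>R b (0 *\<^sub>R p))) {0..1}"
    proof (rule fundamental_theorem_of_calculus)
      fix t :: real
      have comp: "((\<lambda>t. g (t *\<^sub>R p)) has_vector_derivative (fst p *\<^sub>R pd_x g (t *\<^sub>R p) + snd p *\<^sub>R pd_y g (t *\<^sub>R p))) (at t within {0..1})"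
        if "g differentiable (at (t *\<^sub>R p))" for g :: "plane \<Rightarrow> complex"
      proof -
        have "((\<lambda>t. t *\<^sub>R p) has_derivative (\<lambda>h. h *\<^sub>R p)) (at t)" by (auto intro!: derivative_eq_intros)
        from diff_chain_at[OF this has_derivative_partials[OF that]]
        have "((\<lambda>t. g (t *\<^sub>R p)) has_vector_derivative (fst p *\<^sub>R pd_x g (t *\<^sub>R p) + snd p *\<^sub>R pd_y g (t *\<^sub>R p))) (at t)"
          by (simp add: o_def has_vector_derivative_def scaleR_add_right)
        then show ?thesis by (rule has_vector_derivative_at_within)
      qed
      have "((\<lambda>t. t *\<^sub>R (fst v *\<^sub>R a (t *\<^sub>R p) + snd v *\<^sub>R b (t *\<^sub>R p))) has_vector_derivative
        (t *\<^sub>R (fst v *\<^sub>R (fst p *\<^sub>R pd_x a (t *\<^sub>R p) + snd p *\<^sub>R pd_y a (t *\<^sub>R p)) + snd v *\<^sub>R (fst p *\<^sub>R pd_x b (t *\<^sub>R p) + snd p *\<^sub>R pd_y b (t *\<^sub>R p)))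
          + 1 *\<^sub>R (fst v *\<^sub>R a (t *\<^sub>R p) + snd v *\<^sub>R b (t *\<^sub>R p)))) (at t within {0..1})"
        by (intro has_vector_derivative_scaleR has_vector_derivative_add bounded_linear.has_vector_derivative[OF bounded_linear_scaleR_right]
          comp differentiable DERIV_ident)
      moreover have "(t *\<^sub>R (fst v *\<^sub>R (fst p *\<^sub>R pd_x a (t *\<^sub>R p) + snd p *\<^sub>R pd_y a (t *\<^sub>R p)) + snd v *\<^sub>R (fst p *\<^sub>R pd_x b (t *\<^sub>R p) + snd p *\<^sub>R pd_y b (t *\<^sub>R p)))
          + 1 *\<^sub>R (fst v *\<^sub>R a (t *\<^sub>R p) + snd v *\<^sub>R b (t *\<^sub>R p))) = fst v *\<^sub>R c p t + snd v *\<^sub>R d p t"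
        by (simp add: c_def d_def pd_swap algebra_simps)
      ultimately show "((\<lambda>t. t *\<^sub>R (fst v *\<^sub>R a (t *\<^sub>R p) + snd v *\<^sub>R b (t *\<^sub>R p))) has_vector_derivative fst v *\<^sub>R c p t + snd v *\<^sub>R d p t) (at t within {0..1})"
        by simp
    qed simp
    then have "integral (cbox 0 1) (\<lambda>t. fst v *\<^sub>R c p t + snd v *\<^sub>R d p t) = fst v *\<^sub>R a p + snd v *\<^sub>R b p"
      by (simp add: integral_unique)
    finally show ?thesis .
  qed
  then have "blinfun_apply (integral (cbox 0 1) (\<lambda>t. covector (c p t) (d p t))) = (\<lambda>v. fst v *\<^sub>R a p + snd v *\<^sub>R b p)"
    by (rule ext)
  ultimately show ?thesis unfolding primitive_def[abs_def] by simp
qed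

lemma continuous_Z: "continuous_on S Z"
  using primitive_has_derivative by (intro continuous_at_imp_continuous_on ballI has_derivative_continuous)

lemma E_has_derivative:
  "(E has_derivative (\<lambda>v. fst v *\<^sub>R (2 * pi * \<i> * E p * a p) + snd v *\<^sub>R (2 * pi * \<i> * E p * b p))) (at p)"
proof -
  have "((\<lambda>z. exp (2 * pi * \<i> * z)) has_field_derivative exp (2 * pi * \<i> * Z p) * (2 * pi * \<i>)) (at (Z p))"
    by (auto intro!: derivative_eq_intros)
  then have "((\<lambda>z. exp (2 * pi * \<i> * z)) has_derivative (*) (exp (2 * pi * \<i> * Z p) * (2 * pi * \<i>))) (at (Z p))"
    by (simp add: has_field_derivative_def)
  from diff_chain_at[OF primitive_has_derivative this]
  show ?thesis unfolding E_def[abs_def] by (simp add: o_def algebra_simps)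
qed

lemma continuous_E: "continuous_on S E"
  unfolding E_def[abs_def] by (intro continuous_intros continuous_Z)

lemma E_nonzero [simp]: "E p \<noteq> 0" by (simp add: E_def)

lemma q_nome: "nome q"
proof
  show "q \<noteq> 0" by (simp add: q_def)
  have "Re (2 * pi * \<i> * \<tau>) < 0" using normalization(3) by simp
  then show "norm q < 1" unfolding q_def norm_exp_eq_Re by simp
qed

section \<open>Z and E under lattice translations\<close>

lemma Z_shift: "Z (p + (of_int m, of_int n)) = Z p + of_int m + of_int n * \<tau>"
proof -
  have 1: "Z (p + (of_int m, 0)) = Z p + of_int m" for p
  proof (induction m rule: int_induct[of _ 0])
    case (step1 i)
    then show ?case using normalization(1)[of "p + (of_int i, 0)"] by (simp add: add.assoc)
  next
    case (step2 i)
    then show ?case using normalization(1)[of "p + (of_int (i - 1), 0)"] by (simp add: add.assoc algebra_simps)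
  qed (simp add: zero_prod_def[symmetric])
  have 2: "Z (p + (0, of_int n)) = Z p + of_int n * \<tau>" for p
  proof (induction n rule: int_induct[of _ 0])
    case (step1 i)
    then show ?case using normalization(2)[of "p + (0, of_int i)"] by (simp add: add.assoc algebra_simps)
  next
    case (step2 i)
    then show ?case using normalization(2)[of "p + (0, of_int (i - 1))"] by (simp add: add.assoc algebra_simps)
  qed (simp add: zero_prod_def[symmetric])
  show ?thesis using 1[of "p + (0, of_int n)"] 2[of p] by (simp add: add.assoc)
qed

lemma E_shift: "E (p + (1, 0)) = E p" "E (p + (0, 1)) = q * E p"
  by (simp_all add: E_def q_def normalization exp_add ring_distribs)

lemma E_eq_iff: "E p = q powi n * E p' \<longleftrightarrow> (\<exists>m::int. Z p = Z (p' + (of_int m, of_int n)))"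
proof -
  have "q powi n * E p' = exp (2 * pi * \<i> * (Z p' + of_int n * \<tau>))"
    by (simp add: E_def q_def exp_power_int exp_add ring_distribs mult_ac)
  then have "E p = q powi n * E p' \<longleftrightarrow> exp (2 * pi * \<i> * Z p) = exp (2 * pi * \<i> * (Z p' + of_int n * \<tau>))"
    by (simp add: E_def)
  also have "\<dots> \<longleftrightarrow> (\<exists>m::int. 2 * pi * \<i> * Z p = 2 * pi * \<i> * (Z p' + of_int n * \<tau>) + (of_int (2 * m) * pi) * \<i>)"
    by (rule exp_eq)
  also have "\<dots> \<longleftrightarrow> (\<exists>m::int. (2 * pi * \<i>) * Z p = (2 * pi * \<i>) * (Z p' + of_int n * \<tau> + of_int m))"
    by (intro ex_cong1) (simp add: algebra_simps)
  also have "\<dots> \<longleftrightarrow> (\<exists>m::int. Z p = Z p' + of_int n * \<tau> + of_int m)"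
    unfolding mult_cancel_left by simp
  finally show ?thesis by (simp add: Z_shift algebra_simps)
qed

text \<open>\<open>Z\<close> differs from the real-linear map taking \<open>(x, y)\<close> to
  \<open>x + y * \<tau>\<close> by a periodic, hence bounded function, and that map is an
  isomorphism because \<tau> is not real.\<close>

lemma Z_proper: "bounded (Z -` cball z r)"
proof -
  define g where "g p = Z p - (of_real (fst p) + of_real (snd p) * \<tau>)" for p
  have "torus_fun g" by (simp add: torus_fun_def g_def normalization algebra_simps)
  moreover have "continuous_on UNIV g" unfolding g_def by (intro continuous_intros continuous_Z)
  ultimately obtain C where C: "0 \<le> C" "\<And>p. norm (g p) \<le> C" by (rule torus_fun_bounded) blast
  define R where "R = norm z + \<bar>r\<bar> + C"
  have "norm p \<le> R / Im \<tau> * (1 + norm \<tau>) + R" if "Z p \<in> cball z r" for p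
  proof -
    have "norm (Z p) \<le> norm z + \<bar>r\<bar>" using that norm_triangle_sub[of "Z p" z] by (auto simp: dist_norm norm_minus_commute)
    then have 1: "norm (of_real (fst p) + of_real (snd p) * \<tau>) \<le> R"
      using norm_triangle_ineq4[of "Z p" "g p"] C(2)[of p] by (simp add: g_def R_def)
    have "\<bar>snd p * Im \<tau>\<bar> \<le> R" using abs_Im_le_cmod[of "of_real (fst p) + of_real (snd p) * \<tau>"] 1 by simp
    then have y: "\<bar>snd p\<bar> \<le> R / Im \<tau>" using normalization(3) by (simp add: abs_mult field_simps)
    have "\<bar>fst p\<bar> = norm (complex_of_real (fst p))" by simp
    also have "\<dots> \<le> norm (of_real (fst p) + of_real (snd p) * \<tau>) + norm (of_real (snd p) * \<tau>)"
      by (metis add_diff_cancel norm_triangle_ineq4)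
    also have "\<dots> \<le> R + R / Im \<tau> * norm \<tau>" using 1 y by (intro add_mono) (auto simp del: times_divide_eq_left simp: norm_mult intro!: mult_right_mono)
    finally have "\<bar>fst p\<bar> \<le> R + R / Im \<tau> * norm \<tau>" .
    moreover have "norm p \<le> \<bar>fst p\<bar> + \<bar>snd p\<bar>" using norm_Pair_le[of "fst p" "snd p"] by simp
    ultimately show ?thesis using y by (simp add: algebra_simps add_divide_distrib)
  qed
  then show ?thesis by (auto intro!: boundedI)
qed

end

subsection \<open>Growth of the first integral\<close>

lemma ball_cover:
  assumes "compact S" "\<And>p. p \<in> S \<Longrightarrow> 0 < \<delta> p"
  obtains D where "finite D" "D \<subseteq> S" "S \<subseteq> (\<Union>p\<in>D. ball p (\<delta> p))"
  by (rule compactE_image[OF assms(1), of S "\<lambda>p. ball p (\<delta> p)"]) (use assms(2) in force)+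

context torus_form
begin

abbreviation \<omega> :: "plane \<Rightarrow> plane \<Rightarrow> complex" where "\<omega> \<equiv> one_form a b"

lemma isCont_E: "isCont E p" and isCont_ab: "isCont a p" "isCont b p"
  using continuous_E[of UNIV] continuous_ab[of UNIV] continuous_on_eq_continuous_at[OF open_UNIV] by blast+

lemma wedge_cnj_eq: "wedge_cnj \<omega> p = a p * cnj (b p) - b p * cnj (a p)"
  by (simp add: wedge_cnj_def wedge_def one_form_def)

lemma closed_char_lift: "closed (char_lift \<omega>)"
  unfolding char_lift_def wedge_cnj_eq by (intro closed_Collect_eq continuous_intros continuous_ab)

text \<open>Off the characteristic set \<open>a\<close> and \<open>b\<close> are linearly
  independent over the reals, so the differential of \<open>E\<close> is injective and the C^1 lower
  bound applies.\<close>

lemma noncharacteristic_lower_bound: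
  assumes "p\<^sub>0 \<notin> char_lift \<omega>"
  obtains \<delta> c where "0 < \<delta>" "0 < c"
    "\<And>p p'. p \<in> ball p\<^sub>0 \<delta> \<Longrightarrow> p' \<in> ball p\<^sub>0 \<delta> \<Longrightarrow> c * norm (p - p') \<le> norm (E p - E p')"
proof (rule C1_lower_bound[OF open_UNIV UNIV_I E_has_derivative, of p\<^sub>0])
  show "isCont (\<lambda>p. 2 * pi * \<i> * E p * a p) p\<^sub>0" "isCont (\<lambda>p. 2 * pi * \<i> * E p * b p) p\<^sub>0"
    by (intro continuous_intros isCont_E isCont_ab)+
  fix v :: plane
  assume 0: "fst v *\<^sub>R (2 * pi * \<i> * E p\<^sub>0 * a p\<^sub>0) + snd v *\<^sub>R (2 * pi * \<i> * E p\<^sub>0 * b p\<^sub>0) = 0"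
  define X where "X = of_real (fst v) * a p\<^sub>0 + of_real (snd v) * b p\<^sub>0"
  have "(2 * pi * \<i> * E p\<^sub>0) * X = 0" using 0 by (simp add: X_def scaleR_conv_of_real algebra_simps)
  then have X: "X = 0" by simp
  have w: "wedge_cnj \<omega> p\<^sub>0 \<noteq> 0" using assms by (simp add: char_lift_def)
  \<comment> \<open>Cramer's rule for \<open>X\<close> and its conjugate, whose determinant is the
    wedge coefficient.\<close>
  have "of_real (fst v) * wedge_cnj \<omega> p\<^sub>0 = X * cnj (b p\<^sub>0) - cnj X * b p\<^sub>0"
    "of_real (snd v) * wedge_cnj \<omega> p\<^sub>0 = cnj X * a p\<^sub>0 - X * cnj (a p\<^sub>0)"
    by (simp_all add: X_def wedge_cnj_eq algebra_simps)
  then have "of_real (fst v) * wedge_cnj \<omega> p\<^sub>0 = 0" "of_real (snd v) * wedge_cnj \<omega> p\<^sub>0 = 0" by (simp_all add: X)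
  then show "v = 0" using w by (simp add: prod_eq_iff)
qed (use that in blast)

end

text \<open>Only an upper bound for the local exponent is kept, not the component to which the point
  belongs; the components enter just once, when the locale is instantiated.\<close>

locale normal_torus_form = torus_form +
  fixes \<sigma>max :: real
  assumes sigma_pos: "0 < \<sigma>max"
    and normal: "\<And>p. p \<in> char_lift \<omega> \<Longrightarrow> \<exists>\<sigma> U s t h. 0 < \<sigma> \<and> \<sigma> \<le> \<sigma>max \<and> p \<in> U \<and> C1_coords U s t \<and>
      (\<forall>p'\<in>U. h p' \<noteq> 0 \<and> (\<forall>v. \<omega> p' v = h p' * (of_real (frechet_derivative s (at p') v)
         + \<i> * of_real (\<bar>t p'\<bar> powr \<sigma>) * of_real (frechet_derivative t (at p') v))))"
begin

definition d :: real where "d = 2 - \<sigma>max / (\<sigma>max + 1)"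

text \<open>The two summands are the growth exponents in the directions \<open>s\<close> and
  \<open>t\<close> where the degeneracy is strongest.\<close>

lemma d_eq: "d = 1 + 1 / (\<sigma>max + 1)"
  using sigma_pos by (simp add: d_def field_simps)

lemma d_bounds: "1 < d" "d < 2"
  using sigma_pos by (auto simp: d_eq)

text \<open>In a normal chart an oscillation of \<open>E\<close> by \<rho> confines \<open>s\<close>
  to an interval of length O(\<rho>) and \<open>t\<close> to one of length
  O(\<rho>^(1/(\<sigma>+1))), and the strip estimate multiplies the two; off the characteristic set
  the bound is quadratic. Since \<rho> is at most 1, both imply the bound with the common exponent
  \<open>d\<close>. It is stated for arbitrary sets of small oscillation so that it can be summed
  over a cover.\<close>

lemma local_growth:
  "\<exists>\<delta> K. 0 < \<delta> \<and> 0 \<le> K \<and> inj_on E (ball p\<^sub>0 \<delta>) \<and> emeasure lebesgue (char_lift \<omega> \<inter> ball p\<^sub>0 \<delta>) = 0 \<and>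
    (\<forall>S \<rho>. S \<subseteq> ball p\<^sub>0 \<delta> \<longrightarrow> 0 < \<rho> \<longrightarrow> \<rho> \<le> 1 \<longrightarrow> (\<forall>p\<in>S. \<forall>p'\<in>S. norm (E p - E p') \<le> \<rho>) \<longrightarrow>
      emeasure lebesgue S \<le> ennreal (K * \<rho> powr d))"
proof (cases "p\<^sub>0 \<in> char_lift \<omega>")
  case False
  obtain \<delta> c where \<delta>: "0 < \<delta>" "0 < c"
    "\<And>p p'. p \<in> ball p\<^sub>0 \<delta> \<Longrightarrow> p' \<in> ball p\<^sub>0 \<delta> \<Longrightarrow> c * norm (p - p') \<le> norm (E p - E p')"
    using noncharacteristic_lower_bound[OF False] by metis
  obtain \<delta>' where \<delta>': "0 < \<delta>'" "ball p\<^sub>0 \<delta>' \<subseteq> - char_lift \<omega>"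
    using closed_char_lift False open_contains_ball[of "- char_lift \<omega>"] by (auto simp: open_Compl)
  define \<delta>'' where "\<delta>'' = min \<delta> \<delta>'"
  have sub: "ball p\<^sub>0 \<delta>'' \<subseteq> ball p\<^sub>0 \<delta>" "ball p\<^sub>0 \<delta>'' \<subseteq> ball p\<^sub>0 \<delta>'" by (auto simp: \<delta>''_def)
  show ?thesis
  proof (rule exI[of _ \<delta>''], rule exI[of _ "4 / c\<^sup>2"], intro conjI allI impI)
    show "0 < \<delta>''" using \<delta> \<delta>' by (simp add: \<delta>''_def)
    show "inj_on E (ball p\<^sub>0 \<delta>'')"
    proof (rule inj_onI)
      fix p p' assume p: "p \<in> ball p\<^sub>0 \<delta>''" "p' \<in> ball p\<^sub>0 \<delta>''" and "E p = E p'"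
      then have "c * norm (p - p') \<le> 0" using \<delta>(3)[OF subsetD[OF sub(1)] subsetD[OF sub(1)], of p p'] by auto
      then have "norm (p - p') \<le> 0" using \<delta>(2) by (simp add: mult_le_0_iff)
      then show "p = p'" by simp
    qed
    have "char_lift \<omega> \<inter> ball p\<^sub>0 \<delta>'' = {}" using sub \<delta>' by blast
    then show "emeasure lebesgue (char_lift \<omega> \<inter> ball p\<^sub>0 \<delta>'') = 0" by simp
    fix S \<rho> assume S: "S \<subseteq> ball p\<^sub>0 \<delta>''" "\<forall>p\<in>S. \<forall>p'\<in>S. norm (E p - E p') \<le> \<rho>" and \<rho>: "0 < \<rho>" "\<rho> \<le> 1"
    show "emeasure lebesgue S \<le> ennreal (4 / c\<^sup>2 * \<rho> powr d)"
    proof (cases "S = {}")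
      case False
      then obtain p' where p': "p' \<in> S" by blast
      have "emeasure lebesgue S \<le> ennreal (4 * (\<rho> / c)\<^sup>2)"
      proof (rule emeasure_square_le)
        show "S \<subseteq> {p. norm (p - p') \<le> \<rho> / c}"
        proof
          fix p assume p: "p \<in> S"
          have "c * norm (p - p') \<le> norm (E p - E p')" using \<delta>(3) S(1) sub p p' by blast
          also have "\<dots> \<le> \<rho>" using S p p' by blast
          finally show "p \<in> {p. norm (p - p') \<le> \<rho> / c}" using \<delta>(2) by (simp add: field_simps)
        qed
      qed (use \<rho> \<delta> in auto)
      also have "\<dots> \<le> ennreal (4 / c\<^sup>2 * \<rho> powr d)"
      proof (rule ennreal_leI)
        have "\<rho>\<^sup>2 = \<rho> powr 2" using \<rho> by simp
        also have "\<dots> \<le> \<rho> powr d" using \<rho> d_bounds by (intro powr_mono') auto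
        finally have "4 / c\<^sup>2 * \<rho>\<^sup>2 \<le> 4 / c\<^sup>2 * \<rho> powr d" by (intro mult_left_mono) auto
        then show "4 * (\<rho> / c)\<^sup>2 \<le> 4 / c\<^sup>2 * \<rho> powr d" by (simp add: power_divide)
      qed
      finally show ?thesis .
    qed simp
  qed auto
next
  case True
  obtain \<sigma> U s t h where \<sigma>: "0 < \<sigma>" "\<sigma> \<le> \<sigma>max" and U: "p\<^sub>0 \<in> U" "C1_coords U s t"
    and h: "\<And>p. p \<in> U \<Longrightarrow> h p \<noteq> 0"
    and form: "\<And>p v. p \<in> U \<Longrightarrow> \<omega> p v = h p * (of_real (frechet_derivative s (at p) v)
         + \<i> * of_real (\<bar>t p\<bar> powr \<sigma>) * of_real (frechet_derivative t (at p) v))"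
    using normal[OF True] by metis
  have sd: "s differentiable (at p)" and td: "t differentiable (at p)"
    and det: "pd_x s p * pd_y t p - pd_y s p * pd_x t p \<noteq> 0" if "p \<in> U" for p
    using U(2) that by (auto simp: C1_coords_def wedge_def pd_x_def pd_y_def)
  \<comment> \<open>Up to non-zero factors, one of them the Jacobian of the chart, the wedge
    coefficient is \<open>\<bar>t p\<bar> powr \<sigma>\<close>.\<close>
  have t0: "t p = 0" if p: "p \<in> U" "p \<in> char_lift \<omega>" for p
  proof -
    let ?k = "complex_of_real (\<bar>t p\<bar> powr \<sigma>)"
    have ab: "a p = h p * (of_real (pd_x s p) + \<i> * ?k * of_real (pd_x t p))"
      "b p = h p * (of_real (pd_y s p) + \<i> * ?k * of_real (pd_y t p))"
      using form[OF p(1), of "(1, 0)"] form[OF p(1), of "(0, 1)"] by (simp_all add: one_form_def pd_x_def pd_y_def)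
    have "0 = wedge_cnj \<omega> p" using p by (simp add: char_lift_def)
    also have "\<dots> = h p * cnj (h p) * (- 2 * \<i> * ?k * of_real (pd_x s p * pd_y t p - pd_y s p * pd_x t p))"
      unfolding wedge_cnj_eq ab by (simp add: algebra_simps)
    finally have "?k * of_real (pd_x s p * pd_y t p - pd_y s p * pd_x t p) = 0" using h[OF p(1)] by simp
    then have "?k = 0" using det[OF p(1)] unfolding mult_eq_0_iff of_real_eq_0_iff by blast
    then show ?thesis by simp
  qed
  obtain \<delta> c C where \<delta>: "0 < \<delta>" "ball p\<^sub>0 \<delta> \<subseteq> U" "0 < c" "0 \<le> C"
    "\<And>p p'. p \<in> ball p\<^sub>0 \<delta> \<Longrightarrow> p' \<in> ball p\<^sub>0 \<delta> \<Longrightarrow> norm (p - p') \<le> C * max \<bar>s p - s p'\<bar> \<bar>t p - t p'\<bar>"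
    "\<And>p p'. p \<in> ball p\<^sub>0 \<delta> \<Longrightarrow> p' \<in> ball p\<^sub>0 \<delta> \<Longrightarrow> \<bar>s p - s p'\<bar> \<le> C"
    "\<And>p p'. p \<in> ball p\<^sub>0 \<delta> \<Longrightarrow> p' \<in> ball p\<^sub>0 \<delta> \<Longrightarrow> c * \<bar>s p - s p'\<bar> \<le> norm (E p - E p')"
    "\<And>p p'. p \<in> ball p\<^sub>0 \<delta> \<Longrightarrow> p' \<in> ball p\<^sub>0 \<delta> \<Longrightarrow> c * \<bar>odd_power \<sigma> (t p) - odd_power \<sigma> (t p')\<bar> \<le> norm (E p - E p')"
  proof (rule normal_form_lower_bound[OF U(2,1) \<sigma>(1) E_has_derivative, of "\<lambda>p. 2 * pi * \<i> * E p * h p"])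
    show "isCont (\<lambda>p. 2 * pi * \<i> * E p * a p) p\<^sub>0" "isCont (\<lambda>p. 2 * pi * \<i> * E p * b p) p\<^sub>0"
      by (intro continuous_intros isCont_E isCont_ab)+
    show "2 * pi * \<i> * E p\<^sub>0 * h p\<^sub>0 \<noteq> 0" using h[OF U(1)] by simp
    fix p v assume "p \<in> U"
    have "fst v *\<^sub>R (2 * pi * \<i> * E p * a p) + snd v *\<^sub>R (2 * pi * \<i> * E p * b p) = 2 * pi * \<i> * E p * \<omega> p v"
      by (simp add: one_form_scaleR scaleR_conv_of_real algebra_simps)
    then show "fst v *\<^sub>R (2 * pi * \<i> * E p * a p) + snd v *\<^sub>R (2 * pi * \<i> * E p * b p)
      = 2 * pi * \<i> * E p * h p * (of_real (frechet_derivative s (at p) v)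
         + \<i> * of_real (\<bar>t p\<bar> powr \<sigma>) * of_real (frechet_derivative t (at p) v))"
      unfolding form[OF \<open>p \<in> U\<close>] by (simp add: mult.assoc)
  qed blast
  have dt: "(\<bar>t p - t p'\<bar> / 2) powr (\<sigma> + 1) \<le> (\<sigma> + 1) / c * norm (E p - E p')"
    if "p \<in> ball p\<^sub>0 \<delta>" "p' \<in> ball p\<^sub>0 \<delta>" for p p'
  proof -
    have "c * ((\<bar>t p - t p'\<bar> / 2) powr (\<sigma> + 1) / (\<sigma> + 1)) \<le> norm (E p - E p')"
      using odd_power_expanding[OF \<sigma>(1), of "t p" "t p'"] \<delta>(8)[OF that] \<delta>(3) by (meson less_imp_le mult_left_mono order_trans)
    then show ?thesis using \<delta>(3) \<sigma>(1) by (simp add: field_simps)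
  qed
  \<comment> \<open>The second entry inverts the expansion of \<open>odd_power\<close>; the first
    ensures that the strip is at least as long as it is thick.\<close>
  define M where "M = max (1 / c) (2 * ((\<sigma> + 1) / c) powr (1 / (\<sigma> + 1)))"
  have M: "0 < M" using \<delta>(3) by (simp add: M_def less_max_iff_disj)
  show ?thesis
  proof (rule exI[of _ \<delta>], rule exI[of _ "16 * C\<^sup>2 * (1 / c) * M"], intro conjI allI impI)
    show "0 < \<delta>" by fact
    show "0 \<le> 16 * C\<^sup>2 * (1 / c) * M" using M \<delta> by simp
    show "inj_on E (ball p\<^sub>0 \<delta>)"
    proof (rule inj_onI)
      fix p p' assume p: "p \<in> ball p\<^sub>0 \<delta>" "p' \<in> ball p\<^sub>0 \<delta>" and eq: "E p = E p'"
      have "c * \<bar>s p - s p'\<bar> \<le> 0" "(\<bar>t p - t p'\<bar> / 2) powr (\<sigma> + 1) \<le> 0"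
        using \<delta>(7)[OF p] dt[OF p] eq by auto
      then have "\<bar>s p - s p'\<bar> = 0" "\<bar>t p - t p'\<bar> = 0" using \<delta>(3) by (auto simp: mult_le_0_iff)
      then have "norm (p - p') \<le> 0" using \<delta>(5)[OF p] by simp
      then show "p = p'" by simp
    qed
    show "emeasure lebesgue (char_lift \<omega> \<inter> ball p\<^sub>0 \<delta>) = 0"
    proof -
      let ?S = "char_lift \<omega> \<inter> ball p\<^sub>0 \<delta>"
      have bound: "emeasure lebesgue ?S \<le> ennreal (16 * C\<^sup>2 * \<rho> * (C + 1))" if "0 < \<rho>" "\<rho> < 1" for \<rho>
      \<comment> \<open>The roles of \<open>s\<close> and \<open>t\<close> are exchanged:
        \<open>t\<close> vanishes on the characteristic set, so every thickness \<rho> is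
        admissible, and \<open>C + 1\<close> exceeds any \<rho> below 1.\<close>
      proof (rule emeasure_strip_le[of ?S C t s \<rho> "C + 1"])
        fix p p' assume p: "p \<in> ?S" "p' \<in> ?S"
        show "norm (p - p') \<le> C * max \<bar>t p - t p'\<bar> \<bar>s p - s p'\<bar>" using \<delta>(5)[of p p'] p by (simp add: max.commute)
        show "\<bar>t p - t p'\<bar> \<le> \<rho>" using t0[of p] t0[of p'] p subsetD[OF \<delta>(2)] that by simp
        show "\<bar>s p - s p'\<bar> \<le> C + 1" using \<delta>(6)[of p p'] p by simp
      qed (use that \<delta> in auto)
      have "((\<lambda>\<rho>. ennreal (16 * C\<^sup>2 * \<rho> * (C + 1))) \<longlongrightarrow> ennreal (16 * C\<^sup>2 * 0 * (C + 1))) (at_right 0)"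
        by (intro tendsto_ennrealI tendsto_intros)
      then have "emeasure lebesgue ?S \<le> ennreal (16 * C\<^sup>2 * 0 * (C + 1))"
      proof (rule tendsto_lowerbound)
        show "\<forall>\<^sub>F \<rho> in at_right 0. emeasure lebesgue ?S \<le> ennreal (16 * C\<^sup>2 * \<rho> * (C + 1))"
          unfolding eventually_at_right_field using bound by (intro exI[of _ 1]) auto
      qed simp
      then show ?thesis by simp
    qed
    fix S \<rho> assume S: "S \<subseteq> ball p\<^sub>0 \<delta>" "\<forall>p\<in>S. \<forall>p'\<in>S. norm (E p - E p') \<le> \<rho>" and \<rho>: "0 < \<rho>" "\<rho> \<le> 1"
    let ?k = "1 / (\<sigma> + 1)"
    have \<rho>k: "\<rho> \<le> \<rho> powr ?k" using \<rho> \<sigma>(1) powr_mono'[of ?k 1 \<rho>] by simp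
    have "emeasure lebesgue S \<le> ennreal (16 * C\<^sup>2 * (\<rho> / c) * (M * \<rho> powr ?k))"
    proof (rule emeasure_strip_le[of S C s t])
      fix p p' assume p: "p \<in> S" "p' \<in> S"
      then have pb: "p \<in> ball p\<^sub>0 \<delta>" "p' \<in> ball p\<^sub>0 \<delta>" and E: "norm (E p - E p') \<le> \<rho>" using S by auto
      show "norm (p - p') \<le> C * max \<bar>s p - s p'\<bar> \<bar>t p - t p'\<bar>" by (rule \<delta>(5)[OF pb])
      show "\<bar>s p - s p'\<bar> \<le> \<rho> / c" using \<delta>(7)[OF pb] E \<delta>(3) by (simp add: field_simps)
      have "(\<bar>t p - t p'\<bar> / 2) powr (\<sigma> + 1) \<le> (\<sigma> + 1) / c * \<rho>"
        using dt[OF pb] E \<delta>(3) \<sigma>(1) by (smt (verit) divide_nonneg_pos mult_left_mono)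
      then have "((\<bar>t p - t p'\<bar> / 2) powr (\<sigma> + 1)) powr ?k \<le> ((\<sigma> + 1) / c * \<rho>) powr ?k"
        using \<sigma>(1) by (intro powr_mono2) auto
      also have "((\<sigma> + 1) / c * \<rho>) powr ?k = ((\<sigma> + 1) / c) powr ?k * \<rho> powr ?k"
        by (rule powr_mult)
      finally have "\<bar>t p - t p'\<bar> / 2 \<le> ((\<sigma> + 1) / c) powr ?k * \<rho> powr ?k"
        using \<sigma>(1) by (simp add: powr_powr)
      then have "\<bar>t p - t p'\<bar> \<le> (2 * ((\<sigma> + 1) / c) powr ?k) * \<rho> powr ?k" by simp
      also have "\<dots> \<le> M * \<rho> powr ?k" unfolding M_def by (intro mult_right_mono) auto
      finally show "\<bar>t p - t p'\<bar> \<le> M * \<rho> powr ?k" .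
    next
      have "\<rho> / c = (1 / c) * \<rho>" by simp
      also have "\<dots> \<le> M * \<rho> powr ?k" using \<rho>k \<rho> \<delta>(3) M by (intro mult_mono) (auto simp: M_def)
      finally show "\<rho> / c \<le> M * \<rho> powr ?k" .
    qed (use \<rho> \<delta> in auto)
    also have "16 * C\<^sup>2 * (\<rho> / c) * (M * \<rho> powr ?k) = 16 * C\<^sup>2 * (1 / c) * M * \<rho> powr (1 + ?k)"
      using \<rho> by (simp add: powr_add)
    also have "ennreal \<dots> \<le> ennreal (16 * C\<^sup>2 * (1 / c) * M * \<rho> powr d)"
    proof (intro ennreal_leI mult_left_mono powr_mono')
      show "d \<le> 1 + ?k" unfolding d_eq using \<sigma> by (intro add_left_mono divide_left_mono) auto
    qed (use \<rho> M \<delta> in auto)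
    finally show "emeasure lebesgue S \<le> ennreal (16 * C\<^sup>2 * (1 / c) * M * \<rho> powr d)" .
  qed
qed

section \<open>Consequences of injectivity and the global growth bound\<close>

lemma inj_Z: "inj Z"
proof (rule inj_of_proper_locally_injective)
  show "\<exists>\<delta>>0. inj_on Z (ball p \<delta>)" for p
  proof -
    obtain \<delta> where "0 < \<delta>" "inj_on E (ball p \<delta>)" using local_growth by blast
    moreover from this have "inj_on Z (ball p \<delta>)" by (metis E_def inj_on_def)
    ultimately show ?thesis by blast
  qed
qed (use continuous_Z Z_proper in auto)

lemma E_eq_iff_lattice: "E p = q powi n * E p' \<longleftrightarrow> (\<exists>m::int. p = p' + (of_int m, of_int n))"
  unfolding E_eq_iff using inj_Z by (auto simp: inj_eq)

text \<open>A lattice translate of an interior point that lies in the closed square must be the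
  point itself. Only \<open>p'\<close> is kept off the boundary, so \<open>p\<close> may range over
  the sides as Stokes' theorem demands.\<close>

lemma E_eq_interior:
  assumes "p \<in> unit_square" "p' \<in> interior unit_square"
  shows "E p = q powi n * E p' \<longleftrightarrow> n = 0 \<and> p = p'"
proof
  assume "E p = q powi n * E p'"
  then obtain m :: int where m: "p = p' + (of_int m, of_int n)" using E_eq_iff_lattice by blast
  have "0 < fst p'" "fst p' < 1" "0 < snd p'" "snd p' < 1"
    using assms(2) by (auto simp: unit_square_def interior_Times mem_Times_iff)
  moreover have "0 \<le> fst p" "fst p \<le> 1" "0 \<le> snd p" "snd p \<le> 1" using assms(1) by (auto simp: unit_square_def)
  ultimately have "m = 0" "n = 0" using m by auto
  then show "n = 0 \<and> p = p'" using m by (simp add: zero_prod_def[symmetric])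
qed auto

lemma AE_noncharacteristic: "AE p in lebesgue_on unit_square. p \<in> interior unit_square \<and> p \<notin> char_lift \<omega>"
proof -
  obtain \<delta> where \<delta>: "\<And>p. 0 < \<delta> p" "\<And>p. emeasure lebesgue (char_lift \<omega> \<inter> ball p (\<delta> p)) = 0"
    using local_growth by metis
  obtain D where D: "finite D" "unit_square \<subseteq> (\<Union>p\<in>D. ball p (\<delta> p))"
    using ball_cover[OF compact_unit_square, of \<delta>] \<delta>(1) by metis
  have "char_lift \<omega> \<inter> ball p (\<delta> p) \<in> null_sets lebesgue" for p
    using closed_char_lift \<delta>(2)[of p] by (intro null_setsI) auto
  then have "(\<Union>p\<in>D. char_lift \<omega> \<inter> ball p (\<delta> p)) \<in> null_sets lebesgue"
    using D(1) by (intro null_sets_UN' countable_finite)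
  then have 1: "AE p in lebesgue. p \<notin> (\<Union>p\<in>D. char_lift \<omega> \<inter> ball p (\<delta> p))" by (rule AE_not_in)
  have "negligible (frontier unit_square)" unfolding unit_square_cbox by (intro negligible_convex_frontier convex_box)
  then have 2: "AE p in lebesgue. p \<notin> frontier unit_square" by (simp add: negligible_iff_null_sets AE_not_in)
  have "AE p in lebesgue. p \<in> unit_square \<longrightarrow> p \<in> interior unit_square \<and> p \<notin> char_lift \<omega>"
    using 1 2 by eventually_elim (use D(2) closure_subset[of unit_square] in \<open>auto simp: frontier_def\<close>)
  then show ?thesis by (subst AE_restrict_space_iff) (auto simp: unit_square_cbox)
qed

lemma emeasure_unit_square: "emeasure lebesgue unit_square = 1"
proof -
  have "emeasure lebesgue unit_square = ennreal (measure lebesgue unit_square)"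
    unfolding unit_square_cbox by (rule emeasure_eq_measure2) auto
  also have "measure lebesgue unit_square = 1" unfolding unit_square_cbox by (simp add: content_Pair)
  finally show ?thesis by simp
qed

text \<open>Points whose images lie in a disc of radius \<rho> have images at distance at most
  \<open>2 * \<rho>\<close>, so the local bound is applied with \<open>2 * \<rho>\<close>, which
  explains \<open>2 powr d\<close>; for \<open>2 * \<rho> > 1\<close> the total area 1 suffices,
  which explains the summand 1.\<close>

lemma growth:
  obtains C where "growth_measure (lebesgue_on unit_square) E C d"
proof -
  obtain \<delta> K where \<delta>: "\<And>p. 0 < \<delta> p" and K: "\<And>p. 0 \<le> K p"
    "\<And>p S \<rho>. S \<subseteq> ball p (\<delta> p) \<Longrightarrow> 0 < \<rho> \<Longrightarrow> \<rho> \<le> 1 \<Longrightarrow> (\<And>p p'. p \<in> S \<Longrightarrow> p' \<in> S \<Longrightarrow> norm (E p - E p') \<le> \<rho>) \<Longrightarrow>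
       emeasure lebesgue S \<le> ennreal (K p * \<rho> powr d)"
    using local_growth by metis
  obtain D where D: "finite D" "unit_square \<subseteq> (\<Union>p\<in>D. ball p (\<delta> p))"
    using ball_cover[OF compact_unit_square, of \<delta>] \<delta> by metis
  let ?C = "(1 + (\<Sum>p\<in>D. K p)) * 2 powr d"
  have K0: "0 \<le> (\<Sum>p\<in>D. K p)" using K(1) by (intro sum_nonneg) auto
  have sq [simp]: "unit_square \<in> sets lebesgue" by (simp add: unit_square_cbox)
  interpret finite_measure "lebesgue_on unit_square"
    by (rule finite_measureI) (simp add: emeasure_restrict_space emeasure_unit_square)
  have "growth_measure (lebesgue_on unit_square) E ?C d"
  proof
    show "E \<in> borel_measurable (lebesgue_on unit_square)"
      by (intro continuous_imp_measurable_on_sets_lebesgue continuous_E sq)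
    show "0 \<le> ?C" "0 < d" using K0 d_bounds by auto
    fix w :: complex and \<rho> :: real assume \<rho>: "0 < \<rho>"
    define S where "S = {p \<in> unit_square. norm (E p - w) < \<rho>}"
    have "S = unit_square \<inter> {p. norm (E p - w) < \<rho>}" by (auto simp: S_def)
    moreover have "open {p. norm (E p - w) < \<rho>}" by (intro open_Collect_less continuous_intros continuous_E)
    ultimately have Sm [measurable]: "S \<in> sets lebesgue" using sq by auto
    have "emeasure (lebesgue_on unit_square) {p \<in> space (lebesgue_on unit_square). norm (E p - w) < \<rho>} = emeasure lebesgue S"
      by (subst emeasure_restrict_space) (auto simp: S_def)
    also have "\<dots> \<le> ennreal (?C * \<rho> powr d)"
    proof (cases "2 * \<rho> \<le> 1")
      case True
      have "emeasure lebesgue S \<le> emeasure lebesgue (\<Union>p\<in>D. S \<inter> ball p (\<delta> p))"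
      proof (intro emeasure_mono sets.finite_UN D)
        have "S \<subseteq> unit_square" by (auto simp: S_def)
        then show "S \<subseteq> (\<Union>p\<in>D. S \<inter> ball p (\<delta> p))" using D by blast
      qed auto
      also have "\<dots> \<le> (\<Sum>p\<in>D. emeasure lebesgue (S \<inter> ball p (\<delta> p)))"
        using D by (intro emeasure_subadditive_finite) auto
      also have "\<dots> \<le> (\<Sum>p\<in>D. ennreal (K p * (2 * \<rho>) powr d))"
      proof (intro sum_mono K(2))
        fix p p1 p2 assume "p1 \<in> S \<inter> ball p (\<delta> p)" "p2 \<in> S \<inter> ball p (\<delta> p)"
        then show "norm (E p1 - E p2) \<le> 2 * \<rho>"
          using norm_triangle_ineq4[of "E p1 - w" "E p2 - w"] by (auto simp: S_def)
      qed (use True \<rho> in auto)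
      also have "\<dots> = ennreal ((\<Sum>p\<in>D. K p) * 2 powr d * \<rho> powr d)"
        using K(1) \<rho> by (simp add: sum_ennreal powr_mult sum_distrib_right mult.assoc)
      also have "\<dots> \<le> ennreal (?C * \<rho> powr d)" by (intro ennreal_leI mult_right_mono) auto
      finally show ?thesis .
    next
      case False
      have "emeasure lebesgue S \<le> emeasure lebesgue unit_square" by (intro emeasure_mono) (auto simp: S_def)
      also have "\<dots> = ennreal 1" by (simp add: emeasure_unit_square)
      also have "\<dots> \<le> ennreal (?C * \<rho> powr d)"
      proof (rule ennreal_leI)
        have "1 = 1 powr d" by simp
        also have "\<dots> \<le> (2 * \<rho>) powr d" using False d_bounds by (intro powr_mono2) auto
        also have "\<dots> = 1 * 2 powr d * \<rho> powr d" using \<rho> by (simp add: powr_mult)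
        also have "\<dots> \<le> ?C * \<rho> powr d" using K0 by (intro mult_right_mono) auto
        finally show "1 \<le> ?C * \<rho> powr d" .
      qed
      finally show ?thesis .
    qed
    finally show "emeasure (lebesgue_on unit_square) {x \<in> space (lebesgue_on unit_square). norm (E x - w) < \<rho>} \<le> ennreal (?C * \<rho> powr d)" .
  qed
  then show thesis by (rule that)
qed

text \<open>Near \<open>p'\<close> the differential is injective; the rest of the square is compact
  and \<open>E\<close> does not take the value \<open>E p'\<close> there. The bound lets a
  first-order zero at \<open>p'\<close> compensate a simple pole of the kernel.\<close>

lemma E_lower_bound_square:
  assumes "p' \<in> interior unit_square" "p' \<notin> char_lift \<omega>"
  obtains c where "0 < c" "\<And>p. p \<in> unit_square \<Longrightarrow> c * norm (p - p') \<le> norm (E p - E p')"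
proof -
  obtain \<delta> c where \<delta>: "0 < \<delta>" "0 < c"
    "\<And>p p\<^sub>1. p \<in> ball p' \<delta> \<Longrightarrow> p\<^sub>1 \<in> ball p' \<delta> \<Longrightarrow> c * norm (p - p\<^sub>1) \<le> norm (E p - E p\<^sub>1)"
    using noncharacteristic_lower_bound[OF assms(2)] by metis
  define Q where "Q = unit_square - ball p' \<delta>"
  have Q: "compact Q" unfolding Q_def by (intro compact_diff compact_unit_square open_ball)
  have pos: "0 < norm (E p - E p')" if "p \<in> Q" for p
  proof -
    have "p \<in> unit_square" "p \<noteq> p'" using that \<delta>(1) by (auto simp: Q_def)
    then show ?thesis using E_eq_interior[OF _ assms(1), of p 0] by simp
  qed
  have "\<exists>e>0. \<forall>p\<in>Q. e * norm (p - p') \<le> norm (E p - E p')"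
  proof (cases "Q = {}")
    case False
    have "continuous_on Q (\<lambda>p. norm (E p - E p'))" by (intro continuous_intros continuous_E)
    then obtain x where x: "x \<in> Q" "\<And>p. p \<in> Q \<Longrightarrow> norm (E x - E p') \<le> norm (E p - E p')"
      using continuous_attains_inf[OF Q False] by blast
    have "bounded ((\<lambda>p. p - p') ` Q)"
      using Q by (intro compact_imp_bounded compact_continuous_image continuous_intros)
    then obtain R where R: "0 < R" "\<And>p. p \<in> Q \<Longrightarrow> norm (p - p') \<le> R" by (auto simp: bounded_pos)
    show ?thesis
    proof (intro exI[of _ "norm (E x - E p') / R"] conjI ballI)
      show "0 < norm (E x - E p') / R" using pos[OF x(1)] R by simp
      fix p assume p: "p \<in> Q"
      have "norm (E x - E p') / R * norm (p - p') \<le> norm (E x - E p') / R * R"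
        using R p by (intro mult_left_mono) auto
      then show "norm (E x - E p') / R * norm (p - p') \<le> norm (E p - E p')" using x(2)[OF p] R by simp
    qed
  qed (auto intro: exI[of _ 1])
  then obtain e where e: "0 < e" "\<And>p. p \<in> Q \<Longrightarrow> e * norm (p - p') \<le> norm (E p - E p')" by blast
  show thesis
  proof (rule that[of "min c e"])
    show "0 < min c e" using \<delta> e by simp
    fix p assume p: "p \<in> unit_square"
    have "min c e * norm (p - p') \<le> c * norm (p - p')" "min c e * norm (p - p') \<le> e * norm (p - p')"
      by (intro mult_right_mono; simp)+
    moreover have "c * norm (p - p') \<le> norm (E p - E p') \<or> e * norm (p - p') \<le> norm (E p - E p')"
      using \<delta> e(2)[of p] p by (cases "p \<in> ball p' \<delta>") (auto simp: Q_def)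
    ultimately show "min c e * norm (p - p') \<le> norm (E p - E p')" by linarith
  qed
qed

end

subsection \<open>Stokes' theorem with an exceptional point\<close>

lemma unit_square_lebesgue [simp, measurable]: "unit_square \<in> sets lebesgue"
  by (simp add: unit_square_cbox)

lemma unit_square_borel [simp, measurable]: "unit_square \<in> sets borel"
  by (simp add: unit_square_cbox)

lemma set_integral_unit_square:
  fixes f :: "plane \<Rightarrow> complex"
  shows "(LINT p:unit_square|lebesgue. f p) = integral\<^sup>L (lebesgue_on unit_square) f"
  unfolding set_lebesgue_integral_def by (subst integral_restrict_space) auto

text \<open>A bridge from the Lebesgue measure of the square to \<open>lborel\<close>, the form in
  which Fubini's theorem is applied. Continuity off the puncture is enough for Borel
  measurability.\<close>

lemma punctured_square_integral:
  fixes F :: "plane \<Rightarrow> complex"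
  assumes cont: "continuous_on (unit_square - {p'}) F"
    and bound: "\<And>p. p \<in> unit_square - {p'} \<Longrightarrow> norm (F p) \<le> g p" and g: "integrable (lebesgue_on unit_square) g"
  defines "F' \<equiv> \<lambda>p. indicator (unit_square - {p'}) p *\<^sub>R F p"
  shows "integrable (lebesgue_on unit_square) (\<lambda>p. indicator (- {p'}) p *\<^sub>R F p)"
    and "integral\<^sup>L (lebesgue_on unit_square) (\<lambda>p. indicator (- {p'}) p *\<^sub>R F p) = integral\<^sup>L lborel F'"
    and "integrable lborel F'"
proof -
  have eq: "(\<lambda>p. indicator unit_square p *\<^sub>R (indicator (- {p'}) p *\<^sub>R F p)) = F'"
    by (auto simp: F'_def fun_eq_iff indicator_def)
  have m: "F' \<in> borel_measurable borel"
    unfolding F'_def using cont by (intro borel_measurable_continuous_on_indicator) auto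
  then have m': "F' \<in> borel_measurable lebesgue" by (auto intro: measurable_completion)
  have "integrable lebesgue (\<lambda>p. indicator unit_square p *\<^sub>R g p)"
    using g by (subst (asm) integrable_restrict_space) auto
  then have "integrable lebesgue F'"
  proof (rule Bochner_Integration.integrable_bound[OF _ m'], intro AE_I2)
    fix p
    show "norm (F' p) \<le> norm (indicator unit_square p *\<^sub>R g p)"
      using bound[of p] by (auto simp: F'_def indicator_def)
  qed
  then show "integrable (lebesgue_on unit_square) (\<lambda>p. indicator (- {p'}) p *\<^sub>R F p)" "integrable lborel F'"
    using m by (simp_all add: integrable_restrict_space eq integrable_completion del: scaleR_scaleR)
  show "integral\<^sup>L (lebesgue_on unit_square) (\<lambda>p. indicator (- {p'}) p *\<^sub>R F p) = integral\<^sup>L lborel F'"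
    using m by (simp add: integral_restrict_space eq integral_completion del: scaleR_scaleR)
qed

text \<open>The fundamental theorem of calculus holds on every horizontal or vertical line missing
  \<open>p'\<close>, and the one line through it is null for Fubini. Nothing is prescribed at
  \<open>p'\<close> beyond an integrable majorant. On the boundary, continuity is asked only of
  differences between opposite sides, since those are what can be computed.\<close>

lemma integral_partial_derivative:
  fixes A A\<^sub>2 B B\<^sub>1 :: "plane \<Rightarrow> complex"
  assumes cont: "continuous_on (unit_square - {p'}) A\<^sub>2" "continuous_on (unit_square - {p'}) B\<^sub>1"
    and bound: "\<And>p. p \<in> unit_square - {p'} \<Longrightarrow> norm (A\<^sub>2 p) \<le> g p" "\<And>p. p \<in> unit_square - {p'} \<Longrightarrow> norm (B\<^sub>1 p) \<le> g p"
    and g: "integrable (lebesgue_on unit_square) g"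
    and A: "\<And>x y. (x, y) \<in> unit_square - {p'} \<Longrightarrow> ((\<lambda>y. A (x, y)) has_vector_derivative A\<^sub>2 (x, y)) (at y)"
    and B: "\<And>x y. (x, y) \<in> unit_square - {p'} \<Longrightarrow> ((\<lambda>x. B (x, y)) has_vector_derivative B\<^sub>1 (x, y)) (at x)"
    and boundary: "continuous_on {0..1} (\<lambda>y. B (1, y) - B (0, y))" "continuous_on {0..1} (\<lambda>x. A (x, 1) - A (x, 0))"
  shows "integral\<^sup>L (lebesgue_on unit_square) (\<lambda>p. indicator (- {p'}) p *\<^sub>R (B\<^sub>1 p - A\<^sub>2 p))
    = (\<integral>y. indicator {0..1} y *\<^sub>R (B (1, y) - B (0, y)) \<partial>lborel)
      - (\<integral>x. indicator {0..1} x *\<^sub>R (A (x, 1) - A (x, 0)) \<partial>lborel)"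
proof -
  note a = punctured_square_integral[OF cont(1) bound(1) g]
  note b = punctured_square_integral[OF cont(2) bound(2) g]
  obtain x' y' where p': "p' = (x', y')" by (cases p')
  define A' where "A' p = indicator (unit_square - {p'}) p *\<^sub>R A\<^sub>2 p" for p
  define B' where "B' p = indicator (unit_square - {p'}) p *\<^sub>R B\<^sub>1 p" for p
  have eta: "(\<lambda>(x, y). A' (x, y)) = A'" "(\<lambda>(x, y). B' (x, y)) = B'" by auto
  have A': "integrable (lborel \<Otimes>\<^sub>M lborel) (\<lambda>(x, y). A' (x, y))"
    unfolding lborel_prod eta unfolding A'_def[abs_def] by (rule a(3))
  have B': "integrable (lborel \<Otimes>\<^sub>M lborel) (\<lambda>(x, y). B' (x, y))"
    unfolding lborel_prod eta unfolding B'_def[abs_def] by (rule b(3))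
  have Bin: "(\<integral>x. B' (x, y) \<partial>lborel) = indicator {0..1} y *\<^sub>R (B (1, y) - B (0, y))" if "y \<noteq> y'" for y
  proof (cases "y \<in> {0..1}")
    case True
    have "B' (x, y) = indicator {0..1} x *\<^sub>R B\<^sub>1 (x, y)" for x
      using True that by (simp add: B'_def p' unit_square_def indicator_def)
    then have "(\<integral>x. B' (x, y) \<partial>lborel) = (\<integral>x. indicator {0..1} x *\<^sub>R B\<^sub>1 (x, y) \<partial>lborel)" by simp
    also have "\<dots> = B (1, y) - B (0, y)"
    proof (rule integral_FTC_atLeastAtMost[where F = "\<lambda>x. B (x, y)"])
      show "((\<lambda>x. B (x, y)) has_vector_derivative B\<^sub>1 (x, y)) (at x within {0..1})" if "0 \<le> x" "x \<le> 1" for x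
        using that True \<open>y \<noteq> y'\<close> by (intro has_vector_derivative_at_within[OF B]) (auto simp: unit_square_def p')
      show "continuous_on {0..1} (\<lambda>x. B\<^sub>1 (x, y))"
        using True \<open>y \<noteq> y'\<close> by (intro continuous_on_compose2[OF cont(2)] continuous_intros) (auto simp: unit_square_def p')
    qed simp
    finally show ?thesis using True by simp
  next
    case False
    then have "(\<lambda>x. B' (x, y)) = (\<lambda>x. 0)" by (auto simp: B'_def unit_square_def indicator_def)
    then show ?thesis using False by simp
  qed
  have Ain: "(\<integral>y. A' (x, y) \<partial>lborel) = indicator {0..1} x *\<^sub>R (A (x, 1) - A (x, 0))" if "x \<noteq> x'" for x
  proof (cases "x \<in> {0..1}")
    case True
    have "A' (x, y) = indicator {0..1} y *\<^sub>R A\<^sub>2 (x, y)" for y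
      using True that by (simp add: A'_def p' unit_square_def indicator_def)
    then have "(\<integral>y. A' (x, y) \<partial>lborel) = (\<integral>y. indicator {0..1} y *\<^sub>R A\<^sub>2 (x, y) \<partial>lborel)" by simp
    also have "\<dots> = A (x, 1) - A (x, 0)"
    proof (rule integral_FTC_atLeastAtMost[where F = "\<lambda>y. A (x, y)"])
      show "((\<lambda>y. A (x, y)) has_vector_derivative A\<^sub>2 (x, y)) (at y within {0..1})" if "0 \<le> y" "y \<le> 1" for y
        using that True \<open>x \<noteq> x'\<close> by (intro has_vector_derivative_at_within[OF A]) (auto simp: unit_square_def p')
      show "continuous_on {0..1} (\<lambda>y. A\<^sub>2 (x, y))"
        using True \<open>x \<noteq> x'\<close> by (intro continuous_on_compose2[OF cont(1)] continuous_intros) (auto simp: unit_square_def p')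
    qed simp
    finally show ?thesis using True by simp
  next
    case False
    then have "(\<lambda>y. A' (x, y)) = (\<lambda>y. 0)" by (auto simp: A'_def unit_square_def indicator_def)
    then show ?thesis using False by simp
  qed
  have "integral\<^sup>L lborel B' = (\<integral>y. (\<integral>x. B' (x, y) \<partial>lborel) \<partial>lborel)"
    using lborel_pair.integral_snd[OF B'] by (simp add: lborel_prod)
  also have "\<dots> = (\<integral>y. indicator {0..1} y *\<^sub>R (B (1, y) - B (0, y)) \<partial>lborel)"
  proof (rule integral_cong_AE)
    show "(\<lambda>y. \<integral>x. B' (x, y) \<partial>lborel) \<in> borel_measurable lborel"
      using lborel_pair.integrable_snd[OF B'] by (rule borel_measurable_integrable)
    show "(\<lambda>y. indicator {0..1} y *\<^sub>R (B (1, y) - B (0, y))) \<in> borel_measurable lborel"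
      using boundary(1) by (simp add: borel_measurable_continuous_on_indicator)
    show "AE y in lborel. (\<integral>x. B' (x, y) \<partial>lborel) = indicator {0..1} y *\<^sub>R (B (1, y) - B (0, y))"
      using AE_lborel_singleton[of y'] by eventually_elim (rule Bin)
  qed
  finally have 1: "integral\<^sup>L lborel B' = (\<integral>y. indicator {0..1} y *\<^sub>R (B (1, y) - B (0, y)) \<partial>lborel)" .
  have "integral\<^sup>L lborel A' = (\<integral>x. (\<integral>y. A' (x, y) \<partial>lborel) \<partial>lborel)"
    using lborel_pair.integral_fst[OF A'] by (simp add: lborel_prod)
  also have "\<dots> = (\<integral>x. indicator {0..1} x *\<^sub>R (A (x, 1) - A (x, 0)) \<partial>lborel)"
  proof (rule integral_cong_AE)
    show "(\<lambda>x. \<integral>y. A' (x, y) \<partial>lborel) \<in> borel_measurable lborel"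
      using lborel_pair.integrable_fst[OF A'] by (rule borel_measurable_integrable)
    show "(\<lambda>x. indicator {0..1} x *\<^sub>R (A (x, 1) - A (x, 0))) \<in> borel_measurable lborel"
      using boundary(2) by (simp add: borel_measurable_continuous_on_indicator)
    show "AE x in lborel. (\<integral>y. A' (x, y) \<partial>lborel) = indicator {0..1} x *\<^sub>R (A (x, 1) - A (x, 0))"
      using AE_lborel_singleton[of x'] by eventually_elim (rule Ain)
  qed
  finally have 2: "integral\<^sup>L lborel A' = (\<integral>x. indicator {0..1} x *\<^sub>R (A (x, 1) - A (x, 0)) \<partial>lborel)" .
  have "integral\<^sup>L (lebesgue_on unit_square) (\<lambda>p. indicator (- {p'}) p *\<^sub>R (B\<^sub>1 p - A\<^sub>2 p))
    = integral\<^sup>L lborel B' - integral\<^sup>L lborel A'"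
    unfolding scaleR_right_diff_distrib
    by (subst Bochner_Integration.integral_diff) (use a b in \<open>auto simp: A'_def[abs_def] B'_def[abs_def]\<close>)
  then show ?thesis by (simp only: 1 2)
qed

section \<open>Integrability and boundary data for the kernel\<close>

context normal_torus_form
begin

lemma integrable_inverse_E: "integrable (lebesgue_on unit_square) (\<lambda>p. 1 / norm (E p - w))"
proof -
  obtain C where "growth_measure (lebesgue_on unit_square) E C d" by (rule growth)
  then interpret growth_measure "lebesgue_on unit_square" E C d .
  \<comment> \<open>Any exponent strictly between 1 and \<open>d\<close> would serve; the estimate
    is applied to the constant function 1.\<close>
  define r where "r = (1 + d) / 2"
  have r: "1 < r" "r < d" using d_bounds by (auto simp: r_def)
  have "1 < r / (r - 1)" "1 / (r / (r - 1)) + 1 / r = 1" using r by (auto simp: field_simps)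
  from integrable_Cauchy_kernel[OF this(1) r(1) this(2) r(2), of "\<lambda>_. 1"]
  show ?thesis by auto
qed

lemma E_quotient_mem_kernel_dom:
  assumes "p \<in> unit_square" "p' \<in> interior unit_square"
  shows "E p / E p' \<in> kernel_dom q"
proof -
  have 1: "E p \<noteq> q ^ Suc n * E p'" for n
    using E_eq_interior[OF assms, of "int (Suc n)"] by (simp only: power_int_of_nat) simp
  have 2: "E p * q ^ Suc n \<noteq> E p'" for n
  proof
    assume "E p * q ^ Suc n = E p'"
    then have "E p = q powi (- int (Suc n)) * E p'"
      using q_nome[THEN nome.q_nz] by (simp add: power_int_minus field_simps del: of_nat_Suc power_Suc)
    then show False using E_eq_interior[OF assms, of "- int (Suc n)"] by simp
  qed
  show ?thesis using 1 2 by (auto simp: kernel_dom_def field_simps simp del: power_Suc)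
qed

text \<open>The period of the form along the bottom side, by the normalization. It is what gives
  \<open>\<phi> p'\<close> the coefficient 1 in the kernel identity.\<close>

lemma integral_bottom_side: "(\<integral>x. indicator {0..1} x *\<^sub>R a (x, 0) \<partial>lborel) = 1"
proof -
  have "(\<integral>x. indicator {0..1} x *\<^sub>R a (x, 0) \<partial>lborel) = Z (1, 0) - Z (0, 0)"
  proof (rule integral_FTC_atLeastAtMost[where F = "\<lambda>x. Z (x, 0)"])
    fix x :: real
    have "((\<lambda>x. (x, 0)) has_derivative (\<lambda>h. (h, 0))) (at x)" by (auto intro!: derivative_eq_intros)
    from diff_chain_at[OF this primitive_has_derivative]
    have "((\<lambda>x. Z (x, 0)) has_vector_derivative a (x, 0)) (at x)"
      by (simp add: o_def has_vector_derivative_def)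
    then show "((\<lambda>x. Z (x, 0)) has_vector_derivative a (x, 0)) (at x within {0..1})"
      by (rule has_vector_derivative_at_within)
  next
    show "continuous_on {0..1} (\<lambda>x. a (x, 0))"
      by (intro continuous_on_compose2[OF continuous_ab(1)[of UNIV]] continuous_intros) auto
  qed simp
  also have "\<dots> = 1" using normalization(1)[of "(0, 0)"] by simp
  finally show ?thesis .
qed

end

text \<open>One constant for a whole finite family, so that products of many coefficients can be
  estimated without separate bounds.\<close>

lemma uniform_bound_on_compact:
  fixes F :: "('a::topological_space \<Rightarrow> 'b::real_normed_vector) set"
  assumes "finite F" "compact S" "\<And>f. f \<in> F \<Longrightarrow> continuous_on S f"
  obtains H where "0 \<le> H" "\<And>f p. f \<in> F \<Longrightarrow> p \<in> S \<Longrightarrow> norm (f p) \<le> H"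
proof -
  have "\<exists>C. 0 \<le> C \<and> (\<forall>p\<in>S. norm (f p) \<le> C)" if f: "f \<in> F" for f
  proof -
    have "bounded (f ` S)" using assms f by (intro compact_imp_bounded compact_continuous_image) auto
    then show ?thesis unfolding bounded_pos by (metis image_eqI less_imp_le)
  qed
  then obtain C where C: "\<And>f. f \<in> F \<Longrightarrow> 0 \<le> C f" "\<And>f p. f \<in> F \<Longrightarrow> p \<in> S \<Longrightarrow> norm (f p) \<le> C f" by metis
  show thesis
  proof (rule that[of "\<Sum>f\<in>F. C f"])
    show "0 \<le> (\<Sum>f\<in>F. C f)" using C by (intro sum_nonneg) auto
    show "norm (f p) \<le> (\<Sum>f\<in>F. C f)" if "f \<in> F" "p \<in> S" for f p
      using C(2)[OF that] member_le_sum[of f F C] C(1) assms(1) that by force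
  qed
qed

lemma norm_diff_le_of_partials:
  fixes F :: "plane \<Rightarrow> 'b::real_normed_vector"
  assumes "convex P"
    and F: "\<And>p. (F has_derivative (\<lambda>v. fst v *\<^sub>R X p + snd v *\<^sub>R Y p)) (at p)"
    and bound: "\<And>p. p \<in> P \<Longrightarrow> norm (X p) \<le> H" "\<And>p. p \<in> P \<Longrightarrow> norm (Y p) \<le> H"
    and p: "p \<in> P" "p' \<in> P"
  shows "norm (F p - F p') \<le> 2 * H * norm (p - p')"
proof (rule differentiable_bound[where f = F and S = P])
  fix x assume x: "x \<in> P"
  show "(F has_derivative (\<lambda>v. fst v *\<^sub>R X x + snd v *\<^sub>R Y x)) (at x within P)"
    by (rule has_derivative_at_withinI[OF F])
  show "onorm (\<lambda>v. fst v *\<^sub>R X x + snd v *\<^sub>R Y x) \<le> 2 * H"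
  proof (rule onorm_le)
    fix v :: plane
    have "norm (fst v *\<^sub>R X x + snd v *\<^sub>R Y x) \<le> \<bar>fst v\<bar> * norm (X x) + \<bar>snd v\<bar> * norm (Y x)"
      by (rule norm_triangle_le) simp
    also have "\<dots> \<le> norm v * H + norm v * H"
      using norm_fst_le[of "fst v" "snd v"] norm_snd_le[of "snd v" "fst v"] bound[OF x]
      by (intro add_mono mult_mono) auto
    finally show "norm (fst v *\<^sub>R X x + snd v *\<^sub>R Y x) \<le> 2 * H * norm v" by simp
  qed
qed (use assms in auto)

lemma has_derivative_imp_partial:
  fixes A :: "plane \<Rightarrow> complex"
  assumes "(A has_derivative (\<lambda>v. fst v *\<^sub>R X + snd v *\<^sub>R Y)) (at (x, y))"
  shows "((\<lambda>x. A (x, y)) has_vector_derivative X) (at x)" "((\<lambda>y. A (x, y)) has_vector_derivative Y) (at y)"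
proof -
  have "((\<lambda>x. (x, y)) has_derivative (\<lambda>h. (h, 0))) (at x)" "((\<lambda>y. (x, y)) has_derivative (\<lambda>h. (0, h))) (at y)"
    by (auto intro!: derivative_eq_intros)
  from diff_chain_at[OF this(1) assms] diff_chain_at[OF this(2) assms]
  show "((\<lambda>x. A (x, y)) has_vector_derivative X) (at x)" "((\<lambda>y. A (x, y)) has_vector_derivative Y) (at y)"
    by (simp_all add: o_def has_vector_derivative_def)
qed

lemma has_derivative_mult_partials:
  fixes f g :: "plane \<Rightarrow> complex"
  assumes "(f has_derivative (\<lambda>v. fst v *\<^sub>R fx + snd v *\<^sub>R fy)) (at p)"
    and "(g has_derivative (\<lambda>v. fst v *\<^sub>R gx + snd v *\<^sub>R gy)) (at p)"
  shows "((\<lambda>p. f p * g p) has_derivative (\<lambda>v. fst v *\<^sub>R (fx * g p + f p * gx) + snd v *\<^sub>R (fy * g p + f p * gy))) (at p)"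
  using has_derivative_mult[OF assms] by (rule has_derivative_eq_rhs) (auto simp: algebra_simps)

lemma torus_fun_shift_x: "torus_fun g \<Longrightarrow> g (1 + x, y) = g (x, y)"
  and torus_fun_shift_y: "torus_fun g \<Longrightarrow> g (x, 1 + y) = g (x, y)"
  unfolding torus_fun_def by (metis add.commute add_Pair add_0)+

context normal_torus_form
begin

text \<open>
  Stokes' theorem is applied to \<open>(\<phi> - \<phi> p') * torus_kernel q (E / E p') * \<omega>\<close>. The first factor turns the
  pole at \<open>p'\<close> into a bounded singularity, so that neither a residue nor the orientation of \<open>E\<close>
  has to be computed; the only boundary contribution is the jump of the kernel under \<open>w \<mapsto> q * w\<close>.
\<close>

lemma kernel_identity:
  assumes \<phi>: "torus_fun \<phi>" "Ck_on 1 UNIV \<phi>" and p': "p' \<in> interior unit_square" "p' \<notin> char_lift \<omega>"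
  shows "(\<integral>p. torus_kernel q (E p / E p') * L_op a b \<phi> p \<partial>lebesgue_on unit_square)
    = (\<integral>x. indicator {0..1} x *\<^sub>R (\<phi> (x, 0) * a (x, 0)) \<partial>lborel) - \<phi> p'"
proof -
  let ?Q = "unit_square" and ?M = "lebesgue_on unit_square"
  define Q' where "Q' = unit_square - {p'}"
  define w where "w p = E p / E p'" for p
  define G where "G = kernel_reg q"
  define \<kappa> where "\<kappa> p = torus_kernel q (w p)" for p
  define \<kappa>' where "\<kappa>' p = - 1 / (w p - 1)\<^sup>2 + deriv G (w p)" for p
  define wx where "wx p = 2 * pi * \<i> * w p * a p" for p
  define wy where "wy p = 2 * pi * \<i> * w p * b p" for p
  interpret nome q by (rule q_nome)

  have p'Q: "p' \<in> ?Q" using p'(1) interior_subset by blast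
  have \<phi>d: "\<phi> differentiable (at p)" and \<phi>c: "continuous_on UNIV (pd_x \<phi>)" "continuous_on UNIV (pd_y \<phi>)" for p
    using \<phi>(2) unfolding One_nat_def Ck_on.simps by blast+
  have \<phi>_cont: "continuous_on S \<phi>" for S
    using \<phi>d by (auto intro!: continuous_at_imp_continuous_on differentiable_imp_continuous_within)
  have w_dom: "w p \<in> kernel_dom q" if "p \<in> ?Q" for p
    unfolding w_def by (rule E_quotient_mem_kernel_dom[OF that p'(1)])
  have w1: "w p \<noteq> 1" if "p \<in> Q'" for p
    using E_eq_interior[OF _ p'(1), of p 0] that by (auto simp: w_def Q'_def)
  have w_cont: "continuous_on S w" for S
    unfolding w_def by (intro continuous_intros continuous_E) auto
  have w_deriv: "(w has_derivative (\<lambda>v. fst v *\<^sub>R wx p + snd v *\<^sub>R wy p)) (at p)" for p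
    unfolding w_def[abs_def] divide_inverse
    by (rule has_derivative_eq_rhs[OF has_derivative_mult_left[OF E_has_derivative]])
      (auto simp: wx_def wy_def w_def divide_inverse algebra_simps)
  have G_hol: "G holomorphic_on kernel_dom q" unfolding G_def by (rule kernel_reg_holomorphic)
  have \<kappa>_eq: "\<kappa> p = 1 / (w p - 1) + G (w p)" for p by (simp add: \<kappa>_def torus_kernel_def G_def)
  have \<kappa>_deriv: "(\<kappa> has_derivative (\<lambda>v. fst v *\<^sub>R (\<kappa>' p * wx p) + snd v *\<^sub>R (\<kappa>' p * wy p))) (at p)" if p: "p \<in> Q'" for p
  proof -
    have pQ: "p \<in> ?Q" using p by (simp add: Q'_def)
    have "((\<lambda>z. 1 / (z - 1)) has_field_derivative - 1 / (w p - 1)\<^sup>2) (at (w p))"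
      using w1[OF p] by (auto intro!: derivative_eq_intros simp: power2_eq_square)
    then have "((\<lambda>z. 1 / (z - 1) + G z) has_field_derivative \<kappa>' p) (at (w p))"
      unfolding \<kappa>'_def by (intro DERIV_add holomorphic_derivI[OF G_hol open_kernel_dom w_dom[OF pQ]])
    then have "((\<lambda>z. 1 / (z - 1) + G z) has_derivative (*) (\<kappa>' p)) (at (w p))" by (simp add: has_field_derivative_def)
    from diff_chain_at[OF w_deriv this] show ?thesis
      unfolding \<kappa>_eq[abs_def] by (simp add: o_def algebra_simps)
  qed
  have reg_cont: "continuous_on ?Q (\<lambda>p. G (w p))" "continuous_on ?Q (\<lambda>p. deriv G (w p))"
    using w_dom by (auto intro!: continuous_on_compose2[OF holomorphic_on_imp_continuous_on[OF G_hol]]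
      continuous_on_compose2[OF holomorphic_on_imp_continuous_on[OF holomorphic_deriv[OF G_hol open_kernel_dom]]] w_cont)
  have \<kappa>_cont: "continuous_on Q' \<kappa>" "continuous_on Q' \<kappa>'"
    unfolding \<kappa>_eq[abs_def] \<kappa>'_def using w1
    by (auto intro!: continuous_intros w_cont continuous_on_subset[OF reg_cont(1)] continuous_on_subset[OF reg_cont(2)] simp: Q'_def)

  define \<Phi> where "\<Phi> p = \<phi> p - \<phi> p'" for p
  define \<psi> where "\<psi> p = \<Phi> p * \<kappa> p" for p
  define \<psi>x where "\<psi>x p = pd_x \<phi> p * \<kappa> p + \<Phi> p * (\<kappa>' p * wx p)" for p
  define \<psi>y where "\<psi>y p = pd_y \<phi> p * \<kappa> p + \<Phi> p * (\<kappa>' p * wy p)" for p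
  define A\<^sub>2 where "A\<^sub>2 p = pd_y a p * \<psi> p + a p * \<psi>y p" for p
  define B\<^sub>1 where "B\<^sub>1 p = pd_x b p * \<psi> p + b p * \<psi>x p" for p
  have \<Phi>_deriv: "(\<Phi> has_derivative (\<lambda>v. fst v *\<^sub>R pd_x \<phi> p + snd v *\<^sub>R pd_y \<phi> p)) (at p)" for p
    unfolding \<Phi>_def[abs_def] using has_derivative_diff[OF has_derivative_partials[OF \<phi>d] has_derivative_const] by simp
  have \<psi>_deriv: "(\<psi> has_derivative (\<lambda>v. fst v *\<^sub>R \<psi>x p + snd v *\<^sub>R \<psi>y p)) (at p)" if "p \<in> Q'" for p
    unfolding \<psi>_def[abs_def] \<psi>x_def \<psi>y_def by (rule has_derivative_mult_partials[OF \<Phi>_deriv \<kappa>_deriv[OF that]])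
  note A_deriv = has_derivative_mult_partials[OF has_derivative_partials[OF differentiable(1)] \<psi>_deriv]
  note B_deriv = has_derivative_mult_partials[OF has_derivative_partials[OF differentiable(2)] \<psi>_deriv]
  have \<Phi>_cont: "continuous_on S \<Phi>" for S unfolding \<Phi>_def by (intro continuous_intros \<phi>_cont)
  note sub = continuous_on_subset[OF _ subset_UNIV]
  have wxy_cont: "continuous_on S wx" "continuous_on S wy" for S
    unfolding wx_def wy_def by (intro continuous_intros w_cont continuous_ab)+
  have AB_cont: "continuous_on Q' A\<^sub>2" "continuous_on Q' B\<^sub>1"
    unfolding A\<^sub>2_def B\<^sub>1_def \<psi>_def \<psi>x_def \<psi>y_def
    by (intro continuous_intros \<Phi>_cont \<kappa>_cont wxy_cont continuous_ab continuous_pd[THEN sub] \<phi>c[THEN sub])+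

  define Fs where "Fs = {a, b, pd_y a, pd_x b, pd_x \<phi>, pd_y \<phi>, wx, wy, (\<lambda>p. G (w p)), (\<lambda>p. deriv G (w p)), (\<lambda>p. w p - 1)}"
  have "continuous_on ?Q f" if "f \<in> Fs" for f
    using that continuous_ab continuous_pd[THEN sub] \<phi>c[THEN sub] wxy_cont reg_cont w_cont
    by (auto simp: Fs_def intro!: continuous_intros)
  moreover have "finite Fs" by (simp add: Fs_def)
  ultimately obtain H where H0: "0 \<le> H" and H: "\<And>f p. f \<in> Fs \<Longrightarrow> p \<in> ?Q \<Longrightarrow> norm (f p) \<le> H"
    using uniform_bound_on_compact[OF _ compact_unit_square] by metis
  obtain c where c: "0 < c" "\<And>p. p \<in> ?Q \<Longrightarrow> c * norm (p - p') \<le> norm (E p - E p')"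
    using E_lower_bound_square[OF p'] by metis
  have E'0: "0 < norm (E p')" by simp
  define C where "C = 2 * H * norm (E p') / c"
  have C0: "0 \<le> C" using H0 c by (simp add: C_def)
  \<comment> \<open>The Lipschitz bound for \<phi> and the lower bound for \<open>E\<close> combine
    to a first-order zero measured in \<open>w\<close>, which is what cancels the simple
    pole.\<close>
  have \<Phi>_le: "norm (\<Phi> p) \<le> C * norm (w p - 1)" if p: "p \<in> ?Q" for p
  proof -
    have "norm (\<phi> p - \<phi> p') \<le> 2 * H * norm (p - p')"
    proof (rule norm_diff_le_of_partials[OF _ has_derivative_partials[OF \<phi>d] _ _ p p'Q])
      show "convex ?Q" unfolding unit_square_cbox by (rule convex_box)
      show "norm (pd_x \<phi> x) \<le> H" "norm (pd_y \<phi> x) \<le> H" if "x \<in> ?Q" for x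
        using H[OF _ that] by (auto simp: Fs_def)
    qed
    also have "\<dots> \<le> 2 * H * (norm (E p - E p') / c)"
      using c(2)[OF p] c(1) H0 by (intro mult_left_mono) (auto simp: field_simps)
    also have "E p - E p' = E p' * (w p - 1)" by (simp add: w_def field_simps)
    finally show ?thesis by (simp add: \<Phi>_def C_def norm_mult)
  qed
  \<comment> \<open>\<psi> is bounded and its partials are O(1 / |w - 1|), one order better than
    \<open>\<kappa>'\<close>; a singularity of this order is integrable because
    \<open>1 < d\<close>.\<close>
  define g where "g p = H * (C + C * H * H) + H * (H * (1 / norm (w p - 1) + H) + (C / norm (w p - 1) + C * H * H) * H)" for p
  have bounds: "norm (A\<^sub>2 p) \<le> g p" "norm (B\<^sub>1 p) \<le> g p" if p: "p \<in> Q'" for p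
  proof -
    have pQ: "p \<in> ?Q" using p by (simp add: Q'_def)
    let ?n = "norm (w p - 1)"
    have n: "0 < ?n" "?n \<le> H" using w1[OF p] H[OF _ pQ, of "\<lambda>p. w p - 1"] by (auto simp: Fs_def)
    have h: "norm (G (w p)) \<le> H" "norm (deriv G (w p)) \<le> H"
      using H[OF _ pQ, of "\<lambda>p. G (w p)"] H[OF _ pQ, of "\<lambda>p. deriv G (w p)"] by (auto simp: Fs_def)
    have k: "norm (\<kappa> p) \<le> 1 / ?n + H"
      unfolding \<kappa>_eq using norm_triangle_ineq[of "1 / (w p - 1)" "G (w p)"] h by (simp add: norm_divide)
    have k': "norm (\<kappa>' p) \<le> 1 / ?n\<^sup>2 + H"
      unfolding \<kappa>'_def using norm_triangle_ineq[of "- 1 / (w p - 1)\<^sup>2" "deriv G (w p)"] h by (simp add: norm_divide norm_power)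
    have "norm (\<psi> p) \<le> (C * ?n) * (1 / ?n + H)"
      unfolding \<psi>_def norm_mult using \<Phi>_le[OF pQ] k n C0 by (intro mult_mono) auto
    also have "\<dots> = C + C * ?n * H" using n by (simp add: field_simps)
    also have "\<dots> \<le> C + C * H * H" using n H0 C0 by (intro add_left_mono mult_right_mono mult_left_mono) auto
    finally have \<psi>: "norm (\<psi> p) \<le> C + C * H * H" .
    have "norm (\<Phi> p * \<kappa>' p) \<le> (C * ?n) * (1 / ?n\<^sup>2 + H)"
      unfolding norm_mult using \<Phi>_le[OF pQ] k' n C0 by (intro mult_mono) auto
    also have "\<dots> = C / ?n + C * ?n * H" using n by (simp add: field_simps power2_eq_square)
    also have "\<dots> \<le> C / ?n + C * H * H" using n H0 C0 by (intro add_left_mono mult_right_mono mult_left_mono) auto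
    finally have \<Phi>k: "norm (\<Phi> p * \<kappa>' p) \<le> C / ?n + C * H * H" .
    have main: "norm (u * \<psi> p + v * (\<phi>z * \<kappa> p + \<Phi> p * (\<kappa>' p * wz))) \<le> g p"
      if "norm u \<le> H" "norm v \<le> H" "norm \<phi>z \<le> H" "norm wz \<le> H" for u v \<phi>z wz
    proof -
      have "norm (u * \<psi> p + v * (\<phi>z * \<kappa> p + \<Phi> p * (\<kappa>' p * wz)))
        \<le> norm u * norm (\<psi> p) + norm v * (norm \<phi>z * norm (\<kappa> p) + norm (\<Phi> p * \<kappa>' p) * norm wz)"
        unfolding mult.assoc[symmetric, of "\<Phi> p"]
        by (intro norm_triangle_le add_mono order_refl) (auto simp: norm_mult intro!: mult_left_mono norm_triangle_le)
      also have "\<dots> \<le> H * (C + C * H * H) + H * (H * (1 / ?n + H) + (C / ?n + C * H * H) * H)"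
        using that \<psi> k \<Phi>k H0 C0 n by (intro add_mono mult_mono mult_nonneg_nonneg add_nonneg_nonneg divide_nonneg_nonneg norm_ge_zero H0 C0) auto
      finally show ?thesis by (simp add: g_def)
    qed
    show "norm (A\<^sub>2 p) \<le> g p" unfolding A\<^sub>2_def \<psi>y_def by (intro main H[OF _ pQ]) (auto simp: Fs_def)
    show "norm (B\<^sub>1 p) \<le> g p" unfolding B\<^sub>1_def \<psi>x_def by (intro main H[OF _ pQ]) (auto simp: Fs_def)
  qed
  obtain Cg where "growth_measure ?M E Cg d" by (rule growth)
  then interpret growth_measure ?M E Cg d .
  have g_int: "integrable ?M g"
  proof -
    have *: "1 / norm (w p - 1) = norm (E p') * (1 / norm (E p - E p'))" for p
    proof -
      have "w p - 1 = (E p - E p') / E p'" by (simp add: w_def field_simps)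
      then show ?thesis by (simp add: norm_divide)
    qed
    have 1: "integrable ?M (\<lambda>p. 1 / norm (w p - 1))"
      unfolding * by (intro integrable_mult_right integrable_inverse_E)
    have **: "g p = (H * (C + C * H * H) + H * H * H + C * H * H * H * H) + (H * H + H * C * H) * (1 / norm (w p - 1))" for p
      by (simp add: g_def algebra_simps)
    have "integrable ?M (\<lambda>p. (H * (C + C * H * H) + H * H * H + C * H * H * H * H) + (H * H + H * C * H) * (1 / norm (w p - 1)))"
      by (rule Bochner_Integration.integrable_add[OF integrable_const integrable_mult_right[OF 1]])
    then show ?thesis by (simp only: **[symmetric])
  qed

  have \<psi>_per: "\<psi> (1, y) = \<psi> (0, y)" for y
    using torus_fun_shift_x[OF \<phi>(1), of 0 y] E_shift(1)[of "(0, y)"] by (simp add: \<psi>_def \<Phi>_def \<kappa>_def w_def)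
  have \<psi>_jump: "\<psi> (x, 1) = \<psi> (x, 0) - \<Phi> (x, 0)" if "x \<in> {0..1}" for x
  proof -
    have x0: "(x, 0) \<in> Q'" using that p'(1) by (auto simp: Q'_def unit_square_def interior_Times)
    have "w (x, 1) = q * w (x, 0)" using E_shift(2)[of "(x, 0)"] by (simp add: w_def)
    then have "\<kappa> (x, 1) = \<kappa> (x, 0) - 1"
      using kernel_quasi_periodic[OF w_dom w1[OF x0]] x0 by (simp add: \<kappa>_def Q'_def)
    moreover have "\<Phi> (x, 1) = \<Phi> (x, 0)" using torus_fun_shift_y[OF \<phi>(1), of x 0] by (simp add: \<Phi>_def)
    ultimately show ?thesis by (simp add: \<psi>_def right_diff_distrib)
  qed
  have B_bd: "b (1, y) * \<psi> (1, y) - b (0, y) * \<psi> (0, y) = 0" for y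
    using torus_fun_shift_x[OF periodic(2), of 0 y] \<psi>_per by simp
  have A_bd: "a (x, 1) * \<psi> (x, 1) - a (x, 0) * \<psi> (x, 0) = - (a (x, 0) * \<Phi> (x, 0))" if "x \<in> {0..1}" for x
    using torus_fun_shift_y[OF periodic(1), of x 0] by (simp add: \<psi>_jump[OF that] right_diff_distrib)
  have line: "continuous_on {0..1} (\<lambda>x. h (x, 0))" if "continuous_on UNIV h" for h :: "plane \<Rightarrow> complex"
    by (intro continuous_on_compose2[OF that] continuous_intros) auto
  have bd_cont: "continuous_on {0..1} (\<lambda>x. a (x, 1) * \<psi> (x, 1) - a (x, 0) * \<psi> (x, 0))"
  proof (rule continuous_on_eq)
    show "continuous_on {0..1} (\<lambda>x. - (a (x, 0) * \<Phi> (x, 0)))"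
      by (intro continuous_on_minus continuous_on_mult line continuous_ab \<Phi>_cont)
  qed (simp only: A_bd)
  have stokes: "integral\<^sup>L ?M (\<lambda>p. indicator (- {p'}) p *\<^sub>R (B\<^sub>1 p - A\<^sub>2 p))
    = (\<integral>y. indicator {0..1} y *\<^sub>R (b (1, y) * \<psi> (1, y) - b (0, y) * \<psi> (0, y)) \<partial>lborel)
      - (\<integral>x. indicator {0..1} x *\<^sub>R (a (x, 1) * \<psi> (x, 1) - a (x, 0) * \<psi> (x, 0)) \<partial>lborel)"
  proof (rule integral_partial_derivative[where A = "\<lambda>p. a p * \<psi> p" and B = "\<lambda>p. b p * \<psi> p", OF AB_cont[unfolded Q'_def] bounds[unfolded Q'_def] g_int])
    fix x y assume "(x, y) \<in> unit_square - {p'}"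
    then have xy: "(x, y) \<in> Q'" by (simp add: Q'_def)
    show "((\<lambda>y. a (x, y) * \<psi> (x, y)) has_vector_derivative A\<^sub>2 (x, y)) (at y)"
      unfolding A\<^sub>2_def by (rule has_derivative_imp_partial(2)[OF A_deriv[OF xy]])
    show "((\<lambda>x. b (x, y) * \<psi> (x, y)) has_vector_derivative B\<^sub>1 (x, y)) (at x)"
      unfolding B\<^sub>1_def by (rule has_derivative_imp_partial(1)[OF B_deriv[OF xy]])
  qed (use B_bd bd_cont in auto)
  \<comment> \<open>Terms with \<open>\<kappa>'\<close> cancel because \<open>wx\<close> and
    \<open>wy\<close> are proportional to \<open>a\<close> and \<open>b\<close>; terms with partials
    of \<open>a\<close> and \<open>b\<close> cancel because the form is closed. The identity is
    purely algebraic and hence valid at every \<open>p\<close>.\<close>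
  have lhs: "B\<^sub>1 p - A\<^sub>2 p = torus_kernel q (E p / E p') * L_op a b \<phi> p" for p
    by (simp add: A\<^sub>2_def B\<^sub>1_def \<psi>x_def \<psi>y_def wx_def wy_def L_op_def pd_swap \<kappa>_def w_def[symmetric] algebra_simps)
  have "integral\<^sup>L ?M (\<lambda>p. indicator (- {p'}) p *\<^sub>R (B\<^sub>1 p - A\<^sub>2 p)) = integral\<^sup>L ?M (\<lambda>p. torus_kernel q (E p / E p') * L_op a b \<phi> p)"
  proof (rule integral_cong_AE)
    have "L_op a b \<phi> \<in> borel_measurable ?M"
      unfolding L_op_def by (intro continuous_imp_measurable_on_sets_lebesgue continuous_intros continuous_ab \<phi>c[THEN sub]) auto
    then show m: "(\<lambda>p. torus_kernel q (E p / E p') * L_op a b \<phi> p) \<in> borel_measurable ?M" by measurable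
    have "- {p'} \<inter> unit_square \<in> sets lebesgue" by auto
    then have "(\<lambda>p. indicator (- {p'}) p :: real) \<in> borel_measurable ?M"
      by (intro borel_measurable_indicator') (auto simp: sets_restrict_space_iff Int_def)
    then show "(\<lambda>p. indicator (- {p'}) p *\<^sub>R (B\<^sub>1 p - A\<^sub>2 p)) \<in> borel_measurable ?M"
      unfolding lhs using m by measurable
    have "AE p in ?M. E p \<noteq> E p'" by (rule AE_neq)
    then show "AE p in ?M. indicator (- {p'}) p *\<^sub>R (B\<^sub>1 p - A\<^sub>2 p) = torus_kernel q (E p / E p') * L_op a b \<phi> p"
      by eventually_elim (auto simp: lhs indicator_def)
  qed
  moreover have "(\<integral>y. indicator {0..1} y *\<^sub>R (b (1, y) * \<psi> (1, y) - b (0, y) * \<psi> (0, y)) \<partial>lborel) = 0"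
    unfolding B_bd by simp
  moreover have "(\<integral>x. indicator {0..1} x *\<^sub>R (a (x, 1) * \<psi> (x, 1) - a (x, 0) * \<psi> (x, 0)) \<partial>lborel)
      = (\<integral>x. \<phi> p' * (indicator {0..1} x *\<^sub>R a (x, 0)) - indicator {0..1} x *\<^sub>R (\<phi> (x, 0) * a (x, 0)) \<partial>lborel)"
    using A_bd by (intro Bochner_Integration.integral_cong) (auto simp: indicator_def \<Phi>_def algebra_simps)
  moreover have "\<dots> = \<phi> p' * 1 - (\<integral>x. indicator {0..1} x *\<^sub>R (\<phi> (x, 0) * a (x, 0)) \<partial>lborel)"
  proof -
    have "integrable lborel (\<lambda>x. indicator {0..1} x *\<^sub>R a (x, 0))" "integrable lborel (\<lambda>x. indicator {0..1} x *\<^sub>R (\<phi> (x, 0) * a (x, 0)))"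
      using line[OF continuous_ab(1)] line[OF \<phi>_cont] by (auto intro!: borel_integrable_compact continuous_intros)
    then show ?thesis
      by (subst Bochner_Integration.integral_diff)
        (auto simp only: integral_mult_right_zero integral_bottom_side intro: integrable_mult_right)
  qed
  ultimately show ?thesis using stokes by simp
qed

end

subsection \<open>The solution\<close>

lemma Ck_on_const: "Ck_on k UNIV (\<lambda>_. c :: 'a::real_normed_vector)"
proof (induction k arbitrary: c)
  case (Suc k)
  have "pd_x (\<lambda>_. c) = (\<lambda>_. 0)" "pd_y (\<lambda>_. c) = (\<lambda>_. 0)"
    by (auto simp: pd_x_def pd_y_def frechet_derivative_const)
  then show ?case using Suc by simp
qed simp

text \<open>Testing against the constant 1, which the operator annihilates, leaves the integral of
  \<open>f\<close>.\<close>

lemma weak_solution_imp_mean_zero: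
  assumes "weak_solution a b f u"
  shows "(LINT p:unit_square|lebesgue. f p) = 0"
proof -
  have "torus_fun (\<lambda>_. 1 :: complex) \<and> smooth (\<lambda>_. 1 :: complex)"
    by (simp add: torus_fun_def smooth_def Ck_on_const)
  moreover have "L_op a b (\<lambda>_. 1) = (\<lambda>_. 0)"
    by (auto simp: L_op_def pd_x_def pd_y_def frechet_derivative_const)
  ultimately show ?thesis using assms by (force simp: weak_solution_def)
qed

section \<open>Estimates for the potential\<close>

context normal_torus_form
begin

text \<open>For fixed \<open>p\<close> the bad points \<open>p'\<close> are those where
  \<open>E p'\<close> hits one of countably many values, and each fibre of \<open>E\<close> is null.
  Here \<open>p\<close> ranges over the whole plane, as needed for points outside the unit
  square.\<close>

lemma AE_kernel_dom:
  "AE p' in lebesgue_on unit_square. E p / E p' \<in> kernel_dom q \<and> E p / E p' \<noteq> 1"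
proof -
  obtain C where "growth_measure (lebesgue_on unit_square) E C d" by (rule growth)
  then interpret growth_measure "lebesgue_on unit_square" E C d .
  have "AE p' in lebesgue_on unit_square. \<forall>n. E p' \<noteq> E p / q ^ Suc n \<and> E p' \<noteq> E p * q ^ Suc n"
    unfolding AE_all_countable by (intro allI AE_conjI AE_neq)
  moreover have "AE p' in lebesgue_on unit_square. E p' \<noteq> E p" by (rule AE_neq)
  ultimately show ?thesis
  proof eventually_elim
    case (elim p')
    have "q \<noteq> 0" by (rule nome.q_nz[OF q_nome])
    then have "E p \<noteq> q ^ Suc n * E p'" "E p * q ^ Suc n \<noteq> E p'" for n
      using elim(1)[rule_format, of n] by (auto simp: field_simps simp del: power_Suc)
    then show ?case using elim(2) by (auto simp: kernel_dom_def field_simps simp del: power_Suc)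
  qed
qed

context
  fixes f :: "plane \<Rightarrow> complex" and s r :: real
  assumes f: "Lq_torus s f" and s: "s > 2 + \<sigma>max" and r: "r = s / (s - 1)"
begin

text \<open>The integrability exponent, \<open>q\<close> in the theorem, is called \<open>s\<close>
  in this context because \<open>q\<close> is the nome. Before the mean of \<open>f\<close> is
  assumed to vanish, this function on the plane need not be periodic.\<close>

definition potential :: "plane \<Rightarrow> complex" where
  "potential p = (\<integral>p'. f p' * torus_kernel q (E p / E p') \<partial>lebesgue_on unit_square)"

lemma exponents: "1 < s" "1 < r" "1 / s + 1 / r = 1" "r < d" "d < 2 * r"
proof -
  show s1: "1 < s" using s sigma_pos by simp
  then show r1: "1 < r" and "1 / s + 1 / r = 1" by (auto simp: r field_simps)
  \<comment> \<open>This is where \<open>s > 2 + \<sigma>max\<close> is used: for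
    \<open>s > 1\<close> it is equivalent to \<open>r < d\<close>.\<close>
  have "r < (2 + \<sigma>max) / (1 + \<sigma>max)" using s sigma_pos by (simp add: r field_simps)
  also have "\<dots> = d" using sigma_pos by (simp add: d_eq field_simps)
  finally show "r < d" .
  show "d < 2 * r" using r1 d_bounds by simp
qed

lemma f_measurable [measurable]: "f \<in> borel_measurable (lebesgue_on unit_square)"
  using f by (auto simp: Lq_torus_def intro: measurable_restrict_space1)

lemma f_power_integrable: "integrable (lebesgue_on unit_square) (\<lambda>p. \<bar>norm (f p)\<bar> powr s)"
  using f by (simp add: Lq_torus_def set_integrable_def integrable_restrict_space)

lemma E_measurable [measurable]: "E \<in> borel_measurable (lebesgue_on unit_square)"
  by (intro continuous_imp_measurable_on_sets_lebesgue continuous_E) auto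

lemma f_integrable: "integrable (lebesgue_on unit_square) f"
proof -
  interpret finite_measure "lebesgue_on unit_square"
    by (rule finite_measureI) (simp add: emeasure_restrict_space emeasure_unit_square)
  have "integrable (lebesgue_on unit_square) (\<lambda>p. 1 + \<bar>norm (f p)\<bar> powr s)"
    by (rule Bochner_Integration.integrable_add[OF integrable_const f_power_integrable])
  then show ?thesis
  proof (rule Bochner_Integration.integrable_bound[OF _ f_measurable], intro AE_I2)
    fix p
    have "norm (f p) \<le> 1 + norm (f p) powr s"
    proof (cases "norm (f p) \<le> 1")
      case False
      then have "norm (f p) powr 1 \<le> norm (f p) powr s" using exponents by (intro powr_mono) auto
      then show ?thesis using False by simp
    qed (simp add: add_increasing2)
    then show "norm (f p) \<le> norm (1 + \<bar>norm (f p)\<bar> powr s)" by simp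
  qed
qed

text \<open>Once the kernel is split into simple poles in \<open>E p'\<close>, the integral is
  bounded by \<open>integrable_Cauchy_kernel\<close> and its increments by
  \<open>integral_two_poles_le\<close>. A general \<open>P\<close> is allowed because periodicity is
  deduced from these estimates at points outside the square, and the Hoelder bound needs a margin
  around it. Convexity makes \<open>E\<close> Lipschitz on \<open>P\<close>.\<close>

lemma potential_estimates:
  assumes P: "compact P" "convex P" and sub: "unit_square \<subseteq> P"
  obtains U K where
    "\<And>p. p \<in> P \<Longrightarrow> integrable (lebesgue_on unit_square) (\<lambda>p'. f p' * torus_kernel q (E p / E p'))"
    "\<And>p. p \<in> P \<Longrightarrow> (\<integral>p'. norm (f p' * torus_kernel q (E p / E p')) \<partial>lebesgue_on unit_square) \<le> U"
    "\<And>p\<^sub>0 p\<^sub>1. p\<^sub>0 \<in> P \<Longrightarrow> p\<^sub>1 \<in> P \<Longrightarrow> norm (potential p\<^sub>1 - potential p\<^sub>0) \<le> K * dist p\<^sub>0 p\<^sub>1 powr (d / r - 1)"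
proof -
  let ?M = "lebesgue_on unit_square"
  define \<alpha> where "\<alpha> = d / r - 1"
  have \<alpha>: "0 < \<alpha>" "\<alpha> < 1" using exponents by (auto simp: \<alpha>_def field_simps)
  obtain C where "growth_measure ?M E C d" by (rule growth)
  then interpret growth_measure ?M E C d .
  interpret nome q by (rule q_nome)
  have P_ne: "P \<noteq> {}" using sub by (auto simp: unit_square_def)
  have cE: "continuous_on P (\<lambda>p. norm (E p))" by (intro continuous_intros continuous_E)
  obtain p\<^sub>m where pm: "\<And>p. p \<in> P \<Longrightarrow> norm (E p\<^sub>m) \<le> norm (E p)" using continuous_attains_inf[OF P(1) P_ne cE] by blast
  obtain p\<^sub>M where pM: "\<And>p. p \<in> P \<Longrightarrow> norm (E p) \<le> norm (E p\<^sub>M)" using continuous_attains_sup[OF P(1) P_ne cE] by blast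
  \<comment> \<open>The quotients \<open>E p / E p'\<close> stay in the annulus with radii
    \<open>m / B\<close> and \<open>B / m\<close>, where the kernel bounds apply.\<close>
  define m where "m = norm (E p\<^sub>m)"
  define B where "B = norm (E p\<^sub>M)"
  have mB: "0 < m" "0 < B" "\<And>p. p \<in> P \<Longrightarrow> m \<le> norm (E p)" "\<And>p. p \<in> P \<Longrightarrow> norm (E p) \<le> B"
    using pm pM by (auto simp: m_def B_def)
  have quot: "m / B \<le> norm (E p / E p')" "norm (E p / E p') \<le> B / m" if "p \<in> P" "p' \<in> unit_square" for p p'
    unfolding norm_divide using mB(1,2) mB(3,4)[OF that(1)] mB(3,4)[of p'] that(2) sub by (auto intro!: frac_le)
  obtain F Ck where F: "finite F" "0 \<notin> F" and Ck: "0 \<le> Ck"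
    and kb: "\<And>w. w \<in> kernel_dom q \<Longrightarrow> w \<noteq> 1 \<Longrightarrow> m / B \<le> norm w \<Longrightarrow> norm w \<le> B / m \<Longrightarrow>
      norm (torus_kernel q w) \<le> Ck * (1 + (\<Sum>a\<in>F. 1 / norm (w - a)))"
    and kd: "\<And>w\<^sub>0 w\<^sub>1. w\<^sub>0 \<in> kernel_dom q \<Longrightarrow> w\<^sub>0 \<noteq> 1 \<Longrightarrow> m / B \<le> norm w\<^sub>0 \<Longrightarrow> norm w\<^sub>0 \<le> B / m \<Longrightarrow>
      w\<^sub>1 \<in> kernel_dom q \<Longrightarrow> w\<^sub>1 \<noteq> 1 \<Longrightarrow> m / B \<le> norm w\<^sub>1 \<Longrightarrow> norm w\<^sub>1 \<le> B / m \<Longrightarrow>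
      norm (torus_kernel q w\<^sub>1 - torus_kernel q w\<^sub>0) \<le> Ck * norm (w\<^sub>1 - w\<^sub>0) * (1 + (\<Sum>a\<in>F. 1 / (norm (w\<^sub>0 - a) * norm (w\<^sub>1 - a))))"
  proof (rule kernel_bounds[of "m / B" "B / m"])
    show "0 < m / B" using mB(1,2) by simp
  qed (rule that)
  let ?g = "\<lambda>p. norm (f p)"
  have gm: "?g \<in> borel_measurable ?M" by measurable
  obtain K1 where K1: "0 \<le> K1" "\<And>w. integrable ?M (\<lambda>p. ?g p / norm (E p - w))"
    "\<And>w. (\<integral>p. \<bar>?g p\<bar> / norm (E p - w) \<partial>?M) \<le> K1"
    by (rule integrable_Cauchy_kernel[OF exponents(1-4) gm f_power_integrable]) blast
  obtain K2 where K2: "0 \<le> K2"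
    "\<And>w\<^sub>0 w\<^sub>1. w\<^sub>0 \<noteq> w\<^sub>1 \<Longrightarrow> integrable ?M (\<lambda>p. \<bar>?g p\<bar> / (norm (E p - w\<^sub>0) * norm (E p - w\<^sub>1)))"
    "\<And>w\<^sub>0 w\<^sub>1. w\<^sub>0 \<noteq> w\<^sub>1 \<Longrightarrow>
    (\<integral>p. \<bar>?g p\<bar> / (norm (E p - w\<^sub>0) * norm (E p - w\<^sub>1)) \<partial>?M) \<le> K2 * norm (w\<^sub>1 - w\<^sub>0) powr (d / r - 2)"
    by (rule integral_two_poles_le[OF exponents gm f_power_integrable]) blast
  have fint: "integrable ?M ?g" using f_integrable by (rule integrable_norm)
  define I where "I = (\<integral>p. ?g p \<partial>?M)"
  have I0: "0 \<le> I" unfolding I_def by simp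
  \<comment> \<open>A pole of the kernel at \<open>a\<close> is, as a function of \<open>p'\<close>
    and up to a bounded factor, a simple pole where \<open>E p' = E p / a\<close>.\<close>
  have pole: "1 / norm (E p / E p' - a) \<le> B / norm a * (1 / norm (E p' - E p / a))"
    if "p' \<in> unit_square" "a \<in> F" for p p' a
  proof -
    have a: "a \<noteq> 0" using F that by auto
    have "E p / E p' - a = - (a / E p') * (E p' - E p / a)" using a by (simp add: field_simps)
    then have "1 / norm (E p / E p' - a) = norm (E p') / norm a * (1 / norm (E p' - E p / a))"
      by (simp add: norm_mult norm_divide)
    also have "\<dots> \<le> B / norm a * (1 / norm (E p' - E p / a))"
      using mB(4)[of p'] that sub by (intro mult_right_mono divide_right_mono) auto
    finally show ?thesis .
  qed

  let ?k = "\<lambda>p p'. torus_kernel q (E p / E p')"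
  define h where "h p p' = Ck * ?g p' + (\<Sum>a\<in>F. Ck * B / norm a * (?g p' / norm (E p' - E p / a)))" for p p'
  have h_int: "integrable ?M (h p)" for p
    unfolding h_def by (intro Bochner_Integration.integrable_add Bochner_Integration.integrable_sum integrable_mult_right fint K1)
  have h_le: "(\<integral>p'. h p p' \<partial>?M) \<le> Ck * I + (\<Sum>a\<in>F. Ck * B / norm a * K1)" for p
  proof -
    have "(\<integral>p'. h p p' \<partial>?M) = Ck * I + (\<Sum>a\<in>F. Ck * B / norm a * (\<integral>p'. ?g p' / norm (E p' - E p / a) \<partial>?M))"
      unfolding h_def I_def using fint K1(2)
      by (subst Bochner_Integration.integral_add) (auto simp del: times_divide_eq_right times_divide_eq_left)
    also have "\<dots> \<le> Ck * I + (\<Sum>a\<in>F. Ck * B / norm a * K1)"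
      using K1(3) Ck mB by (intro add_left_mono sum_mono mult_left_mono) auto
    finally show ?thesis .
  qed
  have dom: "AE p' in ?M. norm (f p' * ?k p p') \<le> h p p'" if p: "p \<in> P" for p
    using AE_kernel_dom[of p] AE_space
  proof eventually_elim
    case (elim p')
    then have p': "p' \<in> unit_square" by simp
    have "norm (?k p p') \<le> Ck * (1 + (\<Sum>a\<in>F. 1 / norm (E p / E p' - a)))"
      using elim quot[OF p p'] by (intro kb) auto
    also have "\<dots> \<le> Ck * (1 + (\<Sum>a\<in>F. B / norm a * (1 / norm (E p' - E p / a))))"
      using Ck p' by (intro mult_left_mono add_left_mono sum_mono pole)
    finally have "norm (f p' * ?k p p') \<le> ?g p' * (Ck * (1 + (\<Sum>a\<in>F. B / norm a * (1 / norm (E p' - E p / a)))))"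
      unfolding norm_mult by (intro mult_left_mono) auto
    also have "\<dots> = h p p'" by (simp add: h_def algebra_simps sum_distrib_left)
    finally show ?case .
  qed
  have km: "(\<lambda>p'. f p' * ?k p p') \<in> borel_measurable ?M" for p by measurable
  have k_int: "integrable ?M (\<lambda>p'. f p' * ?k p p')" if "p \<in> P" for p
  proof (rule Bochner_Integration.integrable_bound[OF h_int km])
    show "AE p' in ?M. norm (f p' * ?k p p') \<le> norm (h p p')"
      using dom[OF that] by eventually_elim auto
  qed
  have k_le: "(\<integral>p'. norm (f p' * ?k p p') \<partial>?M) \<le> Ck * I + (\<Sum>a\<in>F. Ck * B / norm a * K1)" if "p \<in> P" for p
    using integral_mono_AE[OF integrable_norm[OF k_int[OF that]] h_int dom[OF that]] h_le[of p] by linarith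

  obtain L where L: "0 \<le> L" "\<And>p\<^sub>0 p\<^sub>1. p\<^sub>0 \<in> P \<Longrightarrow> p\<^sub>1 \<in> P \<Longrightarrow> norm (E p\<^sub>1 - E p\<^sub>0) \<le> L * dist p\<^sub>0 p\<^sub>1"
  proof -
    define X where "X = (\<lambda>p. 2 * pi * \<i> * E p * a p)"
    define Y where "Y = (\<lambda>p. 2 * pi * \<i> * E p * b p)"
    have XY: "continuous_on P X" "continuous_on P Y"
      unfolding X_def Y_def by (intro continuous_intros continuous_E continuous_ab)+
    obtain H where H: "0 \<le> H" "\<And>g p. g \<in> {X, Y} \<Longrightarrow> p \<in> P \<Longrightarrow> norm (g p) \<le> H"
      by (rule uniform_bound_on_compact[of "{X, Y}", OF _ P(1)]) (use XY in auto)
    have "norm (E p\<^sub>1 - E p\<^sub>0) \<le> 2 * H * norm (p\<^sub>1 - p\<^sub>0)" if "p\<^sub>0 \<in> P" "p\<^sub>1 \<in> P" for p\<^sub>0 p\<^sub>1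
      by (rule norm_diff_le_of_partials[OF P(2) E_has_derivative[folded X_def Y_def]])
        (use that H(2)[of X] H(2)[of Y] in \<open>auto simp: X_def Y_def\<close>)
    then show ?thesis using H(1) by (intro that[of "2 * H"]) (auto simp: dist_norm norm_minus_commute)
  qed

  \<comment> \<open>The summand with \<open>I\<close> comes from the regular part of the kernel, the
    others from its poles; \<open>L powr \<alpha>\<close> converts distances of values of
    \<open>E\<close> into distances in the plane.\<close>
  define K where "K = Ck / m * (I * (2 * B) powr (1 - \<alpha>) + (\<Sum>a\<in>F. (B / norm a)\<^sup>2 * (K2 * norm a powr (1 - \<alpha>)))) * L powr \<alpha>"
  have holder: "norm (potential p\<^sub>1 - potential p\<^sub>0) \<le> K * dist p\<^sub>0 p\<^sub>1 powr \<alpha>" if p: "p\<^sub>0 \<in> P" "p\<^sub>1 \<in> P" for p\<^sub>0 p\<^sub>1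
  \<comment> \<open>The two-pole estimate requires distinct poles; if they coincide, the potential
    takes the same value.\<close>
  proof (cases "E p\<^sub>0 = E p\<^sub>1")
    case True
    then have "potential p\<^sub>1 = potential p\<^sub>0" by (simp add: potential_def)
    moreover have "0 \<le> K" unfolding K_def using Ck mB K2 I0
      by (intro mult_nonneg_nonneg divide_nonneg_nonneg add_nonneg_nonneg sum_nonneg) auto
    ultimately show ?thesis by simp
  next
    case False
    define \<delta> where "\<delta> = norm (E p\<^sub>1 - E p\<^sub>0)"
    have \<delta>0: "0 < \<delta>" using False by (simp add: \<delta>_def)
    have \<delta>B: "\<delta> \<le> 2 * B" using norm_triangle_ineq4[of "E p\<^sub>1" "E p\<^sub>0"] mB(4)[OF p(1)] mB(4)[OF p(2)] by (simp add: \<delta>_def)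
    let ?D = "\<lambda>a p'. \<bar>?g p'\<bar> / (norm (E p' - E p\<^sub>0 / a) * norm (E p' - E p\<^sub>1 / a))"
    define H where "H p' = Ck / m * \<delta> * (?g p' + (\<Sum>a\<in>F. (B / norm a)\<^sup>2 * ?D a p'))" for p'
    have ne: "E p\<^sub>0 / a \<noteq> E p\<^sub>1 / a" if "a \<in> F" for a using False that F by auto
    have H_int: "integrable ?M H"
      unfolding H_def using ne
      by (intro Bochner_Integration.integrable_add Bochner_Integration.integrable_sum integrable_mult_right fint K2)
    have AE: "AE p' in ?M. norm (f p' * ?k p\<^sub>1 p' - f p' * ?k p\<^sub>0 p') \<le> H p'"
      using AE_kernel_dom[of p\<^sub>0] AE_kernel_dom[of p\<^sub>1] AE_space
    proof eventually_elim
      case (elim p')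
      then have p': "p' \<in> unit_square" by simp
      let ?w0 = "E p\<^sub>0 / E p'" and ?w1 = "E p\<^sub>1 / E p'"
      have "?w1 - ?w0 = (E p\<^sub>1 - E p\<^sub>0) / E p'" by (simp add: diff_divide_distrib)
      then have w: "norm (?w1 - ?w0) = \<delta> / norm (E p')" by (simp add: norm_divide \<delta>_def)
      have w: "norm (?w1 - ?w0) \<le> \<delta> / m" unfolding w using mB(1) mB(3)[of p'] p' sub \<delta>0 by (intro frac_le) auto
      have S: "1 / (norm (?w0 - a) * norm (?w1 - a)) \<le> (B / norm a)\<^sup>2 * (1 / (norm (E p' - E p\<^sub>0 / a) * norm (E p' - E p\<^sub>1 / a)))"
        if "a \<in> F" for a
      proof -
        have "1 / (norm (?w0 - a) * norm (?w1 - a)) = 1 / norm (?w0 - a) * (1 / norm (?w1 - a))" by simp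
        also have "\<dots> \<le> (B / norm a * (1 / norm (E p' - E p\<^sub>0 / a))) * (B / norm a * (1 / norm (E p' - E p\<^sub>1 / a)))"
          using mB(2) that p' by (intro mult_mono pole mult_nonneg_nonneg) auto
        also have "\<dots> = (B / norm a)\<^sup>2 * (1 / (norm (E p' - E p\<^sub>0 / a) * norm (E p' - E p\<^sub>1 / a)))" by (simp add: power2_eq_square)
        finally show ?thesis .
      qed
      have "norm (?k p\<^sub>1 p' - ?k p\<^sub>0 p') \<le> Ck * norm (?w1 - ?w0) * (1 + (\<Sum>a\<in>F. 1 / (norm (?w0 - a) * norm (?w1 - a))))"
        using elim quot[OF p(1) p'] quot[OF p(2) p'] by (intro kd) auto
      also have "\<dots> \<le> Ck * (\<delta> / m) * (1 + (\<Sum>a\<in>F. (B / norm a)\<^sup>2 * (1 / (norm (E p' - E p\<^sub>0 / a) * norm (E p' - E p\<^sub>1 / a)))))"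
        using Ck w S \<delta>0 mB(1)
        by (intro mult_mono mult_left_mono add_left_mono sum_mono mult_nonneg_nonneg add_nonneg_nonneg sum_nonneg divide_nonneg_nonneg) auto
      finally have "norm (f p' * ?k p\<^sub>1 p' - f p' * ?k p\<^sub>0 p')
          \<le> ?g p' * (Ck * (\<delta> / m) * (1 + (\<Sum>a\<in>F. (B / norm a)\<^sup>2 * (1 / (norm (E p' - E p\<^sub>0 / a) * norm (E p' - E p\<^sub>1 / a))))))"
        unfolding right_diff_distrib[symmetric] norm_mult by (intro mult_left_mono) auto
      also have "\<dots> = H p'" by (simp add: H_def algebra_simps sum_distrib_left)
      finally show ?case .
    qed
    have diff_int: "integrable ?M (\<lambda>p'. f p' * ?k p\<^sub>1 p' - f p' * ?k p\<^sub>0 p')"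
      using k_int[OF p(1)] k_int[OF p(2)] by (intro Bochner_Integration.integrable_diff)
    have "potential p\<^sub>1 - potential p\<^sub>0 = (\<integral>p'. f p' * ?k p\<^sub>1 p' - f p' * ?k p\<^sub>0 p' \<partial>?M)"
      unfolding potential_def using k_int p by (subst Bochner_Integration.integral_diff) auto
    then have "norm (potential p\<^sub>1 - potential p\<^sub>0) \<le> (\<integral>p'. norm (f p' * ?k p\<^sub>1 p' - f p' * ?k p\<^sub>0 p') \<partial>?M)"
      by (simp add: integral_norm_bound)
    also have "\<dots> \<le> (\<integral>p'. H p' \<partial>?M)" by (rule integral_mono_AE[OF integrable_norm[OF diff_int] H_int AE])
    also have "\<dots> = Ck / m * \<delta> * (I + (\<Sum>a\<in>F. (B / norm a)\<^sup>2 * (\<integral>p'. ?D a p' \<partial>?M)))"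
    proof -
      have i: "integrable ?M (?D a)" if "a \<in> F" for a using ne[OF that] by (rule K2(2))
      have "(\<integral>p'. H p' \<partial>?M) = Ck / m * \<delta> * (\<integral>p'. ?g p' + (\<Sum>a\<in>F. (B / norm a)\<^sup>2 * ?D a p') \<partial>?M)"
        unfolding H_def by (rule integral_mult_right_zero)
      also have "(\<integral>p'. ?g p' + (\<Sum>a\<in>F. (B / norm a)\<^sup>2 * ?D a p') \<partial>?M) = I + (\<integral>p'. (\<Sum>a\<in>F. (B / norm a)\<^sup>2 * ?D a p') \<partial>?M)"
        unfolding I_def by (intro Bochner_Integration.integral_add fint Bochner_Integration.integrable_sum integrable_mult_right i)
      also have "(\<integral>p'. (\<Sum>a\<in>F. (B / norm a)\<^sup>2 * ?D a p') \<partial>?M) = (\<Sum>a\<in>F. \<integral>p'. (B / norm a)\<^sup>2 * ?D a p' \<partial>?M)"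
        by (intro Bochner_Integration.integral_sum integrable_mult_right i)
      also have "\<dots> = (\<Sum>a\<in>F. (B / norm a)\<^sup>2 * (\<integral>p'. ?D a p' \<partial>?M))"
        by (intro sum.cong refl integral_mult_right_zero)
      finally show ?thesis .
    qed
    also have "\<dots> \<le> Ck / m * \<delta> * (I * ((2 * B) powr (1 - \<alpha>) * \<delta> powr (\<alpha> - 1)) + (\<Sum>a\<in>F. (B / norm a)\<^sup>2 * (K2 * (norm a powr (1 - \<alpha>) * \<delta> powr (\<alpha> - 1)))))"
    proof (intro mult_left_mono add_mono sum_mono)
      \<comment> \<open>The regular part is O(\<delta>), better than required; as \<delta> is at
        most \<open>2 * B\<close> it may be weakened to the power \<alpha>.\<close>
      have "1 = \<delta> powr (1 - \<alpha>) * \<delta> powr (\<alpha> - 1)" using \<delta>0 by (simp add: powr_add[symmetric])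
      also have "\<dots> \<le> (2 * B) powr (1 - \<alpha>) * \<delta> powr (\<alpha> - 1)"
        using \<delta>0 \<delta>B \<alpha> by (intro mult_right_mono powr_mono2) auto
      finally have "I * 1 \<le> I * ((2 * B) powr (1 - \<alpha>) * \<delta> powr (\<alpha> - 1))" using I0 by (intro mult_left_mono)
      then show "I \<le> I * ((2 * B) powr (1 - \<alpha>) * \<delta> powr (\<alpha> - 1))" by simp
      fix a assume a: "a \<in> F"
      then have "0 < norm a" using F by auto
      have "E p\<^sub>1 / a - E p\<^sub>0 / a = (E p\<^sub>1 - E p\<^sub>0) / a" by (simp add: diff_divide_distrib)
      then have "norm (E p\<^sub>1 / a - E p\<^sub>0 / a) = \<delta> / norm a" by (simp add: \<delta>_def norm_divide)
      then have "norm (E p\<^sub>1 / a - E p\<^sub>0 / a) powr (d / r - 2) = (\<delta> / norm a) powr (\<alpha> - 1)" by (simp add: \<alpha>_def)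
      also have "\<dots> = \<delta> powr (\<alpha> - 1) / norm a powr (\<alpha> - 1)" by (rule powr_divide)
      also have "\<dots> = norm a powr (1 - \<alpha>) * \<delta> powr (\<alpha> - 1)"
        using powr_minus[of "norm a" "\<alpha> - 1"] by (simp add: divide_inverse mult.commute)
      finally show "(\<integral>p'. ?D a p' \<partial>?M) \<le> K2 * (norm a powr (1 - \<alpha>) * \<delta> powr (\<alpha> - 1))"
        using K2(3)[OF ne[OF a]] by simp
    qed (use Ck mB(1) \<delta>0 in auto)
    also have "\<dots> = Ck / m * (I * (2 * B) powr (1 - \<alpha>) + (\<Sum>a\<in>F. (B / norm a)\<^sup>2 * (K2 * norm a powr (1 - \<alpha>)))) * (\<delta> * \<delta> powr (\<alpha> - 1))"
      by (simp add: algebra_simps sum_distrib_left)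
    also have "\<delta> * \<delta> powr (\<alpha> - 1) = \<delta> powr \<alpha>" using \<delta>0 by (simp add: powr_diff)
    also have "Ck / m * (I * (2 * B) powr (1 - \<alpha>) + (\<Sum>a\<in>F. (B / norm a)\<^sup>2 * (K2 * norm a powr (1 - \<alpha>)))) * \<delta> powr \<alpha>
       \<le> Ck / m * (I * (2 * B) powr (1 - \<alpha>) + (\<Sum>a\<in>F. (B / norm a)\<^sup>2 * (K2 * norm a powr (1 - \<alpha>)))) * (L powr \<alpha> * dist p\<^sub>0 p\<^sub>1 powr \<alpha>)"
    proof (rule mult_left_mono)
      have "\<delta> powr \<alpha> \<le> (L * dist p\<^sub>0 p\<^sub>1) powr \<alpha>" using L(2)[OF p] \<delta>0 \<alpha> by (intro powr_mono2) (auto simp: \<delta>_def)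
      then show "\<delta> powr \<alpha> \<le> L powr \<alpha> * dist p\<^sub>0 p\<^sub>1 powr \<alpha>" by (simp add: powr_mult)
      show "0 \<le> Ck / m * (I * (2 * B) powr (1 - \<alpha>) + (\<Sum>a\<in>F. (B / norm a)\<^sup>2 * (K2 * norm a powr (1 - \<alpha>))))"
        using Ck mB K2 I0 by (intro mult_nonneg_nonneg divide_nonneg_nonneg add_nonneg_nonneg sum_nonneg) auto
    qed
    finally show ?thesis by (simp add: K_def mult.assoc)
  qed
  show thesis using that[OF k_int k_le] holder unfolding \<alpha>_def by blast
qed

section \<open>Periodicity, regularity and the equation for data of mean zero\<close>

context
  assumes mean: "(LINT p:unit_square|lebesgue. f p) = 0"
begin

text \<open>Translation by \<open>(1, 0)\<close> fixes \<open>E\<close>; translation by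
  \<open>(0, 1)\<close> lowers the kernel by 1 and so changes the potential by the integral of
  \<open>f\<close>.\<close>

lemma potential_torus_fun: "torus_fun potential"
  unfolding torus_fun_def
proof (intro allI conjI)
  let ?M = "lebesgue_on unit_square"
  fix p
  show "potential (p + (1, 0)) = potential p" by (simp add: potential_def E_shift)
  \<comment> \<open>A compact convex set containing the square and the given point, so that the
    integral at that point may be split.\<close>
  define P where "P = convex hull (insert p unit_square)"
  have P: "compact P" "convex P"
    unfolding P_def by (intro compact_convex_hull compact_insert compact_unit_square convex_convex_hull)+
  have sub: "insert p unit_square \<subseteq> P" unfolding P_def by (rule hull_subset)
  then have "unit_square \<subseteq> P" by blast
  then have int: "integrable ?M (\<lambda>p'. f p' * torus_kernel q (E p / E p'))"
    by (rule potential_estimates[OF P]) (use sub in blast)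
  have "potential (p + (0, 1)) = (\<integral>p'. f p' * torus_kernel q (E p / E p') - f p' \<partial>?M)"
    unfolding potential_def
  proof (rule integral_cong_AE)
    show "AE p' in ?M. f p' * torus_kernel q (E (p + (0, 1)) / E p') = f p' * torus_kernel q (E p / E p') - f p'"
      using AE_kernel_dom[of p]
    proof eventually_elim
      case (elim p')
      have "E (p + (0, 1)) / E p' = q * (E p / E p')" by (simp add: E_shift)
      then have "torus_kernel q (E (p + (0, 1)) / E p') = torus_kernel q (E p / E p') - 1"
        using nome.kernel_quasi_periodic[OF q_nome conjunct1[OF elim] conjunct2[OF elim]] by (simp only:)
      then show ?case by (simp add: right_diff_distrib)
    qed
  qed measurable
  also have "\<dots> = potential p - (\<integral>p'. f p' \<partial>?M)"
    unfolding potential_def by (rule Bochner_Integration.integral_diff[OF int f_integrable])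
  also have "(\<integral>p'. f p' \<partial>?M) = 0" using mean by (simp add: set_integral_unit_square)
  finally show "potential (p + (0, 1)) = potential p" by simp
qed

text \<open>Two points at distance at most 1 are moved by a common lattice translation into
  \<open>P\<close>, the unit square with margin 1; at larger distances boundedness suffices, since
  the power of the distance is at least 1.\<close>

lemma potential_holder: "holder_torus (d / r - 1) potential"
proof -
  define P :: "plane set" where "P = cbox (-1, -1) (2, 2)"
  have P: "compact P" "convex P" "unit_square \<subseteq> P" unfolding P_def by (rule compact_cbox, rule convex_box) (auto simp: unit_square_def cbox_Pair_eq)
  obtain U K where U: "\<And>p. p \<in> P \<Longrightarrow> (\<integral>p'. norm (f p' * torus_kernel q (E p / E p')) \<partial>lebesgue_on unit_square) \<le> U"
    and K: "\<And>p\<^sub>0 p\<^sub>1. p\<^sub>0 \<in> P \<Longrightarrow> p\<^sub>1 \<in> P \<Longrightarrow> norm (potential p\<^sub>1 - potential p\<^sub>0) \<le> K * dist p\<^sub>0 p\<^sub>1 powr (d / r - 1)"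
    by (rule potential_estimates[OF P]) (rule that)
  have \<alpha>: "0 < d / r - 1" using exponents by (simp add: field_simps)
  have bounded: "norm (potential p) \<le> U" for p
  proof -
    obtain m n where mn: "p + (of_int m, of_int n) \<in> unit_square" using torus_reduce by blast
    have "norm (potential (p + (of_int m, of_int n))) \<le> U"
      unfolding potential_def using mn P(3) by (intro order_trans[OF integral_norm_bound U]) auto
    then show ?thesis by (simp add: torus_fun_shift[OF potential_torus_fun])
  qed
  have "norm (potential p - potential p') \<le> max K (2 * U) * dist p p' powr (d / r - 1)" for p p'
  proof (cases "dist p p' \<le> 1")
    case True
    obtain m n where mn: "p' + (of_int m, of_int n) \<in> unit_square" using torus_reduce by blast
    let ?t = "(of_int m, of_int n) :: plane"
    have dist: "dist (p' + ?t) (p + ?t) = dist p p'" by (simp add: dist_norm norm_minus_commute)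
    have "p + ?t \<in> P"
    proof -
      have "\<bar>fst (p + ?t) - fst (p' + ?t)\<bar> \<le> 1" "\<bar>snd (p + ?t) - snd (p' + ?t)\<bar> \<le> 1"
        using True dist_fst_le[of p p'] dist_snd_le[of p p'] by (simp_all add: dist_real_def)
      moreover have "0 \<le> fst (p' + ?t)" "fst (p' + ?t) \<le> 1" "0 \<le> snd (p' + ?t)" "snd (p' + ?t) \<le> 1"
        using mn by (auto simp: unit_square_def mem_Times_iff)
      ultimately have "-1 \<le> fst (p + ?t)" "fst (p + ?t) \<le> 2" "-1 \<le> snd (p + ?t)" "snd (p + ?t) \<le> 2" by linarith+
      then show ?thesis by (cases "p + ?t") (auto simp: P_def cbox_Pair_eq)
    qed
    then have "norm (potential (p + ?t) - potential (p' + ?t)) \<le> K * dist (p' + ?t) (p + ?t) powr (d / r - 1)"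
      using mn P(3) by (intro K) auto
    then have "norm (potential p - potential p') \<le> K * dist p p' powr (d / r - 1)"
      unfolding dist by (simp add: torus_fun_shift[OF potential_torus_fun])
    also have "\<dots> \<le> max K (2 * U) * dist p p' powr (d / r - 1)" by (intro mult_right_mono) auto
    finally show ?thesis .
  next
    case False
    have U0: "0 \<le> U" using bounded[of p] norm_ge_zero[of "potential p"] by linarith
    have "norm (potential p - potential p') \<le> 2 * U * 1"
      using norm_triangle_ineq4[of "potential p" "potential p'"] bounded[of p] bounded[of p'] by linarith
    also have "\<dots> \<le> max K (2 * U) * dist p p' powr (d / r - 1)"
      using False \<alpha> U0 by (intro mult_mono) (auto intro!: ge_one_powr_ge_zero)
    finally show ?thesis .
  qed
  then show ?thesis using potential_torus_fun unfolding holder_torus_def holder_on_def by blast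
qed

text \<open>After an exchange of integrals the kernel identity evaluates the inner one as
  \<open>c - \<phi> p'\<close> for almost every \<open>p'\<close>. The constant \<open>c\<close>
  does not depend on \<open>p'\<close>, so the vanishing mean of \<open>f\<close> removes
  it.\<close>

lemma potential_weak_solution: "weak_solution a b f potential"
  unfolding weak_solution_def set_integral_unit_square
proof (intro allI impI, elim conjE)
  let ?M = "lebesgue_on unit_square"
  fix \<phi> :: "plane \<Rightarrow> complex" assume \<phi>: "torus_fun \<phi>" "smooth \<phi>"
  have C1: "Ck_on 1 UNIV \<phi>" using \<phi>(2) unfolding smooth_def by blast
  then have \<phi>d: "\<phi> differentiable (at p)" and \<phi>c: "continuous_on UNIV (pd_x \<phi>)" "continuous_on UNIV (pd_y \<phi>)" for p
    unfolding One_nat_def Ck_on.simps by blast+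
  have \<phi>_cont: "continuous_on S \<phi>" for S
    using \<phi>d by (auto intro!: continuous_at_imp_continuous_on differentiable_imp_continuous_within)
  let ?L = "L_op a b \<phi>"
  have L_cont: "continuous_on S ?L" for S
    unfolding L_op_def by (intro continuous_intros continuous_ab \<phi>c[THEN continuous_on_subset[OF _ subset_UNIV]])
  have [measurable]: "?L \<in> borel_measurable ?M" "\<phi> \<in> borel_measurable ?M"
    by (intro continuous_imp_measurable_on_sets_lebesgue L_cont \<phi>_cont; simp)+
  obtain H where H: "0 \<le> H" "\<And>g p. g \<in> {?L, \<phi>} \<Longrightarrow> p \<in> unit_square \<Longrightarrow> norm (g p) \<le> H"
    by (rule uniform_bound_on_compact[of "{?L, \<phi>}", OF _ compact_unit_square]) (use L_cont \<phi>_cont in auto)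
  define c where "c = (\<integral>x. indicator {0..1} x *\<^sub>R (\<phi> (x, 0) * a (x, 0)) \<partial>lborel)"
  have unit_square_P: "compact unit_square" "convex unit_square" "unit_square \<subseteq> unit_square"
    using compact_unit_square by (auto simp: unit_square_cbox)
  obtain U where int: "\<And>p. p \<in> unit_square \<Longrightarrow> integrable ?M (\<lambda>p'. f p' * torus_kernel q (E p / E p'))"
    and U: "\<And>p. p \<in> unit_square \<Longrightarrow> (\<integral>p'. norm (f p' * torus_kernel q (E p / E p')) \<partial>?M) \<le> U"
    by (rule potential_estimates[OF unit_square_P]) (rule that)
  interpret finite_measure ?M
    by (rule finite_measureI) (simp add: emeasure_restrict_space emeasure_unit_square)
  interpret pair_sigma_finite ?M ?M ..
  let ?F = "\<lambda>p p'. f p' * torus_kernel q (E p / E p') * ?L p"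
  have F_int: "integrable (?M \<Otimes>\<^sub>M ?M) (\<lambda>(p, p'). ?F p p')"
  proof (rule Fubini_integrable)
    show "(\<lambda>(p, p'). ?F p p') \<in> borel_measurable (?M \<Otimes>\<^sub>M ?M)" by measurable
    show "AE p in ?M. integrable ?M (\<lambda>p'. case (p, p') of (p, p') \<Rightarrow> ?F p p')"
      using int by (intro AE_I2) auto
    show "integrable ?M (\<lambda>p. \<integral>p'. norm (case (p, p') of (p, p') \<Rightarrow> ?F p p') \<partial>?M)"
    proof (rule Bochner_Integration.integrable_bound[OF integrable_const[of "U * H"]], measurable, intro AE_I2)
      fix p assume "p \<in> space ?M"
      then have p: "p \<in> unit_square" by simp
      have "(\<integral>p'. norm (?F p p') \<partial>?M) = (\<integral>p'. norm (f p' * torus_kernel q (E p / E p')) * norm (?L p) \<partial>?M)"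
        by (simp only: norm_mult)
      also have "\<dots> = (\<integral>p'. norm (f p' * torus_kernel q (E p / E p')) \<partial>?M) * norm (?L p)"
        by (rule integral_mult_left_zero)
      also have "\<dots> \<le> U * H"
        using U[OF p] H(2)[of ?L, OF _ p] H(1) order_trans[OF _ U[OF p]] by (intro mult_mono) auto
      finally have "(\<integral>p'. norm (?F p p') \<partial>?M) \<le> U * H" .
      moreover have "0 \<le> (\<integral>p'. norm (?F p p') \<partial>?M)" by simp
      ultimately show "norm (\<integral>p'. norm (case (p, p') of (p, p') \<Rightarrow> ?F p p') \<partial>?M) \<le> norm (U * H)"
        unfolding prod.case by simp
    qed
  qed
  have "(\<integral>p. potential p * ?L p \<partial>?M) = (\<integral>p. (\<integral>p'. ?F p p' \<partial>?M) \<partial>?M)"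
    unfolding potential_def by (intro Bochner_Integration.integral_cong refl integral_mult_left_zero[symmetric])
  also have "\<dots> = (\<integral>p'. (\<integral>p. ?F p p' \<partial>?M) \<partial>?M)"
    using Fubini_integral[OF F_int] by simp
  also have "\<dots> = (\<integral>p'. f p' * c - f p' * \<phi> p' \<partial>?M)"
  proof (rule integral_cong_AE)
    show "(\<lambda>p'. \<integral>p. ?F p p' \<partial>?M) \<in> borel_measurable ?M" by measurable
    show "AE p' in ?M. (\<integral>p. ?F p p' \<partial>?M) = f p' * c - f p' * \<phi> p'"
      using AE_noncharacteristic
    proof eventually_elim
      case (elim p')
      have "(\<integral>p. ?F p p' \<partial>?M) = f p' * (\<integral>p. torus_kernel q (E p / E p') * ?L p \<partial>?M)"
        unfolding mult.assoc by (rule integral_mult_right_zero)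
      also have "\<dots> = f p' * (c - \<phi> p')" using kernel_identity[OF \<phi>(1) C1] elim by (simp add: c_def)
      finally show ?case by (simp add: right_diff_distrib)
    qed
  qed measurable
  also have "\<dots> = (\<integral>p'. f p' * c \<partial>?M) - (\<integral>p'. f p' * \<phi> p' \<partial>?M)"
  proof (rule Bochner_Integration.integral_diff)
    show "integrable ?M (\<lambda>p'. f p' * c)" using f_integrable by simp
    have "integrable ?M (\<lambda>p'. norm (f p') * H)" using f_integrable by simp
    then show "integrable ?M (\<lambda>p'. f p' * \<phi> p')"
    proof (rule Bochner_Integration.integrable_bound, measurable, intro AE_I2)
      fix p assume "p \<in> space ?M"
      then have "norm (\<phi> p) \<le> H" using H(2)[of \<phi>] by simp
      then show "norm (f p * \<phi> p) \<le> norm (norm (f p) * H)" using H(1) by (simp add: norm_mult mult_left_mono)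
    qed
  qed
  also have "(\<integral>p'. f p' * c \<partial>?M) = 0" using mean by (simp add: set_integral_unit_square)
  finally show "- (\<integral>p. potential p * ?L p \<partial>?M) = (\<integral>p. f p * \<phi> p \<partial>?M)" by simp
qed

end

end

end

section \<open>From the components of the characteristic set to the local setting\<close>

theorem theorem3p2:
  fixes a b f :: "plane \<Rightarrow> complex"
    and \<omega> :: "plane \<Rightarrow> plane \<Rightarrow> complex"
    and \<epsilon> q r \<mu> \<alpha> \<sigma>max :: real
    and \<tau> :: complex
    and N :: nat
    and \<Sigma>c :: "nat \<Rightarrow> (complex \<times> complex) set"
    and \<sigma> :: "nat \<Rightarrow> real"
  assumes eps: "0 < \<epsilon>" "\<epsilon> \<le> 1"
    and torus: "torus_fun a" "torus_fun b"
    and regular: "C1_holder_on \<epsilon> UNIV a" "C1_holder_on \<epsilon> UNIV b"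
    and omega: "\<omega> = one_form a b"
    and nonvanishing: "\<And>p. \<omega> p \<noteq> (\<lambda>v. 0)"
    and closed: "closed_form a b"
    and curve: "embedded_curve (char_lift \<omega>)"
    and comps: "1 \<le> N" "bij_betw \<Sigma>c {1..N} (components (torus_proj ` char_lift \<omega>))"
    and sigma_pos: "\<And>i. i \<in> {1..N} \<Longrightarrow> 0 < \<sigma> i"
    and order: "\<And>i. i \<in> {1..N} \<Longrightarrow> vanishes_to_order \<omega> (torus_proj -` \<Sigma>c i) (\<sigma> i)"
    and hypo: "hypocomplex \<epsilon> \<omega>"
    and normal: "\<And>i. i \<in> {1..N} \<Longrightarrow> normal_form \<omega> (torus_proj -` \<Sigma>c i) (\<sigma> i)"
    and sigma_max: "\<sigma>max = Max (\<sigma> ` {1..N})"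
    and normalization:
      "\<And>p. primitive \<omega> (p + (1, 0)) = primitive \<omega> p + 1"
      "\<And>p. primitive \<omega> (p + (0, 1)) = primitive \<omega> p + \<tau>"
      "Im \<tau> > 0"
    and f: "Lq_torus q f" "q > 2 + \<sigma>max"
    and exponents: "r = q / (q - 1)" "\<mu> = \<sigma>max / (\<sigma>max + 1)" "\<alpha> = (2 - r - \<mu>) / r"
  shows "(\<exists>u. holder_torus \<alpha> u \<and> weak_solution a b f u)
           \<longleftrightarrow> (LINT p:unit_square|lebesgue. f p) = 0"
proof
  assume "\<exists>u. holder_torus \<alpha> u \<and> weak_solution a b f u"
  then show "(LINT p:unit_square|lebesgue. f p) = 0" using weak_solution_imp_mean_zero by blast
next
  assume mean: "(LINT p:unit_square|lebesgue. f p) = 0"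
  have le: "\<sigma> i \<le> \<sigma>max" if "i \<in> {1..N}" for i
    unfolding sigma_max using that by (intro Max_ge) auto
  have pos: "0 < \<sigma>max" using sigma_pos[of 1] le[of 1] comps(1) by simp
  interpret T: normal_torus_form a b \<tau> \<sigma>max
  proof
    show "Ck_on 1 UNIV a" "Ck_on 1 UNIV b" using regular by (simp_all only: C1_holder_on_def)
    show "primitive (one_form a b) (p + (1, 0)) = primitive (one_form a b) p + 1"
      "primitive (one_form a b) (p + (0, 1)) = primitive (one_form a b) p + \<tau>" for p
      using normalization(1,2)[of p] by (simp_all only: omega)
    fix p assume "p \<in> char_lift (one_form a b)"
    \<comment> \<open>Every characteristic point lies over some component, which supplies the local
      exponent and normal form.\<close>
    then have "torus_proj p \<in> \<Union> (components (torus_proj ` char_lift \<omega>))"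
      unfolding Union_components omega by blast
    then obtain S where "S \<in> components (torus_proj ` char_lift \<omega>)" "torus_proj p \<in> S" by blast
    then obtain i where i: "i \<in> {1..N}" "p \<in> torus_proj -` \<Sigma>c i"
      using bij_betw_imp_surj_on[OF comps(2)] by (metis imageE vimageI)
    obtain U s t h where "p \<in> U" "C1_coords U s t"
      "\<forall>p'\<in>U. h p' \<noteq> 0 \<and> (\<forall>v. \<omega> p' v = h p' * (of_real (frechet_derivative s (at p') v)
         + \<i> * of_real (\<bar>t p'\<bar> powr \<sigma> i) * of_real (frechet_derivative t (at p') v)))"
      using normal[OF i(1)] i(2) unfolding normal_form_def by meson
    then show "\<exists>\<sigma> U s t h. 0 < \<sigma> \<and> \<sigma> \<le> \<sigma>max \<and> p \<in> U \<and> C1_coords U s t \<and>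
      (\<forall>p'\<in>U. h p' \<noteq> 0 \<and> (\<forall>v. one_form a b p' v = h p' * (of_real (frechet_derivative s (at p') v)
         + \<i> * of_real (\<bar>t p'\<bar> powr \<sigma>) * of_real (frechet_derivative t (at p') v))))"
      using sigma_pos[OF i(1)] le[OF i(1)] unfolding omega by blast
  qed (use torus closed normalization(3) pos in auto)
  have "r \<noteq> 0" using f(2) pos by (simp add: exponents(1))
  then have "\<alpha> = T.d / r - 1" by (simp add: exponents(2,3) T.d_def field_simps)
  then show "\<exists>u. holder_torus \<alpha> u \<and> weak_solution a b f u"
    using T.potential_holder[OF f exponents(1) mean] T.potential_weak_solution[OF f exponents(1) mean] by blast
qed

end
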